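(* Let $d\in\mathbb N$, $s>\frac{1+\log_2d}{2}$, $\beta:=2s/(1+\log_2d)>1$ and $r>1$. For $n\in\mathbb N$, $n\ge3$, define $m$ by $$m=\Big\lfloor\frac{n}{10r\log n}\Big\rfloor .$$ Let $\mathbf X=(x^1,\dots,x^n)$ be drawn i.i.d. from the normalized Lebesgue measure $(2\pi)^{-d}dx$ on $\mathbb T^d$. Then $$\mathbb P\Big(\sup_{\|f\|_{H^{s,\#}_{\rm mix}(\mathbb T^d)}\le1}\|f-S^m_{\mathbf X}f\|^2_{L_\infty(\mathbb T^d)}\le1612\Big(\frac{16}{3}\Big)^{\beta}\frac{\beta}{\beta-1}\Big(\frac m2-1\Big)^{-\beta+1}\Big)\ge1-3n^{1-r}.$$
   Context: $\log$ is the natural logarithm. $\mathbb T=[0,2\pi]$ with endpoints identified. For $f\in L_2(\mathbb T^d)$, $c_k(f)=(2\pi)^{-d}\int_{\mathbb T^d}f(x)e^{-ik\cdot x}dx$, $k\in\mathbb Z^d$. The space $H^{s,\#}_{\rm mix}(\mathbb T^d)$ consists of all $f\in L_2(\mathbb T^d)$ with $$\|f\|_{H^{s,\#}_{\rm mix}(\mathbb T^d)}=\Big(\sum_{k\in\mathbb Z^d}|c_k(f)|^2\prod_{j=1}^d(1+|k_j|)^{2s}\Big)^{1/2}<\infty$$ (for $s>1/2$ its elements are identified with continuous functions). Plain (non-weighted) least squares operator $S^m_{\mathbf X}$: order $\mathbb Z^d$ as $k^{(1)},k^{(2)},\dots$ so that the weights $\prod_{j=1}^d(1+|k_j|)^{s}$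 are non-decreasing (ties broken arbitrarily), and let $\eta_l(x)=e^{ik^{(l)}\cdot x}$. With $\mathbf L=(\eta_l(x^j))_{j=1,l=1}^{n,\,m-1}$ of full column rank and $\mathbf f=(f(x^1),\dots,f(x^n))^\top$, put $(c_1,\dots,c_{m-1})^\top=(\mathbf L^*\mathbf L)^{-1}\mathbf L^*\mathbf f$ and $S^m_{\mathbf X}f=\sum_{l=1}^{m-1}c_l\eta_l$. The event in the claim is understood to include that $\mathbf L$ has full column rank.
   Formalization: For m ≤ 2 the factor (m/2−1)^{−β+1} is undefined (or negative, making the claim false, e.g. d=1, s=1, r=2, n=100, m=1); there the bound is read as +∞, so only full column rank of L is asserted; for m ≥ 3 the bound is literal. *)

theory Defs
  imports
    "HOL-Probability.Probability"
    "Jordan_Normal_Form.DL_Rank"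
    "Jordan_Normal_Form.Gauss_Jordan_Elimination"
    "Jordan_Normal_Form.Schur_Decomposition"
begin

text \<open>
  The dimension \<open>d\<close> is \<open>CARD('d)\<close>. Functions on the torus are functions on \<open>real ^ 'd\<close> that are
  \<open>2 * pi\<close>-periodic in every coordinate; \<open>torus_cube\<close> is a fundamental domain up to its null boundary.
  Both Jordan_Normal_Form and HOL-Analysis use \<open>$\<close>, so the access functions are written out.
\<close>

definition torus_cube :: "(real ^ 'd) set" where
  "torus_cube = {x. \<forall>j. 0 \<le> vec_nth x j \<and> vec_nth x j \<le> 2 * pi}"

definition torus_measure :: "(real ^ 'd) measure" where
  "torus_measure = uniform_measure lborel torus_cube"

definition torus_periodic :: "(real ^ 'd \<Rightarrow> complex) \<Rightarrow> bool" where
  "torus_periodic f \<longleftrightarrow> (\<forall>x j. f (x + axis j (2 * pi)) = f x)"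

definition torus_L2 :: "(real ^ 'd \<Rightarrow> complex) set" where
  "torus_L2 = {f. torus_periodic f \<and> f \<in> borel_measurable borel \<and>
      set_integrable lborel torus_cube (\<lambda>x. (cmod (f x))\<^sup>2)}"

definition torus_Linf_norm :: "(real ^ 'd \<Rightarrow> complex) \<Rightarrow> ereal" where
  "torus_Linf_norm f = esssup torus_measure (\<lambda>x. ereal (cmod (f x)))"

definition freq_dot :: "int ^ 'd \<Rightarrow> real ^ 'd \<Rightarrow> real" where
  "freq_dot k x = (\<Sum>j\<in>UNIV. real_of_int (vec_nth k j) * vec_nth x j)"

definition fourier_coeff :: "(real ^ 'd \<Rightarrow> complex) \<Rightarrow> int ^ 'd \<Rightarrow> complex" where
  "fourier_coeff f k =
     (LINT x:torus_cube|lborel. f x * cis (- freq_dot k x)) / of_real ((2 * pi) ^ CARD('d))"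

definition mix_weight :: "real \<Rightarrow> int ^ 'd \<Rightarrow> real" where
  "mix_weight s k = (\<Prod>j\<in>UNIV. (1 + real_of_int \<bar>vec_nth k j\<bar>) powr s)"

definition Hmix :: "real \<Rightarrow> (real ^ 'd \<Rightarrow> complex) set" where
  "Hmix s = {f \<in> torus_L2.
      (\<lambda>k. (cmod (fourier_coeff f k))\<^sup>2 * mix_weight (2 * s) k) summable_on UNIV}"

definition Hmix_norm :: "real \<Rightarrow> (real ^ 'd \<Rightarrow> complex) \<Rightarrow> real" where
  "Hmix_norm s f = sqrt (\<Sum>\<^sub>\<infinity>k. (cmod (fourier_coeff f k))\<^sup>2 * mix_weight (2 * s) k)"

text \<open>
  Elements of \<open>Hmix s\<close> (\<open>s > 1/2\<close>) are identified with their continuous representatives, which is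
  what gives meaning to the point values used by the least squares operator.
\<close>

definition Hmix_unit_ball :: "real \<Rightarrow> (real ^ 'd \<Rightarrow> complex) set" where
  "Hmix_unit_ball s = {f \<in> Hmix s. continuous_on UNIV f \<and> Hmix_norm s f \<le> 1}"

definition weight_ordering :: "real \<Rightarrow> (nat \<Rightarrow> int ^ 'd) \<Rightarrow> bool" where
  "weight_ordering s \<kappa> \<longleftrightarrow>
     bij_betw \<kappa> {1..} UNIV \<and> mono_on {1..} (\<lambda>l. mix_weight s (\<kappa> l))"

definition trig_basis :: "(nat \<Rightarrow> int ^ 'd) \<Rightarrow> nat \<Rightarrow> real ^ 'd \<Rightarrow> complex" where
  "trig_basis \<kappa> l x = cis (freq_dot (\<kappa> l) x)"

text \<open>
  Matrix and vector entries are indexed from \<open>0\<close>, whereas the points \<open>X j\<close> and the basis functions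
  are indexed from \<open>1\<close>.
\<close>

definition lsq_matrix ::
  "(nat \<Rightarrow> int ^ 'd) \<Rightarrow> nat \<Rightarrow> nat \<Rightarrow> (nat \<Rightarrow> real ^ 'd) \<Rightarrow> complex mat" where
  "lsq_matrix \<kappa> m n X =
     Matrix.mat n (m - 1) (\<lambda>(i, l). trig_basis \<kappa> (Suc l) (X (Suc i)))"

definition full_column_rank :: "complex mat \<Rightarrow> bool" where
  "full_column_rank A \<longleftrightarrow> vec_space.rank (dim_row A) A = dim_col A"

text \<open>
  \<open>mat_inverse\<close> returns \<open>None\<close> exactly when the inverse does not exist; for a matrix of full column
  rank the Gram matrix below is invertible.
\<close>

definition lsq_coeffs ::
  "(nat \<Rightarrow> int ^ 'd) \<Rightarrow> nat \<Rightarrow> nat \<Rightarrow> (nat \<Rightarrow> real ^ 'd) \<Rightarrow> (real ^ 'd \<Rightarrow> complex) \<Rightarrow> complex Matrix.vec"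
  where
  "lsq_coeffs \<kappa> m n X f =
     (let L = lsq_matrix \<kappa> m n X in
      (the (mat_inverse (mat_adjoint L * L)) * mat_adjoint L)
        *\<^sub>v Matrix.vec n (\<lambda>i. f (X (Suc i))))"

definition lsq_operator ::
  "(nat \<Rightarrow> int ^ 'd) \<Rightarrow> nat \<Rightarrow> nat \<Rightarrow> (nat \<Rightarrow> real ^ 'd) \<Rightarrow> (real ^ 'd \<Rightarrow> complex)
     \<Rightarrow> real ^ 'd \<Rightarrow> complex" where
  "lsq_operator \<kappa> m n X f x =
     (\<Sum>l = 1..m - 1. vec_index (lsq_coeffs \<kappa> m n X f) (l - 1) * trig_basis \<kappa> l x)"

text \<open>
  A real power with negative exponent \<open>p\<close>: at \<open>x = 0\<close> it is \<open>\<infinity>\<close>, whereas \<open>0 powr p = 0\<close>. For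
  \<open>x < 0\<close> the power is undefined and \<open>powr\<close> returns an arbitrary value; as an upper bound it is
  also read as \<open>\<infinity>\<close>, so that nothing is claimed there.
\<close>

definition neg_powr :: "real \<Rightarrow> real \<Rightarrow> ereal" where
  "neg_powr x p = (if 0 < x then ereal (x powr p) else \<infinity>)"

end

theory Submission
  imports Defs
begin

text \<open>
  Write \<open>\<sigma> l\<close> for the reciprocal squared weight of the \<open>l\<close>-th frequency. Counting the lattice points of a
  hyperbolic cross gives \<open>\<sigma> l \<le> (9 / l) powr \<beta>\<close>, so that \<open>B\<close>, the sum of \<open>\<sigma> l\<close> over \<open>l \<ge> m\<close>, is of the order
  \<open>m powr (1 - \<beta>)\<close>. A function in the unit ball differs from its truncated Fourier series by at most \<open>sqrt B\<close>
  uniformly. The least squares fit of that remainder is small as soon as two events hold: the smallest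
  eigenvalue of the Gram matrix of the first \<open>m - 1\<close> characters at the sample points is at least \<open>n / 4\<close>,
  and the largest eigenvalue of the weighted Gram matrix of the characters with \<open>l \<ge> m\<close> is at most of the order
  \<open>n * \<sigma> m + B * r * ln n\<close>.

  Both events follow from a moment bound for the off-diagonal part \<open>A\<close> of a weighted Gram matrix, whose
  diagonal is deterministic. The expected trace of \<open>A ^ p\<close> is a sum over words \<open>w\<close> of length \<open>p\<close>
  in the \<open>n\<close> sample points of the weighted number of closed frequency paths that are balanced along each
  letter. No letter may occur exactly once, and each letter costs one degree of freedom, which bounds
  the count by a product over letters. This product is dominated by moments of three-point random
  variables, and their exponential moments finish the estimate without any matrix concentration inequality.
\<close>

subsection \<open>Balanced tuples along a word\<close>

text \<open>An even power of the operator norm is at most the trace of that power, and the expected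
  trace is an exact count, because a product of characters has mean \<open>0\<close> or
  \<open>1\<close>. The prefactor of the moment bound is \<open>W / \<tau>\<close>, a bound for
  trace over norm, and not the size of the matrix. This overcomes the obstacle of the second event,
  its infinitely many frequencies: they are cut at an index \<open>M\<close> so far out that the
  rest of the weights sums to at most \<open>B / n\<close>. The rest then costs only
  \<open>B\<close> after summation over the \<open>n\<close> points, and \<open>M\<close> enters no
  constant. The order \<open>p\<close> pays for the failure probability: it exceeds
  \<open>n * \<tau> / (5 * W)\<close> by enough for \<open>exp (- p)\<close> to supply the factor
  \<open>n powr (- r)\<close>.

  The constants leave room. Counting gives \<open>9 powr \<beta>\<close> with
  \<open>9 \<le> 2 * (16 / 3)\<close>, the factor \<open>2\<close> is absorbed in passing from
  \<open>m - 1\<close> to \<open>m / 2 - 1\<close>, and the estimate ends with \<open>86\<close> in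
  place of \<open>1612\<close>. For \<open>m \<le> 2\<close> the claimed bound is infinite and only
  the rank is at stake. The supremum runs over an uncountable ball, so the measurability of the
  event is a separate matter.\<close>

definition cyc_succ :: "nat \<Rightarrow> nat \<Rightarrow> nat" where
  "cyc_succ p a = (if Suc a = p then 0 else Suc a)"

lemma bij_betw_cyc_succ: "bij_betw (cyc_succ p) {..<p} {..<p}"
proof (intro bij_betwI)
  let ?g = "\<lambda>a. if a = 0 then p - 1 else a - 1"
  show "cyc_succ p \<in> {..<p} \<rightarrow> {..<p}" "?g \<in> {..<p} \<rightarrow> {..<p}"
    by (auto simp: cyc_succ_def)
  show "?g (cyc_succ p x) = x" if "x \<in> {..<p}" for x
    using that by (auto simp: cyc_succ_def)
  show "cyc_succ p (?g y) = y" if "y \<in> {..<p}" for y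
    using that by (auto simp: cyc_succ_def)
qed

definition balanced :: "nat \<Rightarrow> (nat \<Rightarrow> nat) \<Rightarrow> (nat \<Rightarrow> 'g::ab_group_add) \<Rightarrow> bool" where
  "balanced p w k \<longleftrightarrow> (\<forall>j. (\<Sum>a | a < p \<and> w a = j. k a - k (cyc_succ p a)) = 0)"

text \<open>
  Position \<open>0\<close> and all positions whose letter has occurred before. A balanced tuple is determined by its
  values there: going down from the last position, the value at the first occurrence of a letter
  is given by the balance condition of that letter.
\<close>

definition later_positions :: "nat \<Rightarrow> (nat \<Rightarrow> nat) \<Rightarrow> nat set" where
  "later_positions p w = {a. a < p \<and> (a = 0 \<or> (\<exists>b<a. w b = w a))}"

lemma finite_later_positions [simp]: "finite (later_positions p w)"
  by (simp add: later_positions_def)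

lemma later_positions_subset: "later_positions p w \<subseteq> {..<p}"
  by (auto simp: later_positions_def)

text \<open>Position \<open>0\<close> is a first occurrence that is counted nevertheless, hence the
  \<open>Suc\<close>. One value has to stay free: the balance conditions of all letters telescope to
  \<open>0\<close> around the cycle, so at most all but one of them are independent.\<close>

lemma card_later_positions:
  assumes "p > 0"
  shows "card (later_positions p w) + card (w ` {..<p}) = Suc p"
proof -
  define Fo where "Fo = {a. a < p \<and> (\<forall>b<a. w b \<noteq> w a)}"
  have fin: "finite Fo" by (simp add: Fo_def)
  have inj: "inj_on w Fo"
    by (rule inj_onI) (metis (mono_tags, lifting) Fo_def linorder_neqE_nat mem_Collect_eq)
  have "w ` Fo = w ` {..<p}"
  proof
    show "w ` {..<p} \<subseteq> w ` Fo"
    proof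
      fix j assume "j \<in> w ` {..<p}"
      then obtain a where a: "a < p" "w a = j" by auto
      define b where "b = (LEAST b. w b = j)"
      have "w b = j" unfolding b_def using a(2) by (rule LeastI)
      moreover have "b \<le> a" unfolding b_def using a(2) by (rule Least_le)
      moreover have "w c \<noteq> j" if "c < b" for c
        using that unfolding b_def by (rule not_less_Least)
      ultimately have "b \<in> Fo" using a by (auto simp: Fo_def)
      then show "j \<in> w ` Fo" using \<open>w b = j\<close> by blast
    qed
  qed (auto simp: Fo_def)
  then have cFo: "card Fo = card (w ` {..<p})"
    using card_image[OF inj] by simp
  have un: "later_positions p w = ({..<p} - Fo) \<union> {0}"
    using assms by (auto simp: later_positions_def Fo_def)
  have "0 \<in> Fo" using assms by (simp add: Fo_def)
  then have "card (later_positions p w) = Suc (card ({..<p} - Fo))"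
    unfolding un by (subst card_Un_disjoint) auto
  also have "card ({..<p} - Fo) = p - card Fo"
    by (subst card_Diff_subset) (auto simp: fin Fo_def)
  finally have "card (later_positions p w) = Suc (p - card Fo)" .
  moreover have "card Fo \<le> p"
    using card_mono[of "{..<p}" Fo] by (auto simp: Fo_def)
  ultimately show ?thesis using cFo by simp
qed

lemma balanced_eqI:
  fixes k k' :: "nat \<Rightarrow> 'g::ab_group_add"
  assumes bal: "balanced p w k" "balanced p w k'"
    and eq: "\<And>a. a \<in> later_positions p w \<Longrightarrow> k a = k' a"
    and "a < p"
  shows "k a = k' a"
  using \<open>a < p\<close>
proof (induction "p - a" arbitrary: a rule: less_induct)
  case less
  show ?case
  proof (cases "a \<in> later_positions p w")
    case False
    then have first: "\<And>b. b < a \<Longrightarrow> w b \<noteq> w a" and "0 < a"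
      using less.prems by (auto simp: later_positions_def)
    define h where "h = (\<lambda>b. k b - k' b)"
    have IH: "h b = 0" if "a < b" "b < p" for b
      using less.hyps[of b] that by (simp add: h_def)
    \<comment> \<open>The last position wraps around to \<open>0\<close>, whose value is free. This
      starts the descent and settles \<open>cyc_succ p b\<close> for every
      \<open>b \<ge> a\<close>.\<close>
    have h0: "h 0 = 0"
      using less.prems by (simp add: h_def eq later_positions_def)
    have nxt: "h (cyc_succ p b) = 0" if "a \<le> b" "b < p" for b
      using that h0 IH[of "Suc b"] by (auto simp: cyc_succ_def)
    have "0 = (\<Sum>b | b < p \<and> w b = w a. k b - k (cyc_succ p b))
            - (\<Sum>b | b < p \<and> w b = w a. k' b - k' (cyc_succ p b))"
      using bal by (simp add: balanced_def)
    also have "\<dots> = (\<Sum>b | b < p \<and> w b = w a. h b - h (cyc_succ p b))"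
      by (simp add: sum_subtractf[symmetric] h_def algebra_simps)
    also have "\<dots> = (\<Sum>b\<in>{a}. h b - h (cyc_succ p b))"
    proof (rule sum.mono_neutral_right)
      show "\<forall>i\<in>{b. b < p \<and> w b = w a} - {a}. h i - h (cyc_succ p i) = 0"
        using first IH nxt by (metis (mono_tags, lifting) Diff_iff diff_zero leI le_eq_less_or_eq
            mem_Collect_eq singletonI)
    qed (use less.prems in auto)
    also have "\<dots> = h a" using nxt[of a] less.prems by simp
    finally show ?thesis by (simp add: h_def)
  qed (rule eq)
qed

lemma balanced_multiplicity:
  fixes k :: "nat \<Rightarrow> 'g::ab_group_add"
  assumes "balanced p w k" and "\<And>a. a < p \<Longrightarrow> k a \<noteq> k (cyc_succ p a)"
  shows "card {a. a < p \<and> w a = j} \<noteq> 1"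
proof
  assume "card {a. a < p \<and> w a = j} = 1"
  then obtain a where a: "{a. a < p \<and> w a = j} = {a}" by (rule card_1_singletonE)
  then have "k a - k (cyc_succ p a) = 0"
    using assms(1)[unfolded balanced_def, rule_format, of j] by simp
  then show False using assms(2)[of a] a by auto
qed

text \<open>The share of a letter with \<open>c\<close> occurrences: an absent letter is neutral, a
  single occurrence is impossible, and any other number costs one factor
  \<open>\<rho> = \<tau> / W\<close>.\<close>

definition word_weight :: "real \<Rightarrow> nat \<Rightarrow> real" where
  "word_weight \<rho> c = (if c = 0 then 1 else if c = 1 then 0 else \<rho>)"

text \<open>With \<open>d\<close> letters in use, \<open>p + 1 - d\<close> values are free and yield
  at most \<open>W\<close> each after summation, while the other \<open>d - 1\<close> are determined
  and at most \<open>\<tau>\<close> each. The product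
  \<open>\<tau> ^ (d - 1) * W ^ (p + 1 - d)\<close> is then distributed as one factor
  \<open>\<tau> / W\<close> per letter, which leaves \<open>W / \<tau>\<close> over.\<close>

lemma sum_balanced_le:
  fixes u :: "'g::ab_group_add \<Rightarrow> real"
  assumes F: "finite F" and J: "finite J" and p: "p > 0"
    and w: "w \<in> {..<p} \<rightarrow> J"
    and u: "\<And>x. x \<in> F \<Longrightarrow> 0 \<le> u x" "\<And>x. x \<in> F \<Longrightarrow> u x \<le> \<tau>"
    and W: "sum u F \<le> W" "0 < W" and \<tau>: "0 < \<tau>"
  shows "(\<Sum>k | k \<in> {..<p} \<rightarrow>\<^sub>E F \<and> balanced p w k \<and> (\<forall>a<p. k a \<noteq> k (cyc_succ p a)).
            \<Prod>a<p. u (k a))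
       \<le> (W / \<tau>) * W ^ p * (\<Prod>j\<in>J. word_weight (\<tau> / W) (card {a. a < p \<and> w a = j}))"
    (is "sum ?f ?K \<le> ?R")
proof (cases "?K = {}")
  case True
  have "0 \<le> word_weight (\<tau> / W) c" for c using W \<tau> by (simp add: word_weight_def)
  then have "0 \<le> ?R" using W \<tau> by (intro mult_nonneg_nonneg prod_nonneg) auto
  then show ?thesis by (subst True) simp
next
  case False
  let ?C = "later_positions p w"
  let ?d = "card (w ` {..<p})"
  have finK: "finite ?K"
    by (rule finite_subset[of _ "{..<p} \<rightarrow>\<^sub>E F"]) (auto intro: finite_PiE F)
  have finC: "finite (?C \<rightarrow>\<^sub>E F)" by (intro finite_PiE F finite_later_positions)
  \<comment> \<open>One admissible tuple is enough to see that no letter of \<open>w\<close> occurs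
    exactly once; this is why the empty case was split off.\<close>
  obtain k0 where "k0 \<in> ?K" using False by blast
  then have mult: "card {a. a < p \<and> w a = j} \<noteq> 1" for j
    by (intro balanced_multiplicity[of p w k0]) auto
  have d: "?d > 0" using p by (auto simp: card_gt_0_iff)
  have cC: "card ?C + ?d = Suc p" by (rule card_later_positions[OF p])
  have dle: "?d \<le> p" using card_image_le[of "{..<p}" w] by simp
  have step: "?f k \<le> \<tau> ^ (?d - 1) * (\<Prod>a\<in>?C. u (restrict k ?C a))" if "k \<in> ?K" for k
  proof -
    have kF: "k a \<in> F" if "a < p" for a using that \<open>k \<in> ?K\<close> by auto
    have "?f k = (\<Prod>a\<in>{..<p} - ?C. u (k a)) * (\<Prod>a\<in>?C. u (k a))"
      by (rule prod.subset_diff) (auto simp: later_positions_subset)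
    also have "\<dots> \<le> \<tau> ^ card ({..<p} - ?C) * (\<Prod>a\<in>?C. u (k a))"
    proof (rule mult_right_mono)
      have "(\<Prod>a\<in>{..<p} - ?C. u (k a)) \<le> (\<Prod>a\<in>{..<p} - ?C. \<tau>)"
        by (rule prod_mono) (use u kF in auto)
      then show "(\<Prod>a\<in>{..<p} - ?C. u (k a)) \<le> \<tau> ^ card ({..<p} - ?C)" by simp
      show "0 \<le> (\<Prod>a\<in>?C. u (k a))"
        by (rule prod_nonneg) (use u kF in \<open>auto simp: later_positions_def\<close>)
    qed
    also have "card ({..<p} - ?C) = ?d - 1"
      using cC d dle by (subst card_Diff_subset) (auto simp: later_positions_subset)
    finally show ?thesis by simp
  qed
  \<comment> \<open>A balanced tuple is recovered from its free values, so the sum may be moved to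
    tuples on \<open>?C\<close> and enlarged there to all of them.\<close>
  have inj: "inj_on (\<lambda>k. restrict k ?C) ?K"
  proof (rule inj_onI)
    fix k k' assume kk: "k \<in> ?K" "k' \<in> ?K" "restrict k ?C = restrict k' ?C"
    have "k a = k' a" if "a < p" for a
    proof (rule balanced_eqI[of p w k k'])
      show "k a = k' a" if "a \<in> ?C" for a
        using fun_cong[OF kk(3), of a] that by simp
    qed (use kk that in auto)
    then show "k = k'" using kk by (intro PiE_ext[of k "{..<p}" "\<lambda>_. F" k']) auto
  qed
  have "sum ?f ?K \<le> (\<Sum>k\<in>?K. \<tau> ^ (?d - 1) * (\<Prod>a\<in>?C. u (restrict k ?C a)))"
    by (rule sum_mono) (rule step)
  also have "\<dots> = \<tau> ^ (?d - 1) * (\<Sum>k\<in>(\<lambda>k. restrict k ?C) ` ?K. \<Prod>a\<in>?C. u (k a))"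
    by (simp add: sum_distrib_left sum.reindex[OF inj])
  also have "\<dots> \<le> \<tau> ^ (?d - 1) * (\<Sum>k\<in>?C \<rightarrow>\<^sub>E F. \<Prod>a\<in>?C. u (k a))"
  proof (intro mult_left_mono sum_mono2 finC)
    show "(\<lambda>k. restrict k ?C) ` ?K \<subseteq> ?C \<rightarrow>\<^sub>E F"
      using later_positions_subset[of p w] by fastforce
    show "0 \<le> (\<Prod>a\<in>?C. u (b a))" if "b \<in> (?C \<rightarrow>\<^sub>E F) - (\<lambda>k. restrict k ?C) ` ?K" for b
      using that by (intro prod_nonneg) (auto intro!: u)
  qed (use \<tau> in auto)
  also have "(\<Sum>k\<in>?C \<rightarrow>\<^sub>E F. \<Prod>a\<in>?C. u (k a)) = sum u F ^ card ?C"
    using prod_sum_PiE[of ?C "\<lambda>_. F" "\<lambda>_ x. u x"] F by simp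
  also have "\<tau> ^ (?d - 1) * sum u F ^ card ?C \<le> \<tau> ^ (?d - 1) * W ^ card ?C"
    using u W \<tau> by (intro mult_left_mono power_mono) (auto intro: sum_nonneg)
  also have "\<dots> = (W / \<tau>) * W ^ p * (\<tau> / W) ^ ?d"
  proof -
    have e1: "\<tau> ^ ?d = \<tau> * \<tau> ^ (?d - 1)" using d by (cases ?d) auto
    have e2: "W * W ^ p = W ^ card ?C * W ^ ?d"
      using cC by (metis power_Suc power_add)
    show ?thesis using W \<tau> e2 by (simp add: e1 power_divide field_simps)
  qed
  also have "(\<tau> / W) ^ ?d = (\<Prod>j\<in>J. word_weight (\<tau> / W) (card {a. a < p \<and> w a = j}))"
  proof -
    have "(\<Prod>j\<in>J. word_weight (\<tau> / W) (card {a. a < p \<and> w a = j}))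
        = (\<Prod>j\<in>w ` {..<p}. word_weight (\<tau> / W) (card {a. a < p \<and> w a = j}))"
      by (rule prod.mono_neutral_right) (use w J in \<open>auto simp: word_weight_def\<close>)
    also have "\<dots> = (\<Prod>j\<in>w ` {..<p}. \<tau> / W)"
    proof (rule prod.cong[OF refl])
      fix j assume "j \<in> w ` {..<p}"
      then have "card {a. a < p \<and> w a = j} \<noteq> 0" by auto
      then show "word_weight (\<tau> / W) (card {a. a < p \<and> w a = j}) = \<tau> / W"
        using mult[of j] unfolding word_weight_def by (simp only: if_False)
    qed
    finally show ?thesis by simp
  qed
  finally show ?thesis .
qed

text \<open>
  The right-hand side is the \<open>c\<close>-th moment of a random variable with values \<open>2\<close>, \<open>-1\<close>, \<open>0\<close>; the sum over
  words thus becomes the \<open>p\<close>-th moment of a sum of independent copies.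
\<close>

lemma word_weight_le_three_point:
  assumes "0 \<le> \<rho>"
  shows "word_weight \<rho> c \<le> \<rho> / 6 * 2 ^ c + \<rho> / 3 * (-1) ^ c + (1 - \<rho> / 2) * 0 ^ c"
proof -
  \<comment> \<open>The law has mass \<open>1\<close>, mean \<open>0\<close>, and second and third
    moment \<open>\<rho>\<close>. The asymmetric values \<open>2\<close> and \<open>-1\<close>
    matter: a symmetric law has vanishing odd moments, whereas every \<open>c \<ge> 3\<close>
    demands at least \<open>\<rho>\<close>.\<close>
  consider "c = 0" | "c = 1" | "c = 2" | "c \<ge> 3" by linarith
  then show ?thesis
  proof cases
    case 4
    have "(2::real) ^ 3 \<le> 2 ^ c" using 4 by (intro power_increasing) auto
    moreover have "(-1::real) ^ c \<ge> -1" by (cases "even c") auto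
    ultimately have "6 \<le> (2::real) ^ c + 2 * (-1) ^ c" by simp
    then have "\<rho> / 6 * 6 \<le> \<rho> / 6 * ((2::real) ^ c + 2 * (-1) ^ c)"
      using assms by (intro mult_left_mono) auto
    then show ?thesis using 4 by (simp add: word_weight_def algebra_simps power_0_left)
  qed (auto simp: word_weight_def)
qed

section \<open>Summation over all words by moments of independent variables\<close>

lemma prod_power_card_fibres:
  fixes v :: "'j \<Rightarrow> 'b::comm_monoid_mult" and w :: "nat \<Rightarrow> 'j"
  assumes "finite J" "w \<in> {..<p} \<rightarrow> J"
  shows "(\<Prod>j\<in>J. v j ^ card {a. a < p \<and> w a = j}) = (\<Prod>a<p. v (w a))"
proof -
  have "(\<Prod>a<p. v (w a)) = (\<Prod>j\<in>J. \<Prod>a | a \<in> {..<p} \<and> w a = j. v (w a))"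
    using assms by (intro prod.group[symmetric] finite_lessThan) auto
  also have "\<dots> = (\<Prod>j\<in>J. v j ^ card {a. a < p \<and> w a = j})"
    by (intro prod.cong refl) (simp add: prod_constant)
  finally show ?thesis by simp
qed

text \<open>This is \<open>t \<le> exp (t - 1)\<close> at
  \<open>t = \<bar>x\<bar> / (2 * p)\<close>, raised to the power \<open>p\<close>. Adding up both
  signs removes the absolute value, so that the exponential of a sum still factorises.\<close>

lemma even_power_le_exp:
  fixes x :: real
  assumes "even p"
  shows "x ^ p \<le> (2 * real p) ^ p * exp (- real p) * (exp (x / 2) + exp (- x / 2))"
proof (cases "p = 0")
  case True
  have "1 \<le> exp (x / 2) + exp (- x / 2)"
    using exp_ge_add_one_self[of "x/2"] exp_ge_add_one_self[of "-x/2"] by linarith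
  then show ?thesis using True by simp
next
  case False
  have "(\<bar>x\<bar> / (2 * real p)) ^ p \<le> exp (\<bar>x\<bar> / (2 * real p) - 1) ^ p"
    using exp_ge_add_one_self[of "\<bar>x\<bar> / (2 * real p) - 1"] by (intro power_mono) auto
  also have "\<dots> = exp (\<bar>x\<bar> / 2 - real p)"
    using False by (simp add: exp_of_nat_mult[symmetric] field_simps)
  also have "\<dots> = exp (- real p) * exp (\<bar>x\<bar> / 2)" by (simp flip: exp_add)
  also have "\<dots> \<le> exp (- real p) * (exp (x / 2) + exp (- x / 2))"
    by (auto simp: abs_if)
  finally have "\<bar>x\<bar> ^ p / (2 * real p) ^ p \<le> exp (- real p) * (exp (x / 2) + exp (- x / 2))"
    by (simp add: power_divide)
  then show ?thesis using False assms by (simp add: field_simps power_even_abs)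
qed

text \<open>Exponential moments of the three-point law at the rates \<open>1/2\<close> and
  \<open>-1/2\<close>. Both exceed \<open>1\<close> by less than \<open>0.17 * \<rho>\<close>; the
  rounded value \<open>\<rho> / 5\<close> is the origin of the \<open>5\<close> in all failure
  probabilities.\<close>

lemma three_point_exp_half:
  fixes \<rho> :: real
  assumes "0 \<le> \<rho>"
  shows "\<rho> / 6 * exp 1 + \<rho> / 3 * exp (- 1 / 2) + (1 - \<rho> / 2) \<le> exp (\<rho> / 5)"
    and "\<rho> / 6 * exp (- 1) + \<rho> / 3 * exp (1 / 2) + (1 - \<rho> / 2) \<le> exp (\<rho> / 5)"
proof -
  have e1: "exp (1::real) < 2.72" using e_less_272 by simp
  have eh: "exp (1/2::real) \<le> 1.65"
  proof (rule power2_le_imp_le)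
    show "(exp (1/2::real))\<^sup>2 \<le> 1.65\<^sup>2"
      using e1 by (simp add: exp_double[symmetric] power2_eq_square flip: exp_add)
  qed simp
  have eh2: "exp (1/2::real) \<ge> 1.6"
    using exp_lower_Taylor_quadratic[of "1/2::real"] by (simp add: power2_eq_square)
  have emh: "exp (-1/2::real) \<le> 5/8"
    using eh2 by (simp add: exp_minus field_simps)
  have em1: "exp (-1::real) \<le> 25/64"
  proof -
    have "exp (-1::real) = exp (-1/2) * exp (-1/2)" by (simp flip: exp_add)
    also have "\<dots> \<le> 5/8 * (5/8)" using emh by (intro mult_mono) auto
    finally show ?thesis by simp
  qed
  have "\<rho> * (exp 1 / 6 + exp (- 1 / 2) / 3 - 1 / 2) \<le> \<rho> * (1/5)"
    using e1 emh assms by (intro mult_left_mono) auto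
  then show "\<rho> / 6 * exp 1 + \<rho> / 3 * exp (- 1 / 2) + (1 - \<rho> / 2) \<le> exp (\<rho> / 5)"
    using exp_ge_add_one_self[of "\<rho>/5"] unfolding right_diff_distrib distrib_left by linarith
  have "\<rho> * (exp (-1) / 6 + exp (1 / 2) / 3 - 1 / 2) \<le> \<rho> * (1/5)"
    using eh em1 assms by (intro mult_left_mono) auto
  then show "\<rho> / 6 * exp (- 1) + \<rho> / 3 * exp (1 / 2) + (1 - \<rho> / 2) \<le> exp (\<rho> / 5)"
    using exp_ge_add_one_self[of "\<rho>/5"] unfolding right_diff_distrib distrib_left by linarith
qed

text \<open>Once word weights are replaced by moments, the product over letters is an expectation,
  under the product law with masses \<open>P\<close>, of a product over positions. Summing over
  words turns the latter into the power \<open>?S V ^ p\<close>, which exponential moments control.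
  The bound \<open>\<rho> \<le> 2\<close> keeps the mass \<open>1 - \<rho> / 2\<close>
  nonnegative.\<close>

lemma sum_words_le:
  fixes J :: "nat set"
  assumes J: "finite J" and p: "even p" and \<rho>: "0 \<le> \<rho>" "\<rho> \<le> 2"
  shows "(\<Sum>w\<in>{..<p} \<rightarrow>\<^sub>E J. \<Prod>j\<in>J. word_weight \<rho> (card {a. a < p \<and> w a = j}))
       \<le> 2 * (2 * real p) ^ p * exp (real (card J) * \<rho> / 5 - real p)"
proof -
  define T where "T = {2, -1, 0::real}"
  define P where "P = (\<lambda>t::real. if t = 2 then \<rho> / 6 else if t = -1 then \<rho> / 3 else 1 - \<rho> / 2)"
  have P0: "0 \<le> P t" for t using \<rho> by (simp add: P_def)
  have fT: "finite T" by (simp add: T_def)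
  have sumT: "(\<Sum>t\<in>T. P t * g t) = \<rho> / 6 * g 2 + \<rho> / 3 * g (-1) + (1 - \<rho> / 2) * g 0" for g
    by (simp add: T_def P_def)
  let ?c = "\<lambda>w j. card {a. a < p \<and> w a = (j::nat)}"
  let ?S = "\<lambda>V. \<Sum>j\<in>J. V j :: real"
  have expsum: "(\<Sum>V\<in>J \<rightarrow>\<^sub>E T. (\<Prod>j\<in>J. P (V j)) * exp (c * ?S V))
      = (\<Sum>t\<in>T. P t * exp (c * t)) ^ card J" for c
  proof -
    have "(\<Sum>V\<in>J \<rightarrow>\<^sub>E T. (\<Prod>j\<in>J. P (V j)) * exp (c * ?S V))
        = (\<Sum>V\<in>J \<rightarrow>\<^sub>E T. \<Prod>j\<in>J. P (V j) * exp (c * V j))"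
      by (simp add: prod.distrib exp_sum J sum_distrib_left)
    also have "\<dots> = (\<Prod>j\<in>J. \<Sum>t\<in>T. P t * exp (c * t))"
      using prod_sum_PiE[of J "\<lambda>_. T" "\<lambda>_ t. P t * exp (c * t)"] J fT by simp
    finally show ?thesis by simp
  qed
  have b: "(\<Sum>V\<in>J \<rightarrow>\<^sub>E T. (\<Prod>j\<in>J. P (V j)) * exp (c * ?S V)) \<le> exp (real (card J) * \<rho> / 5)"
    if "c = 1/2 \<or> c = -1/2" for c
  proof -
    have "(\<Sum>t\<in>T. P t * exp (c * t)) \<le> exp (\<rho> / 5)"
    proof (cases "c = 1/2")
      case True
      show ?thesis using three_point_exp_half(1)[OF \<rho>(1)] unfolding sumT True by simp
    next
      case False
      then have c: "c = -1/2" using that by simp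
      show ?thesis using three_point_exp_half(2)[OF \<rho>(1)] unfolding sumT c by simp
    qed
    then have "(\<Sum>t\<in>T. P t * exp (c * t)) ^ card J \<le> exp (\<rho> / 5) ^ card J"
      by (intro power_mono) (auto intro!: sum_nonneg mult_nonneg_nonneg P0)
    then show ?thesis unfolding expsum by (simp add: exp_of_nat_mult[symmetric])
  qed
  have "(\<Sum>w\<in>{..<p} \<rightarrow>\<^sub>E J. \<Prod>j\<in>J. word_weight \<rho> (?c w j))
      \<le> (\<Sum>w\<in>{..<p} \<rightarrow>\<^sub>E J. \<Prod>j\<in>J. \<Sum>t\<in>T. P t * t ^ ?c w j)"
    unfolding sumT
    by (intro sum_mono prod_mono conjI word_weight_le_three_point \<rho>)
       (use \<rho> in \<open>auto simp: word_weight_def\<close>)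
  also have "\<dots> = (\<Sum>w\<in>{..<p} \<rightarrow>\<^sub>E J. \<Sum>V\<in>J \<rightarrow>\<^sub>E T. (\<Prod>j\<in>J. P (V j)) * (\<Prod>a<p. V (w a)))"
  proof (intro sum.cong refl)
    fix w assume w: "w \<in> {..<p} \<rightarrow>\<^sub>E J"
    have "(\<Prod>j\<in>J. \<Sum>t\<in>T. P t * t ^ ?c w j) = (\<Sum>V\<in>J \<rightarrow>\<^sub>E T. \<Prod>j\<in>J. P (V j) * V j ^ ?c w j)"
      using J fT by (intro prod_sum_PiE) auto
    also have "\<dots> = (\<Sum>V\<in>J \<rightarrow>\<^sub>E T. (\<Prod>j\<in>J. P (V j)) * (\<Prod>a<p. V (w a)))"
      using w J by (intro sum.cong refl) (subst prod_power_card_fibres[symmetric], auto simp: prod.distrib)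
    finally show "(\<Prod>j\<in>J. \<Sum>t\<in>T. P t * t ^ ?c w j)
        = (\<Sum>V\<in>J \<rightarrow>\<^sub>E T. (\<Prod>j\<in>J. P (V j)) * (\<Prod>a<p. V (w a)))" .
  qed
  also have "\<dots> = (\<Sum>V\<in>J \<rightarrow>\<^sub>E T. (\<Prod>j\<in>J. P (V j)) * (\<Sum>w\<in>{..<p} \<rightarrow>\<^sub>E J. \<Prod>a<p. V (w a)))"
    by (subst sum.swap) (simp add: sum_distrib_left)
  also have "\<dots> = (\<Sum>V\<in>J \<rightarrow>\<^sub>E T. (\<Prod>j\<in>J. P (V j)) * ?S V ^ p)"
  proof (intro sum.cong refl)
    fix V :: "nat \<Rightarrow> real"
    show "(\<Prod>j\<in>J. P (V j)) * (\<Sum>w\<in>{..<p} \<rightarrow>\<^sub>E J. \<Prod>a<p. V (w a)) = (\<Prod>j\<in>J. P (V j)) * ?S V ^ p"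
      using prod_sum_PiE[of "{..<p}" "\<lambda>_. J" "\<lambda>_ x. V x"] J by simp
  qed
  also have "\<dots> \<le> (\<Sum>V\<in>J \<rightarrow>\<^sub>E T. (\<Prod>j\<in>J. P (V j)) *
      ((2 * real p) ^ p * exp (- real p) * (exp (?S V / 2) + exp (- ?S V / 2))))"
    by (intro sum_mono mult_left_mono even_power_le_exp p prod_nonneg P0)
  also have "\<dots> = (2 * real p) ^ p * exp (- real p) *
      ((\<Sum>V\<in>J \<rightarrow>\<^sub>E T. (\<Prod>j\<in>J. P (V j)) * exp (1/2 * ?S V))
       + (\<Sum>V\<in>J \<rightarrow>\<^sub>E T. (\<Prod>j\<in>J. P (V j)) * exp (-1/2 * ?S V)))"
  proof -
    have "exp (?S V / 2) = exp (1/2 * ?S V)" "exp (- ?S V / 2) = exp (-1/2 * ?S V)" for V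
      by simp_all
    then show ?thesis
      unfolding sum.distrib[symmetric] sum_distrib_left[of _ _ "J \<rightarrow>\<^sub>E T"]
      by (intro sum.cong refl) (simp only: algebra_simps)
  qed
  also have "\<dots> \<le> (2 * real p) ^ p * exp (- real p) *
      (exp (real (card J) * \<rho> / 5) + exp (real (card J) * \<rho> / 5))"
    by (intro mult_left_mono add_mono b) auto
  also have "\<dots> = 2 * (2 * real p) ^ p * exp (real (card J) * \<rho> / 5 - real p)"
    by (simp only: exp_diff exp_minus divide_inverse algebra_simps mult_2)
  finally show ?thesis .
qed

subsection \<open>Traces of powers of a Hermitian kernel\<close>

text \<open>Matrix powers over an arbitrary finite index set, so that the frequencies themselves
  index rows and columns.\<close>

primrec kernel_power :: "'k set \<Rightarrow> ('k \<Rightarrow> 'k \<Rightarrow> 'a::comm_semiring_1) \<Rightarrow> nat \<Rightarrow> 'k \<Rightarrow> 'k \<Rightarrow> 'a" where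
  "kernel_power F A 0 x y = of_bool (x = y)"
| "kernel_power F A (Suc p) x y = (\<Sum>z\<in>F. kernel_power F A p x z * A z y)"

lemma kernel_power_paths:
  assumes F: "finite F" and xy: "x \<in> F" "y \<in> F"
  shows "kernel_power F A p x y
       = (\<Sum>k | k \<in> {..p} \<rightarrow>\<^sub>E F \<and> k 0 = x \<and> k p = y. \<Prod>a<p. A (k a) (k (Suc a)))"
  using xy(2)
proof (induction p arbitrary: y)
  case 0
  have "{k. k \<in> {..0::nat} \<rightarrow>\<^sub>E F \<and> k 0 = x \<and> k 0 = y}
      = (if x = y then {\<lambda>i. if i = 0 then x else undefined} else {})"
    using xy by (auto simp: PiE_iff extensional_def fun_eq_iff)
  then show ?case by simp
next
  case (Suc p)
  let ?P = "\<lambda>p y. {k. k \<in> {..p} \<rightarrow>\<^sub>E F \<and> k 0 = x \<and> k p = y}"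
  let ?g = "\<lambda>p k. \<Prod>a<p. A (k a) (k (Suc a))"
  have fin: "finite (?P p y)" for p :: nat and y
    by (rule finite_subset[of _ "{..p} \<rightarrow>\<^sub>E F"]) (auto intro: finite_PiE F)
  have "kernel_power F A (Suc p) x y = (\<Sum>z\<in>F. \<Sum>k\<in>?P p z. ?g p k * A z y)"
    by (simp add: Suc.IH sum_distrib_right)
  also have "\<dots> = (\<Sum>(z, k)\<in>(SIGMA z:F. ?P p z). ?g p k * A z y)"
    by (rule sum.Sigma) (auto simp: F fin)
  also have "\<dots> = (\<Sum>k\<in>?P (Suc p) y. ?g (Suc p) k)"
  proof (rule sum.reindex_bij_witness[of _ "\<lambda>k. (k p, restrict k {..p})" "\<lambda>(z, k). k(Suc p := y)"])
    fix u assume u: "u \<in> (SIGMA z:F. ?P p z)"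
    then obtain z k where u': "u = (z, k)" and k: "k \<in> {..p} \<rightarrow>\<^sub>E F" "k 0 = x" "k p = z" by auto
    have "restrict (k(Suc p := y)) {..p} = k"
      using k by (auto simp: PiE_iff extensional_def fun_eq_iff)
    then show "((case u of (z, k) \<Rightarrow> k(Suc p := y)) p,
        restrict (case u of (z, k) \<Rightarrow> k(Suc p := y)) {..p}) = u"
      using k u' by simp
    show "(case u of (z, k) \<Rightarrow> k(Suc p := y)) \<in> ?P (Suc p) y"
      using k u' Suc.prems by (auto simp: PiE_iff extensional_def le_Suc_eq)
    have "(\<Prod>a<p. A ((k(Suc p := y)) a) ((k(Suc p := y)) (Suc a))) = (\<Prod>a<p. A (k a) (k (Suc a)))"
      by (intro prod.cong) auto
    then show "?g (Suc p) (case u of (z, k) \<Rightarrow> k(Suc p := y)) = (case u of (z, k) \<Rightarrow> ?g p k * A z y)"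
      using k u' by simp
  next
    fix k assume k: "k \<in> ?P (Suc p) y"
    show "(case (k p, restrict k {..p}) of (z, k) \<Rightarrow> k(Suc p := y)) = k"
      using k by (auto simp: PiE_iff extensional_def fun_eq_iff le_Suc_eq)
    show "(k p, restrict k {..p}) \<in> (SIGMA z:F. ?P p z)"
      using k by (auto simp: PiE_iff)
  qed
  finally show ?case .
qed

text \<open>A closed path lists its end point twice, at \<open>0\<close> and at \<open>p\<close>.
  Dropping the second copy gives tuples on \<open>{..<p}\<close>, and \<open>cyc_succ\<close>
  restores the closing step.\<close>

lemma trace_kernel_power:
  assumes F: "finite F" and p: "p > 0"
  shows "(\<Sum>x\<in>F. kernel_power F A p x x)
       = (\<Sum>k\<in>{..<p} \<rightarrow>\<^sub>E F. \<Prod>a<p. A (k a) (k (cyc_succ p a)))"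
proof -
  let ?P = "\<lambda>x. {k. k \<in> {..p} \<rightarrow>\<^sub>E F \<and> k 0 = x \<and> k p = x}"
  have fin: "finite (?P x)" for x
    by (rule finite_subset[of _ "{..p} \<rightarrow>\<^sub>E F"]) (auto intro: finite_PiE F)
  have "(\<Sum>x\<in>F. kernel_power F A p x x) = (\<Sum>x\<in>F. \<Sum>k\<in>?P x. \<Prod>a<p. A (k a) (k (Suc a)))"
    using F by (intro sum.cong refl) (auto simp: kernel_power_paths)
  also have "\<dots> = (\<Sum>(x, k)\<in>(SIGMA x:F. ?P x). \<Prod>a<p. A (k a) (k (Suc a)))"
    by (rule sum.Sigma) (auto simp: F fin)
  also have "\<dots> = (\<Sum>k\<in>{..<p} \<rightarrow>\<^sub>E F. \<Prod>a<p. A (k a) (k (cyc_succ p a)))"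
  proof (rule sum.reindex_bij_witness[of _ "\<lambda>k. (k 0, k(p := k 0))" "\<lambda>(z, k). restrict k {..<p}"])
    fix u assume u: "u \<in> (SIGMA x:F. ?P x)"
    then obtain z k where u': "u = (z, k)" and k: "k \<in> {..p} \<rightarrow>\<^sub>E F" "k 0 = z" "k p = z" by auto
    have "(restrict k {..<p})(p := z) = k"
      using k by (auto simp: PiE_iff extensional_def fun_eq_iff le_less)
    then show "((case u of (z, k) \<Rightarrow> restrict k {..<p}) 0,
        (case u of (z, k) \<Rightarrow> restrict k {..<p})(p := (case u of (z, k) \<Rightarrow> restrict k {..<p}) 0)) = u"
      using k u' p by simp
    show "(case u of (z, k) \<Rightarrow> restrict k {..<p}) \<in> {..<p} \<rightarrow>\<^sub>E F"
      using k u' by (auto simp: PiE_iff)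
    have "(\<Prod>a<p. A (restrict k {..<p} a) (restrict k {..<p} (cyc_succ p a))) = (\<Prod>a<p. A (k a) (k (Suc a)))"
      using k p by (intro prod.cong refl) (auto simp: cyc_succ_def)
    then show "(\<Prod>a<p. A ((case u of (z, k) \<Rightarrow> restrict k {..<p}) a)
          ((case u of (z, k) \<Rightarrow> restrict k {..<p}) (cyc_succ p a)))
        = (case u of (x, k) \<Rightarrow> \<Prod>a<p. A (k a) (k (Suc a)))"
      using u' by simp
  next
    fix k assume k: "k \<in> {..<p} \<rightarrow>\<^sub>E F"
    show "(case (k 0, k(p := k 0)) of (z, k) \<Rightarrow> restrict k {..<p}) = k"
      using k by (auto simp: PiE_iff extensional_def fun_eq_iff)
    show "(k 0, k(p := k 0)) \<in> (SIGMA x:F. ?P x)"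
      using k p by (auto simp: PiE_iff extensional_def le_less)
  qed
  finally show ?thesis .
qed

text \<open>The ratios \<open>N (Suc k) / N k\<close> are nondecreasing, so each of the
  \<open>q\<close> ratios leading from \<open>N 1\<close> to \<open>N (Suc q)\<close> is at least
  \<open>N 1 / N 0\<close>.\<close>

lemma log_convex_power_le:
  fixes N :: "nat \<Rightarrow> real"
  assumes N: "\<And>k. 0 \<le> N k" and conv: "\<And>k. (N (Suc k))\<^sup>2 \<le> N k * N (Suc (Suc k))"
  shows "N 1 ^ Suc q \<le> N 0 ^ q * N (Suc q)"
proof (cases "N 1 = 0")
  case True
  then show ?thesis using N by simp
next
  case False
  then have N1: "0 < N 1" using N[of 1] by simp
  have N0: "0 < N 0"
    using conv[of 0] N1 N[of 0] by (metis One_nat_def less_eq_real_def mult_zero_left not_le zero_less_power)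
  have step: "0 < N k \<and> 0 < N (Suc k) \<and> N 1 * N k \<le> N 0 * N (Suc k)" for k
  proof (induction k)
    case 0
    show ?case using N0 N1 by (simp add: mult.commute)
  next
    case (Suc k)
    have "0 < (N (Suc k))\<^sup>2" using Suc by simp
    then have "0 < N k * N (Suc (Suc k))" using conv[of k] by linarith
    then have pos: "0 < N (Suc (Suc k))" using Suc by (simp add: zero_less_mult_iff)
    have "N k * (N 1 * N (Suc k)) \<le> N 0 * (N (Suc k))\<^sup>2"
      using Suc mult_right_mono[of "N 1 * N k" "N 0 * N (Suc k)" "N (Suc k)"]
      by (simp add: power2_eq_square mult_ac)
    also have "\<dots> \<le> N 0 * (N k * N (Suc (Suc k)))"
      using conv[of k] N0 by (intro mult_left_mono) auto
    finally have "N k * (N 1 * N (Suc k)) \<le> N k * (N 0 * N (Suc (Suc k)))" by (simp add: mult_ac)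
    then show ?case using Suc pos by simp
  qed
  show ?thesis
  proof (induction q)
    case 0
    show ?case by simp
  next
    case (Suc q)
    have "N 1 ^ Suc (Suc q) \<le> N 1 * (N 0 ^ q * N (Suc q))"
      using Suc N by (simp only: power_Suc[of _ "Suc q"] mult_left_mono)
    also have "\<dots> = N 0 ^ q * (N 1 * N (Suc q))" by simp
    also have "\<dots> \<le> N 0 ^ q * (N 0 * N (Suc (Suc q)))"
      using step[of "Suc q"] N by (intro mult_left_mono) auto
    finally show ?case by (simp add: mult_ac)
  qed
qed

lemma Cauchy_Schwarz_complex_sum:
  fixes u v :: "'k \<Rightarrow> complex"
  shows "(cmod (\<Sum>x\<in>F. cnj (u x) * v x))\<^sup>2 \<le> (\<Sum>x\<in>F. (cmod (u x))\<^sup>2) * (\<Sum>x\<in>F. (cmod (v x))\<^sup>2)"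
proof -
  have "cmod (\<Sum>x\<in>F. cnj (u x) * v x) \<le> (\<Sum>x\<in>F. cmod (u x) * cmod (v x))"
    using norm_sum[of "\<lambda>x. cnj (u x) * v x" F] by (simp add: norm_mult)
  then have "(cmod (\<Sum>x\<in>F. cnj (u x) * v x))\<^sup>2 \<le> (\<Sum>x\<in>F. cmod (u x) * cmod (v x))\<^sup>2"
    by (intro power_mono) auto
  also have "\<dots> \<le> (\<Sum>x\<in>F. (cmod (u x))\<^sup>2) * (\<Sum>x\<in>F. (cmod (v x))\<^sup>2)"
    by (rule Cauchy_Schwarz_ineq_sum)
  finally show ?thesis .
qed

text \<open>A spectral bound without eigenvalues. As the kernel is self-adjoint, the squared lengths
  \<open>N a k\<close> of the iterates \<open>(T ^^ k) a\<close> are log-convex, so the length of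
  \<open>T a\<close> is controlled by that of \<open>(T ^^ q) a\<close>. The latter is at most the
  Hilbert-Schmidt norm of the \<open>q\<close>-th power times the length of \<open>a\<close>, and
  the square of that norm is the trace of the power \<open>2 * q\<close>.\<close>

lemma hermitian_form_le_trace:
  fixes A :: "'k \<Rightarrow> 'k \<Rightarrow> complex"
  assumes F: "finite F" and herm: "\<And>x y. x \<in> F \<Longrightarrow> y \<in> F \<Longrightarrow> A y x = cnj (A x y)" and q: "q > 0"
  shows "cmod (\<Sum>x\<in>F. \<Sum>y\<in>F. cnj (a x) * A x y * a y) ^ (2 * q)
       \<le> (\<Sum>x\<in>F. (cmod (a x))\<^sup>2) ^ (2 * q) * Re (\<Sum>x\<in>F. kernel_power F A (2 * q) x x)"
proof -
  define T where "T = (\<lambda>u x. \<Sum>y\<in>F. A x y * u y)"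
  define ip where "ip = (\<lambda>u v. \<Sum>x\<in>F. cnj (u x) * v x :: complex)"
  define N where "N = (\<lambda>u k. \<Sum>x\<in>F. (cmod ((T ^^ k) u x))\<^sup>2)"
  have adj: "ip (T u) v = ip u (T v)" for u v
  proof -
    have "ip (T u) v = (\<Sum>x\<in>F. \<Sum>y\<in>F. cnj (u y) * A y x * v x)"
      unfolding ip_def T_def cnj_sum sum_distrib_right
    proof (intro sum.cong refl)
      fix x y assume "x \<in> F" "y \<in> F"
      then show "cnj (A x y * u y) * v x = cnj (u y) * A y x * v x"
        using herm[of x y] by simp
    qed
    also have "\<dots> = ip u (T v)"
      unfolding ip_def T_def sum_distrib_left by (subst sum.swap) (simp add: mult.assoc)
    finally show ?thesis .
  qed
  have ipT: "ip ((T ^^ i) u) v = ip u ((T ^^ i) v)" for i u v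
  proof (induction i arbitrary: v)
    case (Suc i)
    have "ip ((T ^^ Suc i) u) v = ip u ((T ^^ i) (T v))" by (simp add: adj Suc)
    then show ?case by (simp add: funpow_swap1)
  qed simp
  have ip_norm: "ip u u = of_real (\<Sum>x\<in>F. (cmod (u x))\<^sup>2)" for u
    unfolding ip_def of_real_sum by (intro sum.cong refl) (metis complex_norm_square mult.commute of_real_power)
  have CS: "(cmod (ip u v))\<^sup>2 \<le> (\<Sum>x\<in>F. (cmod (u x))\<^sup>2) * (\<Sum>x\<in>F. (cmod (v x))\<^sup>2)" for u v
    unfolding ip_def by (rule Cauchy_Schwarz_complex_sum)
  have N0: "0 \<le> N u k" for u k unfolding N_def by (intro sum_nonneg) auto
  have conv: "(N u (Suc k))\<^sup>2 \<le> N u k * N u (Suc (Suc k))" for u k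
  proof -
    have "complex_of_real (N u (Suc k)) = ip ((T ^^ Suc k) u) ((T ^^ Suc k) u)"
      unfolding N_def ip_norm ..
    also have "\<dots> = ip ((T ^^ k) u) ((T ^^ Suc (Suc k)) u)"
      by (simp add: adj)
    finally have "cmod (complex_of_real (N u (Suc k))) = cmod (ip ((T ^^ k) u) ((T ^^ Suc (Suc k)) u))" by simp
    then have "N u (Suc k) = cmod (ip ((T ^^ k) u) ((T ^^ Suc (Suc k)) u))" using N0[of u "Suc k"] by simp
    then show ?thesis using CS[of "(T ^^ k) u" "(T ^^ Suc (Suc k)) u"] unfolding N_def by simp
  qed
  have kp: "(T ^^ i) u x = (\<Sum>y\<in>F. kernel_power F A i x y * u y)" if "x \<in> F" for i u x
    using that
  proof (induction i arbitrary: u)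
    case 0
    then have "(\<Sum>y\<in>F. of_bool (x = y) * u y) = (\<Sum>y\<in>{x}. u y)"
      using F by (intro sum.mono_neutral_cong_right) auto
    then show ?case by simp
  next
    case (Suc i)
    have "(T ^^ Suc i) u x = (\<Sum>z\<in>F. \<Sum>y\<in>F. kernel_power F A i x z * A z y * u y)"
      unfolding funpow_Suc_right comp_def using Suc by (simp add: T_def sum_distrib_left mult.assoc)
    also have "\<dots> = (\<Sum>y\<in>F. kernel_power F A (Suc i) x y * u y)"
      by (subst sum.swap) (simp add: sum_distrib_right)
    finally show ?case .
  qed
  have tr: "(\<Sum>x\<in>F. \<Sum>y\<in>F. (cmod (kernel_power F A q x y))\<^sup>2) = Re (\<Sum>y\<in>F. kernel_power F A (2 * q) y y)"
  proof -
    have "(\<Sum>x\<in>F. (cmod (kernel_power F A q x y))\<^sup>2) = Re (kernel_power F A (2 * q) y y)" if y: "y \<in> F" for y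
    proof -
      \<comment> \<open>Column \<open>y\<close> of the \<open>q\<close>-th power is that power
        applied to the unit vector at \<open>y\<close>; by self-adjointness its squared length is a
        diagonal entry of the power \<open>2 * q\<close>.\<close>
      define e where "e = (\<lambda>x. of_bool (x = y) :: complex)"
      have se: "(\<Sum>x\<in>F. f x * e x) = f y" for f
      proof -
        have "(\<Sum>x\<in>F. f x * e x) = (\<Sum>x\<in>{y}. f x)"
          unfolding e_def by (rule sum.mono_neutral_cong_right) (use F y in auto)
        then show ?thesis by simp
      qed
      have "(\<Sum>x\<in>F. (cmod (kernel_power F A q x y))\<^sup>2) = (\<Sum>x\<in>F. (cmod ((T ^^ q) e x))\<^sup>2)"
        by (intro sum.cong refl) (simp add: kp se)
      also have "\<dots> = Re (ip ((T ^^ q) e) ((T ^^ q) e))" by (simp add: ip_norm)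
      also have "\<dots> = Re (ip e ((T ^^ (2 * q)) e))" by (simp add: ipT mult_2 funpow_add)
      also have "ip e ((T ^^ (2 * q)) e) = (\<Sum>x\<in>F. (T ^^ (2 * q)) e x * e x)"
        unfolding ip_def by (intro sum.cong refl) (simp add: e_def)
      also have "\<dots> = kernel_power F A (2 * q) y y" by (simp add: se kp y)
      finally show ?thesis .
    qed
    then show ?thesis by (subst sum.swap) simp
  qed
  have Nq: "N a q \<le> N a 0 * Re (\<Sum>y\<in>F. kernel_power F A (2 * q) y y)"
  proof -
    have "N a q \<le> (\<Sum>x\<in>F. (\<Sum>y\<in>F. (cmod (kernel_power F A q x y))\<^sup>2) * (\<Sum>y\<in>F. (cmod (a y))\<^sup>2))"
      unfolding N_def
    proof (rule sum_mono)
      fix x assume "x \<in> F"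
      then show "(cmod ((T ^^ q) a x))\<^sup>2
          \<le> (\<Sum>y\<in>F. (cmod (kernel_power F A q x y))\<^sup>2) * (\<Sum>y\<in>F. (cmod (a y))\<^sup>2)"
        using Cauchy_Schwarz_complex_sum[of "\<lambda>y. cnj (kernel_power F A q x y)" a F] by (simp add: kp)
    qed
    also have "\<dots> = Re (\<Sum>y\<in>F. kernel_power F A (2 * q) y y) * N a 0"
      unfolding sum_distrib_right[symmetric] tr N_def by simp
    finally show ?thesis by (simp only: mult.commute)
  qed
  obtain q' where q': "q = Suc q'" using q by (cases q) auto
  have "(\<Sum>x\<in>F. \<Sum>y\<in>F. cnj (a x) * A x y * a y) = ip a (T a)"
    by (simp add: ip_def T_def sum_distrib_left mult.assoc)
  then have "cmod (\<Sum>x\<in>F. \<Sum>y\<in>F. cnj (a x) * A x y * a y) ^ (2 * q) = ((cmod (ip a (T a)))\<^sup>2) ^ q"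
    by (simp add: power_mult)
  also have "\<dots> \<le> (N a 0 * N a 1) ^ q"
    using CS[of a "T a"] by (intro power_mono) (auto simp: N_def)
  also have "\<dots> = N a 0 ^ q * N a 1 ^ Suc q'" by (simp add: power_mult_distrib q')
  also have "\<dots> \<le> N a 0 ^ q * (N a 0 ^ q' * N a q)"
    using log_convex_power_le[of "N a", OF N0 conv, of q'] N0 by (intro mult_left_mono) (auto simp: q')
  also have "\<dots> \<le> N a 0 ^ q * (N a 0 ^ q' * (N a 0 * Re (\<Sum>y\<in>F. kernel_power F A (2 * q) y y)))"
    using Nq N0 by (intro mult_left_mono) auto
  also have "\<dots> = N a 0 ^ (q + Suc q') * Re (\<Sum>y\<in>F. kernel_power F A (2 * q) y y)"
    by (simp add: power_add mult_ac)
  also have "q + Suc q' = 2 * q" by (simp add: q')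
  finally show ?thesis by (simp add: N_def)
qed

subsection \<open>Integration over the torus\<close>

lemma integral_lborel_prod:
  fixes f :: "'a::euclidean_space \<Rightarrow> real \<Rightarrow> complex"
  assumes f: "\<And>b. b \<in> Basis \<Longrightarrow> integrable lborel (f b)"
  shows "(LINT x|lborel. (\<Prod>b\<in>Basis. f b (inner x b))) = (\<Prod>b\<in>Basis. LINT t|lborel. f b t)"
proof -
  interpret product_sigma_finite "\<lambda>_::'a. lborel :: real measure" by standard
  have [measurable]: "f b \<in> borel_measurable borel" if "b \<in> Basis" for b
    using f[OF that] by simp
  have "(LINT x|lborel. (\<Prod>b\<in>Basis. f b (inner x b)))
      = (LINT g|(\<Pi>\<^sub>M b\<in>(Basis::'a set). lborel). (\<Prod>b\<in>Basis. f b (inner (\<Sum>b\<in>Basis. g b *\<^sub>R b) b)))"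
    by (subst lborel_eq, rule integral_distr) measurable
  also have "\<dots> = (LINT g|(\<Pi>\<^sub>M b\<in>(Basis::'a set). lborel). (\<Prod>b\<in>Basis. f b (g b)))"
    by (intro Bochner_Integration.integral_cong prod.cong refl) simp
  also have "\<dots> = (\<Prod>b\<in>Basis. LINT t|lborel. f b t)"
    by (rule product_integral_prod) (auto intro: f)
  finally show ?thesis .
qed

lemma integral_cis_int:
  "(LINT t|lborel. indicator {0..2 * pi} t *\<^sub>R cis (real_of_int k * t)) = of_bool (k = 0) * (2 * pi)"
proof (cases "k = 0")
  case True
  then show ?thesis by (simp add: scaleR_conv_of_real)
next
  case False
  define F where "F = (\<lambda>t. cis (real_of_int k * t) / (\<i> * of_int k))"
  have "(LINT t|lborel. indicator {0..2 * pi} t *\<^sub>R cis (real_of_int k * t)) = F (2 * pi) - F 0"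
  proof (rule integral_FTC_Icc)
    show "(F has_vector_derivative cis (real_of_int k * t)) (at t within {0..2 * pi})" for t
      unfolding F_def using False
      by (auto intro!: derivative_eq_intros simp: has_vector_derivative_def scaleR_conv_of_real field_simps)
  qed (auto intro!: continuous_intros)
  also have "F (2 * pi) = F 0"
    unfolding F_def using cis_multiple_2pi[of "real_of_int k"] by (simp add: mult_ac)
  finally show ?thesis using False by simp
qed

lemma Basis_vec_axis: "(Basis :: (real ^ 'd) set) = (\<lambda>j. axis j 1) ` UNIV"
  by (auto simp: Basis_vec_def)

lemma prod_Basis_vec: "(\<Prod>b\<in>(Basis :: (real ^ 'd) set). h b) = (\<Prod>j\<in>UNIV. h (axis j 1))"
  unfolding Basis_vec_axis by (subst prod.reindex) (auto simp: inj_on_def axis_eq_axis)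

lemma torus_cube_eq_cbox: "(torus_cube :: (real ^ 'd) set) = cbox 0 ((\<chi> j. 2 * pi))"
  by (auto simp: torus_cube_def mem_box_cart)

lemma sets_torus_cube [measurable]: "(torus_cube :: (real ^ 'd) set) \<in> sets borel"
  by (simp add: torus_cube_eq_cbox)

lemma emeasure_torus_cube:
  "emeasure lborel (torus_cube :: (real ^ 'd) set) = ennreal ((2 * pi) ^ CARD('d))"
proof -
  have "emeasure lborel (torus_cube :: (real ^ 'd) set) = (\<Prod>b\<in>(Basis :: (real ^ 'd) set). inner (\<chi> j. 2 * pi) b)"
    unfolding torus_cube_eq_cbox by (subst emeasure_lborel_cbox) (auto simp: Basis_vec_axis inner_axis)
  then show ?thesis by (simp add: prod_Basis_vec inner_axis)
qed

lemma sets_torus_measure [measurable_cong]: "sets (torus_measure :: (real ^ 'd) measure) = sets borel"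
  by (simp add: torus_measure_def)

lemma space_torus_measure [simp]: "space (torus_measure :: (real ^ 'd) measure) = UNIV"
  by (simp add: torus_measure_def)

lemma prob_space_torus_measure: "prob_space (torus_measure :: (real ^ 'd) measure)"
  unfolding torus_measure_def
  by (rule prob_space_uniform_measure) (simp_all add: emeasure_torus_cube)

lemma integral_torus_measure:
  fixes f :: "real ^ 'd \<Rightarrow> complex"
  assumes "f \<in> borel_measurable borel"
  shows "(LINT x|torus_measure. f x) = (LINT x:torus_cube|lborel. f x) / of_real ((2 * pi) ^ CARD('d))"
proof -
  have "torus_measure = density lborel (\<lambda>x::real ^ 'd. ennreal (indicator torus_cube x / (2 * pi) ^ CARD('d)))"
    unfolding torus_measure_def uniform_measure_def
    by (intro density_cong) (auto split: split_indicator simp: emeasure_torus_cube divide_ennreal[symmetric])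
  then have "(LINT x|torus_measure. f x)
      = (LINT x|density lborel (\<lambda>x::real ^ 'd. ennreal (indicator torus_cube x / (2 * pi) ^ CARD('d))). f x)"
    by simp
  also have "\<dots> = (LINT x|lborel. (indicator torus_cube x / (2 * pi) ^ CARD('d)) *\<^sub>R f x)"
    using assms by (auto simp: integral_density)
  also have "\<dots> = (LINT x|lborel. (indicator torus_cube x *\<^sub>R f x) / of_real ((2 * pi) ^ CARD('d)))"
    by (intro Bochner_Integration.integral_cong refl) (simp add: scaleR_conv_of_real)
  also have "\<dots> = (LINT x:torus_cube|lborel. f x) / of_real ((2 * pi) ^ CARD('d))"
    unfolding set_lebesgue_integral_def by (rule integral_divide_zero)
  finally show ?thesis .
qed

lemma freq_dot_add: "freq_dot (k + l) x = freq_dot k x + freq_dot l x"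
  by (simp add: freq_dot_def algebra_simps sum.distrib)

lemma freq_dot_diff: "freq_dot (k - l) x = freq_dot k x - freq_dot l x"
  by (simp add: freq_dot_def algebra_simps sum_subtractf)

lemma freq_dot_minus: "freq_dot (- k) x = - freq_dot k x"
  by (simp add: freq_dot_def sum_negf)

lemma freq_dot_zero [simp]: "freq_dot 0 x = 0"
  by (simp add: freq_dot_def)

lemma freq_dot_sum: "freq_dot (\<Sum>a\<in>S. h a) x = (\<Sum>a\<in>S. freq_dot (h a) x)"
  by (induction S rule: infinite_finite_induct) (auto simp: freq_dot_add)

lemma continuous_on_freq_dot [continuous_intros]:
  "continuous_on S f \<Longrightarrow> continuous_on S (\<lambda>x. freq_dot k (f x))"
  unfolding freq_dot_def by (intro continuous_intros)

lemma measurable_freq_dot [measurable]: "freq_dot k \<in> borel_measurable borel"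
  by (intro borel_measurable_continuous_onI continuous_intros)

lemma measurable_cis [measurable]: "cis \<in> borel_measurable borel"
  by (intro borel_measurable_continuous_onI continuous_intros)

lemma integral_torus_cis:
  "(LINT x|torus_measure. cis (freq_dot k x)) = of_bool (k = (0 :: int ^ 'd))"
proof -
  have int: "integrable lborel (\<lambda>t. indicator {0..2 * pi} t *\<^sub>R cis (real_of_int c * t))" for c
    by (intro borel_integrable_compact continuous_intros) simp
  \<comment> \<open>Fubini runs over \<open>Basis\<close>, so the frequency coordinate that belongs
    to a basis vector \<open>b\<close> is read off by a sum with one nonzero case.\<close>
  define g where "g = (\<lambda>b t. indicator {0..2 * pi} t *\<^sub>R cis (real_of_int (\<Sum>j\<in>UNIV. if b = axis j (1::real) then vec_nth k j else 0) * t))"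
  have sumk: "(\<Sum>i\<in>UNIV. if axis j (1::real) = axis i 1 then vec_nth k i else 0) = vec_nth k j" for j
    by (simp add: axis_eq_axis)
  have "(LINT x:torus_cube|lborel. cis (freq_dot k x)) = (LINT x|lborel. (\<Prod>b\<in>(Basis :: (real ^ 'd) set). g b (inner x b)))"
    unfolding set_lebesgue_integral_def
  proof (intro Bochner_Integration.integral_cong refl)
    fix x :: "real ^ 'd"
    have ind: "(\<Prod>j\<in>UNIV. indicator {0..2 * pi} (vec_nth x j)) = (indicator torus_cube x :: real)"
    proof (cases "x \<in> torus_cube")
      case False
      then obtain j where "vec_nth x j \<notin> {0..2 * pi}" by (auto simp: torus_cube_def)
      then have "(\<Prod>j\<in>UNIV. indicator {0..2 * pi} (vec_nth x j)) = (0::real)"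
        by (intro prod_zero bexI[of _ j]) auto
      then show ?thesis using False by simp
    qed (auto simp: torus_cube_def)
    have c: "(\<Prod>j\<in>UNIV. cis (real_of_int (vec_nth k j) * vec_nth x j)) = cis (freq_dot k x)"
      unfolding freq_dot_def by (simp add: cis_conv_exp exp_sum sum_distrib_left)
    have "(\<Prod>b\<in>Basis. g b (inner x b)) = (\<Prod>j\<in>UNIV. indicator {0..2 * pi} (vec_nth x j) *\<^sub>R cis (real_of_int (vec_nth k j) * vec_nth x j))"
      unfolding prod_Basis_vec g_def sumk by (simp add: inner_axis)
    also have "\<dots> = indicator torus_cube x *\<^sub>R cis (freq_dot k x)"
      unfolding scaleR_conv_of_real prod.distrib c of_real_prod[symmetric] ind ..
    finally show "indicator torus_cube x *\<^sub>R cis (freq_dot k x) = (\<Prod>b\<in>Basis. g b (inner x b))"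
      by simp
  qed
  also have "\<dots> = (\<Prod>b\<in>(Basis :: (real ^ 'd) set). LINT t|lborel. g b t)"
    by (rule integral_lborel_prod) (simp only: g_def int)
  also have "\<dots> = (\<Prod>j\<in>UNIV. of_bool (vec_nth k j = 0) * (2 * pi))"
    unfolding prod_Basis_vec g_def sumk integral_cis_int by simp
  also have "\<dots> = of_bool (k = 0) * (2 * pi) ^ CARD('d)"
  proof (cases "k = 0")
    case False
    then obtain j where "vec_nth k j \<noteq> 0" by (auto simp: Finite_Cartesian_Product.vec_eq_iff)
    then have "(\<Prod>j\<in>UNIV. of_bool (vec_nth k j = 0) * (2 * pi)) = 0"
      by (intro prod_zero bexI[of _ j]) auto
    then show ?thesis using False by simp
  qed simp
  finally show ?thesis
    by (subst integral_torus_measure) auto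
qed

abbreviation torus_sample :: "nat \<Rightarrow> (nat \<Rightarrow> real ^ 'd) measure" where
  "torus_sample n \<equiv> \<Pi>\<^sub>M j\<in>{1..n}. torus_measure"

lemma prob_space_torus_sample: "prob_space (torus_sample n :: (nat \<Rightarrow> real ^ 'd) measure)"
  by (intro prob_space_PiM prob_space_torus_measure)

lemma integrable_torus_cis: "integrable torus_measure (\<lambda>x. cis (freq_dot k x))"
proof -
  interpret prob_space "torus_measure :: (real ^ 'd) measure" by (rule prob_space_torus_measure)
  show ?thesis by (rule integrable_const_bound[where B = 1]) auto
qed

lemma
  fixes h :: "nat \<Rightarrow> int ^ 'd"
  shows integrable_sample_cis: "integrable (torus_sample n) (\<lambda>X. \<Prod>j\<in>{1..n}. cis (freq_dot (h j) (X j)))"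
    and integral_sample_cis:
      "(LINT X|torus_sample n. (\<Prod>j\<in>{1..n}. cis (freq_dot (h j) (X j)))) = of_bool (\<forall>j\<in>{1..n}. h j = 0)"
proof -
  interpret product_sigma_finite "\<lambda>_::nat. torus_measure :: (real ^ 'd) measure"
    by (simp add: product_sigma_finite_def prob_space_imp_sigma_finite prob_space_torus_measure)
  show "integrable (torus_sample n) (\<lambda>X. \<Prod>j\<in>{1..n}. cis (freq_dot (h j) (X j)))"
    by (rule product_integrable_prod) (auto intro: integrable_torus_cis)
  show "(LINT X|torus_sample n. (\<Prod>j\<in>{1..n}. cis (freq_dot (h j) (X j)))) = of_bool (\<forall>j\<in>{1..n}. h j = 0)"
    by (subst product_integral_prod) (auto intro: integrable_torus_cis simp: integral_torus_cis)
qed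

subsection \<open>Concentration of Gram matrices\<close>

text \<open>
  The weighted Gram matrix of the characters at the sample points minus its diagonal, which is
  \<open>n * u k\<close> whatever the points are.
\<close>

definition gram_deviation ::
  "(int ^ 'd \<Rightarrow> real) \<Rightarrow> nat \<Rightarrow> (nat \<Rightarrow> real ^ 'd) \<Rightarrow> int ^ 'd \<Rightarrow> int ^ 'd \<Rightarrow> complex" where
  "gram_deviation u n X k l =
     (if k = l then 0 else of_real (sqrt (u k * u l)) * (\<Sum>j\<in>{1..n}. cis (freq_dot (l - k) (X j))))"

lemma gram_deviation_hermitian: "gram_deviation u n X l k = cnj (gram_deviation u n X k l)"
proof -
  have "cis (freq_dot (k - l) x) = cnj (cis (freq_dot (l - k) x))" for x
    using freq_dot_minus[of "l - k" x] by (simp add: cis_cnj)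
  then show ?thesis by (simp add: gram_deviation_def mult.commute)
qed

text \<open>Around the cycle every \<open>v a\<close> occurs in two factors, each time under a
  root.\<close>

lemma prod_sqrt_cyclic:
  assumes "\<And>a. a < p \<Longrightarrow> 0 \<le> v a"
  shows "(\<Prod>a<p. sqrt (v a * v (cyc_succ p a))) = (\<Prod>a<p. v a)"
proof -
  have "(\<Prod>a<p. v (cyc_succ p a)) = (\<Prod>a<p. v a)"
    using prod.reindex_bij_betw[OF bij_betw_cyc_succ, of v p] .
  moreover have sqrt_prod: "sqrt (\<Prod>a<p. f a) = (\<Prod>a<p. sqrt (f a))" for f
    by (induction p) (auto simp: real_sqrt_mult)
  ultimately have "(\<Prod>a<p. sqrt (v a * v (cyc_succ p a))) = sqrt (\<Prod>a<p. v a) * sqrt (\<Prod>a<p. v a)"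
    by (simp add: real_sqrt_mult prod.distrib flip: sqrt_prod)
  also have "\<dots> = (\<Prod>a<p. v a)"
    using assms by (intro real_sqrt_mult_self[THEN trans] abs_of_nonneg prod_nonneg) auto
  finally show ?thesis .
qed

lemma cis_sum: "cis (\<Sum>a\<in>S. t a) = (\<Prod>a\<in>S. cis (t a))"
  by (induction S rule: infinite_finite_induct) (auto simp: cis_mult[symmetric])

lemma prod_cis_word:
  fixes w :: "nat \<Rightarrow> nat"
  assumes "w \<in> {..<p} \<rightarrow> {1..n}"
  shows "(\<Prod>a<p. cis (freq_dot (h a) (X (w a))))
       = (\<Prod>j\<in>{1..n}. cis (freq_dot (\<Sum>a | a < p \<and> w a = j. h a) (X j)))"
proof -
  have "(\<Prod>a<p. cis (freq_dot (h a) (X (w a))))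
      = (\<Prod>j\<in>{1..n}. \<Prod>a | a \<in> {..<p} \<and> w a = j. cis (freq_dot (h a) (X (w a))))"
    using assms by (intro prod.group[symmetric] finite_lessThan) auto
  also have "\<dots> = (\<Prod>j\<in>{1..n}. cis (freq_dot (\<Sum>a | a < p \<and> w a = j. h a) (X j)))"
  proof (intro prod.cong refl)
    fix j
    have "(\<Prod>a | a \<in> {..<p} \<and> w a = j. cis (freq_dot (h a) (X (w a))))
        = (\<Prod>a | a < p \<and> w a = j. cis (freq_dot (h a) (X j)))"
      by (intro prod.cong) auto
    also have "\<dots> = cis (freq_dot (\<Sum>a | a < p \<and> w a = j. h a) (X j))"
      unfolding freq_dot_sum by (simp only: cis_sum)
    finally show "(\<Prod>a | a \<in> {..<p} \<and> w a = j. cis (freq_dot (h a) (X (w a))))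
        = cis (freq_dot (\<Sum>a | a < p \<and> w a = j. h a) (X j))" .
  qed
  finally show ?thesis .
qed

text \<open>Expanding each entry over the sample points labels every step of a closed path with the
  point it uses. Collecting exponents letter by letter leaves one character per point, a form that
  independence can integrate.\<close>

lemma trace_gram_deviation:
  fixes u :: "int ^ 'd \<Rightarrow> real"
  assumes F: "finite F" and p: "p > 0" and u: "\<And>k. k \<in> F \<Longrightarrow> 0 \<le> u k"
  shows "(\<Sum>x\<in>F. kernel_power F (gram_deviation u n X) p x x)
       = (\<Sum>w\<in>{..<p} \<rightarrow>\<^sub>E {1..n}. \<Sum>k | k \<in> {..<p} \<rightarrow>\<^sub>E F \<and> (\<forall>a<p. k a \<noteq> k (cyc_succ p a)).
            of_real (\<Prod>a<p. u (k a)) *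
            (\<Prod>j\<in>{1..n}. cis (freq_dot (\<Sum>a | a < p \<and> w a = j. k (cyc_succ p a) - k a) (X j))))"
proof -
  let ?K = "{k. k \<in> {..<p} \<rightarrow>\<^sub>E F \<and> (\<forall>a<p. k a \<noteq> k (cyc_succ p a))}"
  let ?e = "\<lambda>w k. \<Prod>j\<in>{1..n}. cis (freq_dot (\<Sum>a | a < p \<and> w a = j. k (cyc_succ p a) - k a) (X j))"
  have "(\<Sum>x\<in>F. kernel_power F (gram_deviation u n X) p x x)
      = (\<Sum>k\<in>{..<p} \<rightarrow>\<^sub>E F. \<Prod>a<p. gram_deviation u n X (k a) (k (cyc_succ p a)))"
    by (rule trace_kernel_power[OF F p])
  \<comment> \<open>The zero diagonal of \<open>gram_deviation\<close> removes tuples with equal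
    cyclic neighbours; this is what later excludes letters that occur once.\<close>
  also have "\<dots> = (\<Sum>k\<in>?K. \<Prod>a<p. gram_deviation u n X (k a) (k (cyc_succ p a)))"
  proof (rule sum.mono_neutral_right)
    show "finite ({..<p} \<rightarrow>\<^sub>E F)" by (intro finite_PiE F) auto
    show "\<forall>k\<in>({..<p} \<rightarrow>\<^sub>E F) - ?K. (\<Prod>a<p. gram_deviation u n X (k a) (k (cyc_succ p a))) = 0"
    proof
      fix k assume "k \<in> ({..<p} \<rightarrow>\<^sub>E F) - ?K"
      then obtain a where "a < p" "k a = k (cyc_succ p a)" by auto
      then show "(\<Prod>a<p. gram_deviation u n X (k a) (k (cyc_succ p a))) = 0"
        by (intro prod_zero bexI[of _ a]) (auto simp: gram_deviation_def)
    qed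
  qed auto
  also have "\<dots> = (\<Sum>k\<in>?K. \<Sum>w\<in>{..<p} \<rightarrow>\<^sub>E {1..n}. of_real (\<Prod>a<p. u (k a)) * ?e w k)"
  proof (intro sum.cong refl)
    fix k assume k: "k \<in> ?K"
    let ?d = "\<lambda>a. k (cyc_succ p a) - k a"
    have "(\<Prod>a<p. gram_deviation u n X (k a) (k (cyc_succ p a)))
        = (\<Prod>a<p. of_real (sqrt (u (k a) * u (k (cyc_succ p a)))) * (\<Sum>j\<in>{1..n}. cis (freq_dot (?d a) (X j))))"
      using k by (intro prod.cong refl) (auto simp: gram_deviation_def)
    also have "\<dots> = of_real (\<Prod>a<p. sqrt (u (k a) * u (k (cyc_succ p a)))) *
        (\<Prod>a<p. \<Sum>j\<in>{1..n}. cis (freq_dot (?d a) (X j)))"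
      by (simp add: prod.distrib)
    also have "(\<Prod>a<p. sqrt (u (k a) * u (k (cyc_succ p a)))) = (\<Prod>a<p. u (k a))"
      using k by (intro prod_sqrt_cyclic u) auto
    also have "(\<Prod>a<p. \<Sum>j\<in>{1..n}. cis (freq_dot (?d a) (X j)))
        = (\<Sum>w\<in>{..<p} \<rightarrow>\<^sub>E {1..n}. \<Prod>a<p. cis (freq_dot (?d a) (X (w a))))"
      by (rule prod_sum_PiE) auto
    also have "\<dots> = (\<Sum>w\<in>{..<p} \<rightarrow>\<^sub>E {1..n}. ?e w k)"
      by (intro sum.cong refl prod_cis_word) auto
    finally show "(\<Prod>a<p. gram_deviation u n X (k a) (k (cyc_succ p a)))
        = (\<Sum>w\<in>{..<p} \<rightarrow>\<^sub>E {1..n}. of_real (\<Prod>a<p. u (k a)) * ?e w k)"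
      by (simp add: sum_distrib_left)
  qed
  finally show ?thesis by (subst (asm) sum.swap)
qed

lemma
  fixes u :: "int ^ 'd \<Rightarrow> real"
  assumes F: "finite F" and p: "p > 0" "even p"
    and u: "\<And>k. k \<in> F \<Longrightarrow> 0 \<le> u k" "\<And>k. k \<in> F \<Longrightarrow> u k \<le> \<tau>"
    and W: "sum u F \<le> W" "0 < W" and \<tau>: "0 < \<tau>" "\<tau> \<le> 2 * W"
  shows integrable_trace_gram_deviation:
      "integrable (torus_sample n) (\<lambda>X. Re (\<Sum>x\<in>F. kernel_power F (gram_deviation u n X) p x x))"
    and expected_trace_gram_deviation_le:
      "(LINT X|torus_sample n. Re (\<Sum>x\<in>F. kernel_power F (gram_deviation u n X) p x x))
        \<le> 2 * (W / \<tau>) * (2 * W * real p) ^ p * exp (real n * \<tau> / (5 * W) - real p)"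
proof -
  let ?K = "{k. k \<in> {..<p} \<rightarrow>\<^sub>E F \<and> (\<forall>a<p. k a \<noteq> k (cyc_succ p a))}"
  let ?e = "\<lambda>w k X. \<Prod>j\<in>{1..n}. cis (freq_dot (\<Sum>a | a < p \<and> w a = j. k (cyc_succ p a) - k a) (X j))"
  let ?T = "\<lambda>X. \<Sum>x\<in>F. kernel_power F (gram_deviation u n X) p x x"
  let ?Wd = "{..<p} \<rightarrow>\<^sub>E {1..n}"
  have T: "?T X = (\<Sum>w\<in>?Wd. \<Sum>k\<in>?K. of_real (\<Prod>a<p. u (k a)) * ?e w k X)" for X
    by (rule trace_gram_deviation[OF F p(1) u(1)])
  have finK: "finite ?K"
    by (rule finite_subset[of _ "{..<p} \<rightarrow>\<^sub>E F"]) (auto intro: finite_PiE F)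
  have inte: "integrable (torus_sample n) (?e w k)" for w k by (rule integrable_sample_cis)
  have intT: "integrable (torus_sample n) ?T"
    unfolding T by (intro Bochner_Integration.integrable_sum integrable_mult_right inte)
  then show "integrable (torus_sample n) (\<lambda>X. Re (?T X))" by (rule integrable_Re)
  \<comment> \<open>\<open>balanced\<close> ranges over all natural numbers, but letters outside
    \<open>{1..n}\<close> do not occur in \<open>w\<close> and give empty sums. The opposite sign of
    the exponents is immaterial.\<close>
  have bal: "(\<forall>j\<in>{1..n}. (\<Sum>a | a < p \<and> w a = j. k (cyc_succ p a) - k a) = 0) \<longleftrightarrow> balanced p w k"
    if "w \<in> ?Wd" for w :: "nat \<Rightarrow> nat" and k :: "nat \<Rightarrow> int ^ 'd"
  proof -
    have neg: "(\<Sum>a | a < p \<and> w a = j. k (cyc_succ p a) - k a) = - (\<Sum>a | a < p \<and> w a = j. k a - k (cyc_succ p a))" for j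
      by (simp add: sum_negf[symmetric])
    have out: "(\<Sum>a | a < p \<and> w a = j. k a - k (cyc_succ p a)) = 0" if "j \<notin> {1..n}" for j
    proof -
      have e: "{a. a < p \<and> w a = j} = {}" using \<open>w \<in> ?Wd\<close> that by fastforce
      show ?thesis by (simp only: e sum.empty)
    qed
    show ?thesis unfolding balanced_def neg neg_equal_0_iff_equal using out by blast
  qed
  have "(LINT X|torus_sample n. ?T X)
      = (\<Sum>w\<in>?Wd. \<Sum>k\<in>?K. of_real (\<Prod>a<p. u (k a)) * (LINT X|torus_sample n. ?e w k X))"
    unfolding T by (simp only: Bochner_Integration.integral_sum Bochner_Integration.integrable_sum
        integrable_mult_right inte integral_mult_right_zero)
  also have "\<dots> = (\<Sum>w\<in>?Wd. \<Sum>k\<in>?K. of_real (\<Prod>a<p. u (k a)) * of_bool (balanced p w k))"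
    by (intro sum.cong refl) (simp only: integral_sample_cis bal)
  also have "\<dots> = of_real (\<Sum>w\<in>?Wd. \<Sum>k\<in>?K. (\<Prod>a<p. u (k a)) * of_bool (balanced p w k))"
    unfolding of_real_sum of_real_mult by (intro sum.cong refl arg_cong2[where f = "(*)"]) auto
  finally have "(LINT X|torus_sample n. Re (?T X)) = (\<Sum>w\<in>?Wd. \<Sum>k\<in>?K. (\<Prod>a<p. u (k a)) * of_bool (balanced p w k))"
    by (simp only: integral_Re[OF intT] Re_complex_of_real)
  also have "\<dots> = (\<Sum>w\<in>?Wd. \<Sum>k | k \<in> {..<p} \<rightarrow>\<^sub>E F \<and> balanced p w k \<and> (\<forall>a<p. k a \<noteq> k (cyc_succ p a)). \<Prod>a<p. u (k a))"
    by (intro sum.cong refl sum.mono_neutral_cong_right finK) auto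
  also have "\<dots> \<le> (\<Sum>w\<in>?Wd. (W / \<tau>) * W ^ p * (\<Prod>j\<in>{1..n}. word_weight (\<tau> / W) (card {a. a < p \<and> w a = j})))"
    by (intro sum_mono sum_balanced_le F p u W \<tau>) auto
  also have "\<dots> = (W / \<tau>) * W ^ p * (\<Sum>w\<in>?Wd. \<Prod>j\<in>{1..n}. word_weight (\<tau> / W) (card {a. a < p \<and> w a = j}))"
    by (simp only: sum_distrib_left)
  also have "\<dots> \<le> (W / \<tau>) * W ^ p * (2 * (2 * real p) ^ p * exp (real (card {1..n}) * (\<tau> / W) / 5 - real p))"
    using W \<tau> by (intro mult_left_mono sum_words_le p) (auto simp: field_simps)
  also have "\<dots> = 2 * (W / \<tau>) * (2 * W * real p) ^ p * exp (real n * \<tau> / (5 * W) - real p)"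
    by (simp add: power_mult_distrib mult_ac)
  finally show "(LINT X|torus_sample n. Re (?T X))
      \<le> 2 * (W / \<tau>) * (2 * W * real p) ^ p * exp (real n * \<tau> / (5 * W) - real p)" .
qed

lemma weighted_gram_form:
  fixes u :: "int ^ 'd \<Rightarrow> real" and a :: "int ^ 'd \<Rightarrow> complex"
  assumes F: "finite F" and u: "\<And>k. k \<in> F \<Longrightarrow> 0 \<le> u k"
  shows "of_real (\<Sum>j\<in>{1..n}. (cmod (\<Sum>k\<in>F. of_real (sqrt (u k)) * a k * cis (freq_dot k (X j))))\<^sup>2)
       = of_real (real n * (\<Sum>k\<in>F. u k * (cmod (a k))\<^sup>2))
         + (\<Sum>k\<in>F. \<Sum>l\<in>F. cnj (a k) * gram_deviation u n X k l * a l)"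
proof -
  let ?t = "\<lambda>k l j. cnj (a k) * of_real (sqrt (u k * u l)) * cis (freq_dot (l - k) (X j)) * a l"
  have sq: "of_real ((cmod (\<Sum>k\<in>F. of_real (sqrt (u k)) * a k * cis (freq_dot k (X j))))\<^sup>2)
      = (\<Sum>k\<in>F. \<Sum>l\<in>F. ?t k l j)" for j
  proof -
    let ?z = "\<lambda>k. of_real (sqrt (u k)) * a k * cis (freq_dot k (X j))"
    have "of_real ((cmod (\<Sum>k\<in>F. ?z k))\<^sup>2) = (\<Sum>k\<in>F. ?z k) * cnj (\<Sum>k\<in>F. ?z k)"
      by (rule complex_norm_square)
    also have "\<dots> = (\<Sum>k\<in>F. cnj (?z k)) * (\<Sum>l\<in>F. ?z l)"
      by (simp only: cnj_sum mult.commute)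
    also have "\<dots> = (\<Sum>k\<in>F. \<Sum>l\<in>F. cnj (?z k) * ?z l)" by (rule sum_product)
    also have "\<dots> = (\<Sum>k\<in>F. \<Sum>l\<in>F. ?t k l j)"
    proof (intro sum.cong refl)
      fix k l assume "k \<in> F" "l \<in> F"
      have "cis (freq_dot (l - k) (X j)) = cis (- freq_dot k (X j)) * cis (freq_dot l (X j))"
        by (simp add: freq_dot_diff cis_mult)
      then show "cnj (?z k) * ?z l = ?t k l j"
        by (simp add: real_sqrt_mult cis_cnj mult_ac)
    qed
    finally show ?thesis .
  qed
  have "of_real (\<Sum>j\<in>{1..n}. (cmod (\<Sum>k\<in>F. of_real (sqrt (u k)) * a k * cis (freq_dot k (X j))))\<^sup>2)
      = (\<Sum>j\<in>{1..n}. \<Sum>k\<in>F. \<Sum>l\<in>F. ?t k l j)"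
    unfolding of_real_sum sq ..
  also have "\<dots> = (\<Sum>k\<in>F. \<Sum>l\<in>F. \<Sum>j\<in>{1..n}. ?t k l j)"
    by (subst sum.swap) (intro sum.cong refl sum.swap)
  also have "\<dots> = (\<Sum>k\<in>F. \<Sum>l\<in>F. (if l = k then of_real (real n * (u k * (cmod (a k))\<^sup>2)) else 0)
      + cnj (a k) * gram_deviation u n X k l * a l)"
  proof (intro sum.cong refl)
    fix k l assume kl: "k \<in> F" "l \<in> F"
    show "(\<Sum>j\<in>{1..n}. ?t k l j) = (if l = k then of_real (real n * (u k * (cmod (a k))\<^sup>2)) else 0)
      + cnj (a k) * gram_deviation u n X k l * a l"
    proof (cases "l = k")
      case True
      have "cnj (a k) * a k = of_real ((cmod (a k))\<^sup>2)"
        by (simp only: complex_norm_square mult.commute)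
      then show ?thesis using True kl u by (simp add: gram_deviation_def algebra_simps)
    next
      case False
      then show ?thesis
        by (simp add: gram_deviation_def sum_distrib_left sum_distrib_right mult.assoc)
    qed
  qed
  also have "\<dots> = of_real (real n * (\<Sum>k\<in>F. u k * (cmod (a k))\<^sup>2))
         + (\<Sum>k\<in>F. \<Sum>l\<in>F. cnj (a k) * gram_deviation u n X k l * a l)"
    using F by (simp add: sum.distrib sum_distrib_left)
  finally show ?thesis .
qed

text \<open>Markov's inequality is applied to the trace and not to the quadratic form. The
  exceptional set is thus independent of \<open>a\<close>, the estimate holds for all coefficients
  at once, and measurability is that of the trace.\<close>

lemma gram_deviation_concentration:
  fixes u :: "int ^ 'd \<Rightarrow> real"
  assumes F: "finite F" and p: "p > 0" "even p"
    and u: "\<And>k. k \<in> F \<Longrightarrow> 0 \<le> u k" "\<And>k. k \<in> F \<Longrightarrow> u k \<le> \<tau>"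
    and W: "sum u F \<le> W" "0 < W" and \<tau>: "0 < \<tau>" "\<tau> \<le> 2 * W"
    and v: "2 * W * real p \<le> v"
  obtains E where "E \<in> sets (torus_sample n)"
    "measure (torus_sample n) E \<le> 2 * (W / \<tau>) * exp (real n * \<tau> / (5 * W) - real p)"
    "\<forall>X\<in>space (torus_sample n) - E. \<forall>a.
      \<bar>(\<Sum>j\<in>{1..n}. (cmod (\<Sum>k\<in>F. of_real (sqrt (u k)) * a k * cis (freq_dot k (X j))))\<^sup>2)
        - real n * (\<Sum>k\<in>F. u k * (cmod (a k))\<^sup>2)\<bar> \<le> v * (\<Sum>k\<in>F. (cmod (a k))\<^sup>2)"
proof -
  let ?M = "torus_sample n :: (nat \<Rightarrow> real ^ 'd) measure"
  let ?T = "\<lambda>X. Re (\<Sum>x\<in>F. kernel_power F (gram_deviation u n X) p x x)"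
  interpret prob_space ?M by (rule prob_space_torus_sample)
  have v0: "0 < v" using v W p by (smt (verit, best) mult_pos_pos of_nat_0_less_iff)
  have int: "integrable ?M ?T"
    by (rule integrable_trace_gram_deviation[OF F p u W \<tau>])
  note [measurable] = borel_measurable_integrable[OF int]
  obtain q where q: "p = 2 * q" using p by auto
  have q0: "q > 0" using p q by simp
  have form: "cmod (\<Sum>k\<in>F. \<Sum>l\<in>F. cnj (a k) * gram_deviation u n X k l * a l) ^ p
      \<le> (\<Sum>k\<in>F. (cmod (a k))\<^sup>2) ^ p * ?T X" for a X
    unfolding q by (rule hermitian_form_le_trace[OF F _ q0]) (rule gram_deviation_hermitian)
  \<comment> \<open>Markov's inequality needs a nonnegative trace; \<open>form\<close> gives it when
    tested on the unit vector of a single frequency.\<close>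
  have T0: "0 \<le> ?T X" for X
  proof (cases "F = {}")
    case False
    then obtain k where k: "k \<in> F" by blast
    have "(\<Sum>l\<in>F. (cmod (of_bool (l = k)))\<^sup>2) = (1::real)"
      by (subst sum.mono_neutral_cong_right[of F "{k}" _ "\<lambda>_. 1"]) (use F k in auto)
    then show ?thesis using order_trans[OF zero_le_power[OF norm_ge_zero] form[of "\<lambda>l. of_bool (l = k)" X]]
      by (simp only: power_one mult_1)
  qed simp
  define E where "E = {X \<in> space ?M. v ^ p \<le> ?T X}"
  have E: "E \<in> sets ?M" unfolding E_def by measurable
  have "prob E \<le> (LINT X|?M. ?T X) / v ^ p"
    unfolding E_def by (rule integral_Markov_inequality_measure[OF int sets.empty_sets AE_I2[OF T0]]) (use v0 in simp)
  also have "\<dots> \<le> (2 * (W / \<tau>) * (2 * W * real p) ^ p * exp (real n * \<tau> / (5 * W) - real p)) / v ^ p"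
    using v0 by (intro divide_right_mono expected_trace_gram_deviation_le[OF F p u W \<tau>]) auto
  also have "\<dots> = (2 * W * real p / v) ^ p * (2 * (W / \<tau>) * exp (real n * \<tau> / (5 * W) - real p))"
    by (simp add: power_divide mult_ac)
  also have "\<dots> \<le> 1 * (2 * (W / \<tau>) * exp (real n * \<tau> / (5 * W) - real p))"
    using v v0 W \<tau> by (intro mult_right_mono power_le_one) auto
  finally have pE: "prob E \<le> 2 * (W / \<tau>) * exp (real n * \<tau> / (5 * W) - real p)" by simp
  show ?thesis
  proof (rule that[OF E pE], intro ballI allI)
    fix X and a :: "int ^ 'd \<Rightarrow> complex" assume X: "X \<in> space ?M - E"
    let ?S = "\<Sum>k\<in>F. \<Sum>l\<in>F. cnj (a k) * gram_deviation u n X k l * a l"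
    let ?l = "(\<Sum>j\<in>{1..n}. (cmod (\<Sum>k\<in>F. of_real (sqrt (u k)) * a k * cis (freq_dot k (X j))))\<^sup>2)
        - real n * (\<Sum>k\<in>F. u k * (cmod (a k))\<^sup>2)"
    have "complex_of_real ?l = ?S"
      using weighted_gram_form[OF F u(1), where n = n and a = a and X = X] by (simp only: of_real_diff add_diff_cancel_left')
    then have "cmod (complex_of_real ?l) = cmod ?S" by (rule arg_cong)
    then have "\<bar>?l\<bar> = cmod ?S" by (simp only: norm_of_real)
    moreover have "cmod ?S ^ p \<le> ((\<Sum>k\<in>F. (cmod (a k))\<^sup>2) * v) ^ p"
    proof -
      have "?T X \<le> v ^ p" using X unfolding E_def by (simp only: Diff_iff mem_Collect_eq) linarith
      then have "(\<Sum>k\<in>F. (cmod (a k))\<^sup>2) ^ p * ?T X \<le> (\<Sum>k\<in>F. (cmod (a k))\<^sup>2) ^ p * v ^ p"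
        by (intro mult_left_mono zero_le_power sum_nonneg) auto
      then show ?thesis using form[of a X] by (simp add: power_mult_distrib)
    qed
    then have "cmod ?S \<le> (\<Sum>k\<in>F. (cmod (a k))\<^sup>2) * v"
      using p v0 by (subst (asm) power_mono_iff) (auto intro!: mult_nonneg_nonneg sum_nonneg)
    ultimately show "\<bar>?l\<bar> \<le> v * (\<Sum>k\<in>F. (cmod (a k))\<^sup>2)" by (simp add: mult.commute)
  qed
qed

subsection \<open>Hyperbolic cross weights\<close>

lemma mix_weight_eq_powr: "mix_weight s k = mix_weight 1 k powr s"
  by (simp add: mix_weight_def prod_powr_distrib)

lemma mix_weight_pos [simp]: "0 < mix_weight s k"
  unfolding mix_weight_def by (intro prod_pos) (simp add: add_pos_nonneg)

lemma mix_weight_nonneg [simp]: "0 \<le> mix_weight s k"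
  using mix_weight_pos[of s k] by linarith

lemma mix_weight_neq_0 [simp]: "mix_weight s k \<noteq> 0"
  using mix_weight_pos[of s k] by linarith

lemma one_le_mix_weight: "1 \<le> mix_weight 1 k"
  unfolding mix_weight_def by (rule prod_ge_1) auto

lemma coordinate_le_mix_weight: "1 + real_of_int \<bar>vec_nth k j\<bar> \<le> mix_weight 1 k"
proof -
  have "1 + real_of_int \<bar>vec_nth k j\<bar> \<le> (1 + real_of_int \<bar>vec_nth k j\<bar>) * (\<Prod>i\<in>UNIV - {j}. 1 + real_of_int \<bar>vec_nth k i\<bar>)"
    using prod_ge_1[of "UNIV - {j}" "\<lambda>i. 1 + real_of_int \<bar>vec_nth k i\<bar>"]
    by (intro mult_le_cancel_left1[THEN iffD2]) auto
  also have "\<dots> = mix_weight 1 k"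
    unfolding mix_weight_def by (subst prod.remove[of UNIV j]) auto
  finally show ?thesis .
qed

text \<open>
  The exponent satisfies \<open>2 powr \<alpha> = 2 * d\<close>, so that each dyadic block contributes a term of a geometric
  series with ratio \<open>1 / d\<close>.
\<close>

lemma sum_dyadic_le:
  fixes \<alpha> :: real and d :: nat
  assumes d: "d \<ge> 2" and \<alpha>: "\<alpha> = 1 + log 2 (real d)"
  shows "(\<Sum>i | 1 + \<bar>i\<bar> < (2::int) ^ Suc M. (1 + real_of_int \<bar>i\<bar>) powr (- \<alpha>))
       \<le> 1 + 2 * (1 - (1 / real d) ^ M) / (real d - 1)"
proof (induction M)
  case 0
  have "{i. 1 + \<bar>i\<bar> < (2::int) ^ Suc 0} = {0}" by auto
  then show ?case by simp
next
  case (Suc M)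
  let ?g = "\<lambda>i. (1 + real_of_int \<bar>i\<bar>) powr (- \<alpha>)"
  let ?Q = "(2::int) ^ Suc M"
  let ?D = "{i. 1 + \<bar>i\<bar> < ?Q}" and ?N = "{i. ?Q \<le> 1 + \<bar>i\<bar> \<and> 1 + \<bar>i\<bar> < 2 * ?Q}"
  have fD: "finite ?D" by (rule finite_subset[of _ "{- ?Q..?Q}"]) auto
  have fN: "finite ?N" by (rule finite_subset[of _ "{- 2 * ?Q..2 * ?Q}"]) auto
  have "{i. 1 + \<bar>i\<bar> < (2::int) ^ Suc (Suc M)} = ?D \<union> ?N" by auto
  then have "(\<Sum>i | 1 + \<bar>i\<bar> < (2::int) ^ Suc (Suc M). ?g i) = sum ?g ?D + sum ?g ?N"
    using fD fN by (simp only:) (rule sum.union_disjoint, auto)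
  moreover have "sum ?g ?N \<le> 2 * (1 / real d) ^ Suc M"
  proof -
    have l0: "0 \<le> log 2 (real d)" using d by simp
    have two: "2 powr \<alpha> = 2 * real d" using d unfolding \<alpha> by (simp add: powr_add)
    have "?g i \<le> (1 / (2 * real d)) ^ Suc M" if "i \<in> ?N" for i
    proof -
      have "real_of_int ?Q \<le> 1 + real_of_int \<bar>i\<bar>"
      proof -
        have "real_of_int ?Q \<le> real_of_int (1 + \<bar>i\<bar>)" using that by (simp only: of_int_le_iff mem_Collect_eq)
        then show ?thesis by (simp only: of_int_add of_int_1)
      qed
      then have "?g i \<le> real_of_int ?Q powr (- \<alpha>)"
        using l0 by (intro powr_mono2') (auto simp: \<alpha>)
      also have "real_of_int ?Q = 2 powr real (Suc M)" by (subst powr_realpow) auto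
      also have "(2 powr real (Suc M)) powr (- \<alpha>) = (2 powr \<alpha>) powr (- real (Suc M))"
        by (simp only: powr_powr mult_minus_left mult_minus_right mult.commute)
      also have "\<dots> = (1 / (2 * real d)) ^ Suc M"
        unfolding two using d by (subst powr_minus, subst powr_realpow) (auto simp: field_simps power_divide)
      finally show ?thesis .
    qed
    then have "sum ?g ?N \<le> real (card ?N) * (1 / (2 * real d)) ^ Suc M"
      by (rule sum_bounded_above)
    moreover have "card ?N \<le> 2 * 2 ^ Suc M"
    proof -
      have "?N \<subseteq> {?Q - 1..<2 * ?Q - 1} \<union> {1 - 2 * ?Q<..1 - ?Q}" by auto
      then have "card ?N \<le> card ({?Q - 1..<2 * ?Q - 1} \<union> {1 - 2 * ?Q<..1 - ?Q})"
        by (intro card_mono) auto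
      also have "\<dots> \<le> card {?Q - 1..<2 * ?Q - 1} + card {1 - 2 * ?Q<..1 - ?Q}" by (rule card_Un_le)
      also have "\<dots> = 2 * 2 ^ Suc M" by (simp add: nat_power_eq nat_mult_distrib)
      finally show ?thesis .
    qed
    ultimately have "sum ?g ?N \<le> real (2 * 2 ^ Suc M) * (1 / (2 * real d)) ^ Suc M"
      by (smt (verit) mult_right_mono of_nat_le_iff zero_le_divide_1_iff zero_le_power of_nat_0_le_iff)
    also have "\<dots> = 2 * (1 / real d) ^ Suc M" by (simp add: field_simps)
    finally show ?thesis .
  qed
  moreover have "2 * (1 / real d) ^ Suc M = 2 * (1 - (1 / real d) ^ Suc M) / (real d - 1) - 2 * (1 - (1 / real d) ^ M) / (real d - 1)"
  proof -
    define u where "u = (1 / real d) ^ M"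
    have "2 * (1 - u / real d) - 2 * (1 - u) = 2 * (u / real d) * (real d - 1)"
      using d by (simp add: field_simps)
    then have e: "2 * (1 - (1 / real d) ^ Suc M) - 2 * (1 - (1 / real d) ^ M) = 2 * (1 / real d) ^ Suc M * (real d - 1)"
      by (simp add: u_def)
    show ?thesis unfolding diff_divide_distrib[symmetric] e using d by simp
  qed
  ultimately show ?case using Suc by linarith
qed

text \<open>Equality holds at \<open>d = 2\<close>, and the values decrease towards
  \<open>exp 2\<close>. Small \<open>d\<close> are evaluated; from \<open>13\<close> on,
  \<open>2 / (d - 1) \<le> 1 / 6\<close> makes the exponential bound sufficient.\<close>

lemma dyadic_constant_le:
  assumes "d \<ge> 2"
  shows "(1 + 2 / (real d - 1)) ^ d \<le> 9"
proof (cases "d \<le> 12")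
  case True
  have "d \<in> {2..12}" using assms True by simp
  also have "{2..12::nat} = {2,3,4,5,6,7,8,9,10,11,12}" by (simp add: atLeastAtMost_insertL[symmetric] eval_nat_numeral atLeastAtMostSuc_conv insert_commute)
  finally show ?thesis by (elim insertE emptyE) (simp_all add: eval_nat_numeral)
next
  case False
  have "(1 + 2 / (real d - 1)) ^ d \<le> exp (2 / (real d - 1)) ^ d"
    using assms exp_ge_add_one_self[of "2 / (real d - 1)"] by (intro power_mono) auto
  also have "\<dots> = exp (2 + 2 / (real d - 1))"
    using assms by (simp add: exp_of_nat_mult[symmetric] field_simps)
  also have "\<dots> \<le> exp (2 + 1 / 6)" using False by (simp add: field_simps)
  also have "\<dots> = exp 1 * exp 1 * exp (1/6)" by (simp flip: exp_add)
  also have "exp (1/6::real) \<le> 1 + 1/6 + (1/6)\<^sup>2" by (rule exp_bound) auto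
  also have "exp 1 * exp 1 * (1 + 1/6 + (1/6)\<^sup>2) \<le> 2.72 * 2.72 * (1 + 1/6 + (1/6)\<^sup>2 :: real)"
    using e_less_272 by (intro mult_mono) auto
  also have "\<dots> \<le> 9" by (simp add: power2_eq_square)
  finally show ?thesis by simp
qed

text \<open>Rankin's trick: each counted frequency satisfies
  \<open>1 \<le> (R / mix_weight 1 k) powr \<alpha>\<close>, and the sum of the right-hand sides,
  enlarged to a box, factorises into one-dimensional sums. The dyadic cut-off \<open>M\<close> only
  serves to keep these finite.\<close>

lemma card_hyperbolic_cross_le:
  fixes S :: "(int ^ 'd) set" and \<alpha> R :: real
  assumes \<alpha>: "\<alpha> = 1 + log 2 (real CARD('d))" and S: "finite S"
    and R: "\<And>k. k \<in> S \<Longrightarrow> mix_weight 1 k \<le> R"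
  shows "real (card S) \<le> 9 * R powr \<alpha>"
proof (cases "S = {}")
  case False
  then have R1: "1 \<le> R" using R one_le_mix_weight by (metis all_not_in_conv order_trans)
  have d1: "CARD('d) \<ge> 1" by (simp add: Suc_leI)
  show ?thesis
  \<comment> \<open>For \<open>d = 1\<close> the geometric ratio \<open>1 / d\<close> is
    \<open>1\<close> and the series diverges; integers are counted directly.\<close>
  proof (cases "CARD('d) = 1")
    case True
    then obtain j :: 'd where j: "UNIV = {j}" by (metis card_1_singletonE)
    have "inj_on (\<lambda>k. vec_nth k j) S"
    proof (rule inj_onI)
      fix k l :: "int ^ 'd" assume "vec_nth k j = vec_nth l j"
      moreover have "i = j" for i using j by auto
      ultimately show "k = l" unfolding Finite_Cartesian_Product.vec_eq_iff by metis
    qed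
    then have "card S = card ((\<lambda>k. vec_nth k j) ` S)" by (simp add: card_image)
    also have "\<dots> \<le> card {- \<lfloor>R\<rfloor>..\<lfloor>R\<rfloor>}"
    proof (intro card_mono subsetI)
      fix i assume "i \<in> (\<lambda>k. vec_nth k j) ` S"
      then have "real_of_int \<bar>i\<bar> \<le> R" using R coordinate_le_mix_weight
        by (smt (verit) imageE)
      then have "\<bar>i\<bar> \<le> \<lfloor>R\<rfloor>" by (simp add: le_floor_iff)
      then show "i \<in> {- \<lfloor>R\<rfloor>..\<lfloor>R\<rfloor>}" by auto
    qed auto
    finally have "card S \<le> nat (2 * \<lfloor>R\<rfloor> + 1)" by simp
    then have "real (card S) \<le> 2 * real_of_int \<lfloor>R\<rfloor> + 1" using R1 by linarith
    also have "\<dots> \<le> 9 * R" using R1 by linarith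
    finally show ?thesis using R1 True by (simp add: \<alpha>)
  next
    case False
    then have d2: "CARD('d) \<ge> 2" using d1 by linarith
    obtain M where M: "R < 2 ^ M" using real_arch_pow[of 2 R] by auto
    let ?g = "\<lambda>i. (1 + real_of_int \<bar>i\<bar>) powr (- \<alpha>)"
    let ?D = "{i. 1 + \<bar>i\<bar> < (2::int) ^ Suc M}"
    have fD: "finite ?D" by (rule finite_subset[of _ "{- (2 ^ Suc M)..2 ^ Suc M}"]) auto
    have "real (card S) = (\<Sum>k\<in>S. 1)" by simp
    also have "\<dots> \<le> (\<Sum>k\<in>S. R powr \<alpha> * (\<Prod>j\<in>UNIV. ?g (vec_nth k j)))"
    proof (rule sum_mono)
      fix k assume k: "k \<in> S"
      have "mix_weight 1 k powr \<alpha> \<le> R powr \<alpha>"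
        using R[OF k] mix_weight_pos[of 1 k] d2 \<alpha> by (intro powr_mono2) (auto simp: less_imp_le)
      then have "1 \<le> R powr \<alpha> * mix_weight 1 k powr (- \<alpha>)"
        using mix_weight_pos[of 1 k]
        by (subst powr_minus_divide) (simp add: pos_le_divide_eq powr_gt_zero less_imp_neq[symmetric] del: mix_weight_pos)
      also have "mix_weight 1 k powr (- \<alpha>) = mix_weight (- \<alpha>) k"
        by (rule mix_weight_eq_powr[symmetric])
      also have "mix_weight (- \<alpha>) k = (\<Prod>j\<in>UNIV. ?g (vec_nth k j))"
        by (simp only: mix_weight_def)
      finally show "1 \<le> R powr \<alpha> * (\<Prod>j\<in>UNIV. ?g (vec_nth k j))" .
    qed
    also have "\<dots> = R powr \<alpha> * (\<Sum>f\<in>vec_nth ` S. \<Prod>j\<in>UNIV. ?g (f j))"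
      by (simp add: sum_distrib_left sum.reindex vec_nth_inject inj_on_def)
    also have "\<dots> \<le> R powr \<alpha> * (\<Sum>f\<in>(UNIV :: 'd set) \<rightarrow>\<^sub>E ?D. \<Prod>j\<in>UNIV. ?g (f j))"
    proof (rule mult_left_mono[OF sum_mono2])
      show "finite ((UNIV :: 'd set) \<rightarrow>\<^sub>E ?D)" by (intro finite_PiE fD) auto
      show "vec_nth ` S \<subseteq> UNIV \<rightarrow>\<^sub>E ?D"
      proof
        fix f assume "f \<in> vec_nth ` S"
        then obtain k where k: "k \<in> S" "f = vec_nth k" by auto
        have "1 + \<bar>vec_nth k j\<bar> < 2 ^ Suc M" for j
        proof -
          have "1 + real_of_int \<bar>vec_nth k j\<bar> < 2 ^ M"
            using coordinate_le_mix_weight[of k j] R[OF k(1)] M by linarith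
          also have "(2::real) ^ M \<le> 2 ^ Suc M" by simp
          finally have "real_of_int (1 + \<bar>vec_nth k j\<bar>) < real_of_int (2 ^ Suc M)" by simp
          then show ?thesis by (simp only: of_int_less_iff)
        qed
        then show "f \<in> UNIV \<rightarrow>\<^sub>E ?D" using k by (simp add: PiE_iff extensional_def)
      qed
    qed (auto intro: prod_nonneg)
    also have "(\<Sum>f\<in>(UNIV :: 'd set) \<rightarrow>\<^sub>E ?D. \<Prod>j\<in>UNIV. ?g (f j)) = (\<Sum>i\<in>?D. ?g i) ^ CARD('d)"
      using prod_sum_PiE[of "UNIV :: 'd set" "\<lambda>_. ?D" "\<lambda>_ i. ?g i"] fD by simp
    also have "R powr \<alpha> * (\<Sum>i\<in>?D. ?g i) ^ CARD('d) \<le> R powr \<alpha> * (1 + 2 / (real CARD('d) - 1)) ^ CARD('d)"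
    proof (intro mult_left_mono power_mono)
      have "(\<Sum>i\<in>?D. ?g i) \<le> 1 + 2 * (1 - (1 / real CARD('d)) ^ M) / (real CARD('d) - 1)"
        by (rule sum_dyadic_le[OF d2 \<alpha>])
      also have "\<dots> \<le> 1 + 2 / (real CARD('d) - 1)"
        using d2 by (simp add: divide_right_mono)
      finally show "(\<Sum>i\<in>?D. ?g i) \<le> 1 + 2 / (real CARD('d) - 1)" .
    qed (auto intro: sum_nonneg)
    also have "\<dots> \<le> R powr \<alpha> * 9" by (intro mult_left_mono dyadic_constant_le[OF d2]) auto
    finally show ?thesis by (simp add: mult.commute)
  qed
qed simp

text \<open>The first \<open>l\<close> frequencies all lie in the cross whose radius
  \<open>R\<close> is the weight of the \<open>l\<close>-th one, so
  \<open>l \<le> 9 * R powr \<alpha>\<close>. The exponent \<open>\<beta> = 2 * s / \<alpha>\<close>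
  converts this into a statement on \<open>R powr (2 * s)\<close>.\<close>

lemma weight_ordering_decay:
  fixes \<kappa> :: "nat \<Rightarrow> int ^ 'd"
  assumes ord: "weight_ordering s \<kappa>" and s: "s > 0" and l: "l \<ge> 1"
    and \<beta>: "\<beta> = 2 * s / (1 + log 2 (real CARD('d)))"
  shows "1 / mix_weight (2 * s) (\<kappa> l) \<le> (9 / real l) powr \<beta>"
proof -
  define \<alpha> where "\<alpha> = 1 + log 2 (real CARD('d))"
  define R where "R = mix_weight 1 (\<kappa> l)"
  have d1: "real CARD('d) \<ge> 1" by (simp add: Suc_leI)
  then have \<alpha>1: "\<alpha> \<ge> 1" by (simp add: \<alpha>_def)
  have R0: "0 < R" by (simp add: R_def)
  have inj: "inj_on \<kappa> {1..l}"
    using ord by (auto simp: weight_ordering_def bij_betw_def intro: inj_on_subset)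
  have "real (card (\<kappa> ` {1..l})) \<le> 9 * R powr \<alpha>"
  proof (rule card_hyperbolic_cross_le[OF \<alpha>_def])
    fix k assume "k \<in> \<kappa> ` {1..l}"
    then obtain i where i: "k = \<kappa> i" "1 \<le> i" "i \<le> l" by auto
    have "mix_weight s (\<kappa> i) \<le> mix_weight s (\<kappa> l)"
      using ord i l by (auto simp: weight_ordering_def mono_on_def)
    then have "mix_weight 1 (\<kappa> i) powr s \<le> R powr s"
      unfolding R_def by (simp only: mix_weight_eq_powr[symmetric])
    then show "mix_weight 1 k \<le> R"
      unfolding i using s R0 by (metis mix_weight_pos not_le powr_less_mono2 less_imp_le)
  qed auto
  then have "real l / 9 \<le> R powr \<alpha>" using card_image[OF inj] by simp
  then have "(real l / 9) powr \<beta> \<le> (R powr \<alpha>) powr \<beta>"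
    using l s \<alpha>1 unfolding \<beta> \<alpha>_def[symmetric] by (intro powr_mono2) auto
  also have "\<dots> = R powr (2 * s)" using \<alpha>1 by (simp add: powr_powr \<beta> \<alpha>_def[symmetric])
  also have "\<dots> = mix_weight (2 * s) (\<kappa> l)" unfolding R_def by (rule mix_weight_eq_powr[symmetric])
  finally have "1 / mix_weight (2 * s) (\<kappa> l) \<le> 1 / (real l / 9) powr \<beta>"
    using l by (intro divide_left_mono) auto
  also have "\<dots> = (9 / real l) powr \<beta>" using l by (simp add: powr_divide)
  finally show ?thesis .
qed

text \<open>The right-hand side is the integral of \<open>t powr (- \<beta>)\<close> over
  \<open>[x, x + 1]\<close>. The comparison is obtained from \<open>1 + t \<le> exp t\<close> and
  the matching bound for \<open>ln\<close>, without integration.\<close>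

lemma powr_telescope:
  fixes x \<beta> :: real
  assumes x: "x > 0" and \<beta>: "\<beta> > 1"
  shows "(x + 1) powr (- \<beta>) \<le> (x powr (1 - \<beta>) - (x + 1) powr (1 - \<beta>)) / (\<beta> - 1)"
proof -
  have "ln (1 + (- 1 / (x + 1))) \<le> - 1 / (x + 1)"
    using x by (intro ln_add_one_self_le_self2) (auto simp: field_simps)
  moreover have "1 + (- 1 / (x + 1)) = x / (x + 1)" using x by (simp add: field_simps)
  ultimately have "1 / (x + 1) \<le> ln ((x + 1) / x)" using x by (simp add: ln_div)
  then have "1 + (\<beta> - 1) * (1 / (x + 1)) \<le> 1 + (\<beta> - 1) * ln ((x + 1) / x)"
    using \<beta> by (intro add_left_mono mult_left_mono) auto
  also have "\<dots> \<le> exp ((\<beta> - 1) * ln ((x + 1) / x))" by (rule exp_ge_add_one_self)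
  also have "\<dots> = ((x + 1) / x) powr (\<beta> - 1)" using x by (simp add: powr_def)
  also have "\<dots> = x powr (1 - \<beta>) / (x + 1) powr (1 - \<beta>)"
    using x powr_minus_divide[of x "\<beta> - 1"] powr_minus_divide[of "x + 1" "\<beta> - 1"]
    by (simp add: powr_divide)
  finally have "(x + 1) powr (1 - \<beta>) * (1 + (\<beta> - 1) * (1 / (x + 1))) \<le> x powr (1 - \<beta>)"
    using x by (simp add: field_simps)
  moreover have "(x + 1) powr (1 - \<beta>) / (x + 1) = (x + 1) powr (- \<beta>)"
    using x powr_diff[of "x + 1" "1 - \<beta>" 1] by simp
  moreover have "(x + 1) powr (1 - \<beta>) * (1 + (\<beta> - 1) * (1 / (x + 1)))
      = (x + 1) powr (1 - \<beta>) + (\<beta> - 1) * ((x + 1) powr (1 - \<beta>) / (x + 1))"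
    by (simp add: distrib_left)
  ultimately have "(\<beta> - 1) * (x + 1) powr (- \<beta>) \<le> x powr (1 - \<beta>) - (x + 1) powr (1 - \<beta>)"
    by simp
  then show ?thesis using \<beta> by (simp add: field_simps)
qed

lemma sum_powr_tail_le:
  fixes \<beta> :: real
  assumes m: "m \<ge> 2" and \<beta>: "\<beta> > 1"
  shows "(\<Sum>l=m..M. real l powr (- \<beta>)) \<le> (real m - 1) powr (1 - \<beta>) / (\<beta> - 1)"
proof (cases "m \<le> M")
  case True
  have "(\<Sum>l=m..M. real l powr (- \<beta>))
      \<le> ((real m - 1) powr (1 - \<beta>) - real M powr (1 - \<beta>)) / (\<beta> - 1)"
    using True
  proof (induction M rule: dec_induct)
    case base
    show ?case using powr_telescope[of "real m - 1" \<beta>] m \<beta> by simp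
  next
    case (step i)
    have "real (Suc i) powr (- \<beta>) \<le> (real i powr (1 - \<beta>) - real (Suc i) powr (1 - \<beta>)) / (\<beta> - 1)"
      using powr_telescope[of "real i" \<beta>] step m \<beta> by (simp add: add.commute)
    then show ?case using step by (simp add: diff_divide_distrib)
  qed
  also have "\<dots> \<le> (real m - 1) powr (1 - \<beta>) / (\<beta> - 1)"
    using \<beta> by (intro divide_right_mono) auto
  finally show ?thesis .
qed (use \<beta> in simp)

definition tail_bound :: "real \<Rightarrow> nat \<Rightarrow> real" where
  "tail_bound \<beta> m = 9 powr \<beta> * ((real m - 1) powr (1 - \<beta>) / (\<beta> - 1))"

lemma sum_weights_tail_le:
  fixes \<kappa> :: "nat \<Rightarrow> int ^ 'd"
  assumes ord: "weight_ordering s \<kappa>" and s: "s > 0" and m: "m \<ge> 2"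
    and \<beta>: "\<beta> = 2 * s / (1 + log 2 (real CARD('d)))" "\<beta> > 1"
  shows "(\<Sum>l=m..M. 1 / mix_weight (2 * s) (\<kappa> l)) \<le> tail_bound \<beta> m"
proof -
  have "(\<Sum>l=m..M. 1 / mix_weight (2 * s) (\<kappa> l)) \<le> (\<Sum>l=m..M. 9 powr \<beta> * real l powr (- \<beta>))"
  proof (rule sum_mono)
    fix l assume l: "l \<in> {m..M}"
    then have "1 / mix_weight (2 * s) (\<kappa> l) \<le> (9 / real l) powr \<beta>"
      using m by (intro weight_ordering_decay[OF ord s _ \<beta>(1)]) auto
    also have "\<dots> = 9 powr \<beta> * real l powr (- \<beta>)"
      using l m by (simp add: powr_divide powr_minus_divide)
    finally show "1 / mix_weight (2 * s) (\<kappa> l) \<le> 9 powr \<beta> * real l powr (- \<beta>)" .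
  qed
  also have "\<dots> = 9 powr \<beta> * (\<Sum>l=m..M. real l powr (- \<beta>))" by (simp add: sum_distrib_left)
  also have "\<dots> \<le> tail_bound \<beta> m"
    unfolding tail_bound_def by (intro mult_left_mono sum_powr_tail_le m \<beta>) auto
  finally show ?thesis .
qed

lemma summable_weights:
  fixes \<kappa> :: "nat \<Rightarrow> int ^ 'd"
  assumes ord: "weight_ordering s \<kappa>" and s: "s > 0"
    and \<beta>: "\<beta> = 2 * s / (1 + log 2 (real CARD('d)))" "\<beta> > 1"
  shows "summable (\<lambda>l. 1 / mix_weight (2 * s) (\<kappa> l))"
proof -
  \<comment> \<open>The tail bound starts at index \<open>2\<close>, because its base
    \<open>m - 1\<close> vanishes for \<open>m = 1\<close>. Finitely many terms, among them the
    meaningless \<open>\<kappa> 0\<close>, do not matter.\<close>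
  have "summable (\<lambda>l. 1 / mix_weight (2 * s) (\<kappa> (l + 2)))"
  proof (rule summableI_nonneg_bounded)
    fix n
    have "(\<Sum>l<n. 1 / mix_weight (2 * s) (\<kappa> (l + 2))) = (\<Sum>l\<in>{2..<n+2}. 1 / mix_weight (2 * s) (\<kappa> l))"
      by (rule sum.reindex_bij_witness[of _ "\<lambda>l. l - 2" "\<lambda>l. l + 2"]) auto
    also have "\<dots> \<le> (\<Sum>l=2..n+2. 1 / mix_weight (2 * s) (\<kappa> l))"
      by (rule sum_mono2) (auto simp: less_imp_le)
    also have "\<dots> \<le> tail_bound \<beta> 2" by (rule sum_weights_tail_le[OF ord s _ \<beta>]) simp
    finally show "(\<Sum>l<n. 1 / mix_weight (2 * s) (\<kappa> (l + 2))) \<le> tail_bound \<beta> 2" .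
  qed (simp add: less_imp_le)
  then show ?thesis by (subst (asm) summable_iff_shift)
qed

subsection \<open>Fourier series\<close>

lemma torus_periodic_int_shift:
  fixes f :: "real ^ 'd \<Rightarrow> complex" and n :: "'d \<Rightarrow> int"
  assumes "torus_periodic f"
  shows "f (x + (\<chi> j. 2 * pi * of_int (n j))) = f x"
proof -
  have nat: "f (x + axis j (2 * pi * real k)) = f x" for x j k
  proof (induction k)
    case 0
    have "axis j (2 * pi * real 0) = (0 :: real ^ 'd)" by (simp add: Finite_Cartesian_Product.vec_eq_iff axis_def)
    then show ?case by (simp only: add_0_right)
  next
    case (Suc k)
    have eq: "x + axis j (2 * pi * real (Suc k)) = (x + axis j (2 * pi * real k)) + axis j (2 * pi)"
      by (simp add: Finite_Cartesian_Product.vec_eq_iff axis_def algebra_simps)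
    show ?case unfolding eq using Suc assms by (simp only: torus_periodic_def)
  qed
  have int: "f (x + axis j (2 * pi * of_int i)) = f x" for x j and i :: int
  proof (cases "i \<ge> 0")
    case True
    then show ?thesis using nat[of x j "nat i"] by simp
  next
    case False
    have eq: "(x + axis j (2 * pi * of_int i)) + axis j (2 * pi * real (nat (- i))) = x"
      using False by (simp add: Finite_Cartesian_Product.vec_eq_iff axis_def)
    show ?thesis using nat[of "x + axis j (2 * pi * of_int i)" j "nat (- i)"] unfolding eq by (rule sym)
  qed
  have fin: "f (x + (\<Sum>j\<in>A. axis j (2 * pi * of_int (n j)))) = f x" if "finite A" for A
    using that
  proof (induction A arbitrary: x)
    case (insert j A)
    have "f ((x + axis j (2 * pi * of_int (n j))) + (\<Sum>j\<in>A. axis j (2 * pi * of_int (n j)))) = f x"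
      using insert.IH int by simp
    then show ?case using insert.hyps by (simp add: add.assoc)
  qed simp
  have "(\<chi> j. 2 * pi * of_int (n j)) = (\<Sum>j\<in>UNIV. axis j (2 * pi * of_int (n j)))"
    by (simp add: Finite_Cartesian_Product.vec_eq_iff axis_def if_distrib cong: if_cong)
  then show ?thesis using fin[of UNIV] by simp
qed

text \<open>The quotient map onto the product of unit circles: points with the same image differ by
  periods, so a periodic function factors through it.\<close>

definition torus_embed :: "real ^ 'd \<Rightarrow> complex ^ 'd" where
  "torus_embed x = (\<chi> j. cis (vec_nth x j))"

lemma continuous_on_torus_embed: "continuous_on S torus_embed"
  unfolding torus_embed_def by (intro continuous_intros)

lemma torus_embed_eqD:
  fixes f :: "real ^ 'd \<Rightarrow> complex"
  assumes "torus_periodic f" "torus_embed x = torus_embed y"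
  shows "f x = f y"
proof -
  have "\<exists>n::int. vec_nth x j = vec_nth y j + 2 * pi * n" for j
  proof -
    have "cis (vec_nth x j) = cis (vec_nth y j)"
      using arg_cong[OF assms(2), of "\<lambda>z. vec_nth z j"] by (simp add: torus_embed_def)
    then show ?thesis
      by (subst sin_cos_eq_iff[symmetric]) (auto simp: complex_eq_iff)
  qed
  then obtain n :: "'d \<Rightarrow> int" where n: "\<And>j. vec_nth x j = vec_nth y j + 2 * pi * n j" by metis
  then have "x = y + (\<chi> j. 2 * pi * of_int (n j))"
    by (simp add: Finite_Cartesian_Product.vec_eq_iff)
  then show ?thesis using torus_periodic_int_shift[OF assms(1)] by simp
qed

lemma torus_cube_representative:
  fixes x :: "real ^ 'd"
  obtains y where "y \<in> torus_cube" "torus_embed y = torus_embed x"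
proof
  define n :: "'d \<Rightarrow> int" where "n = (\<lambda>j. \<lfloor>vec_nth x j / (2 * pi)\<rfloor>)"
  let ?y = "\<chi> j. vec_nth x j - 2 * pi * n j"
  have "0 \<le> vec_nth x j - 2 * pi * n j \<and> vec_nth x j - 2 * pi * n j \<le> 2 * pi" for j
  proof -
    have "n j \<le> vec_nth x j / (2 * pi)" "vec_nth x j / (2 * pi) \<le> n j + 1"
      unfolding n_def by linarith+
    then show ?thesis by (simp add: field_simps)
  qed
  then show "?y \<in> torus_cube" by (simp add: torus_cube_def)
  have "cis (vec_nth x j - 2 * pi * n j) = cis (vec_nth x j)" for j
    by (simp add: cis_divide[symmetric])
  then show "torus_embed ?y = torus_embed x" by (simp add: torus_embed_def)
qed

section \<open>Trigonometric polynomials, their density, and uniqueness of Fourier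
  coefficients\<close>

inductive trig_polynomial :: "(real ^ 'd \<Rightarrow> complex) \<Rightarrow> bool" where
  trig_monomial: "trig_polynomial (\<lambda>x. c * cis (freq_dot k x))"
| trig_add: "trig_polynomial p \<Longrightarrow> trig_polynomial q \<Longrightarrow> trig_polynomial (\<lambda>x. p x + q x)"

lemma trig_const: "trig_polynomial (\<lambda>x. c)"
  using trig_monomial[of c 0] by simp

lemma trig_mult:
  assumes "trig_polynomial p" "trig_polynomial q"
  shows "trig_polynomial (\<lambda>x. p x * q x)"
  using assms(1)
proof induction
  case (trig_monomial c k)
  from assms(2) show ?case
  proof induction
    case (trig_monomial c' k')
    have "(\<lambda>x. c * cis (freq_dot k x) * (c' * cis (freq_dot k' x))) = (\<lambda>x. (c * c') * cis (freq_dot (k + k') x))"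
      by (simp add: fun_eq_iff freq_dot_add cis_mult[symmetric] mult_ac)
    then show ?case using trig_polynomial.trig_monomial by metis
  next
    case (trig_add p q)
    then show ?case using trig_polynomial.trig_add by (fastforce simp: distrib_left)
  qed
next
  case (trig_add p1 p2)
  then show ?case using trig_polynomial.trig_add by (fastforce simp: distrib_right)
qed

lemma trig_sum:
  assumes "finite A" "\<And>a. a \<in> A \<Longrightarrow> trig_polynomial (p a)"
  shows "trig_polynomial (\<lambda>x. \<Sum>a\<in>A. p a x)"
  using assms by (induction A) (auto intro: trig_const trig_add)

lemma freq_dot_axis: "freq_dot (axis j c) x = real_of_int c * vec_nth x j"
  unfolding freq_dot_def axis_def by (simp add: if_distrib if_distribR cong: if_cong)

lemma freq_dot_axis_right: "freq_dot k (axis j c) = real_of_int (vec_nth k j) * c"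
  unfolding freq_dot_def axis_def by (simp add: if_distrib if_distribR cong: if_cong)

lemma freq_dot_add_right: "freq_dot k (x + y) = freq_dot k x + freq_dot k y"
  by (simp add: freq_dot_def distrib_left sum.distrib)

lemma trig_cos: "trig_polynomial (\<lambda>x. of_real (cos (vec_nth x j)))"
proof -
  have "trig_polynomial (\<lambda>x. 1/2 * cis (freq_dot (axis j 1) x) + 1/2 * cis (freq_dot (axis j (-1)) x))"
    by (intro trig_add trig_monomial)
  also have "(\<lambda>x. 1/2 * cis (freq_dot (axis j 1) x) + 1/2 * cis (freq_dot (axis j (-1)) x))
      = (\<lambda>x. complex_of_real (cos (vec_nth x j)))"
    by (auto simp: fun_eq_iff freq_dot_axis complex_eq_iff)
  finally show ?thesis .
qed

lemma trig_sin: "trig_polynomial (\<lambda>x. of_real (sin (vec_nth x j)))"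
proof -
  have "trig_polynomial (\<lambda>x. (- \<i>/2) * cis (freq_dot (axis j 1) x) + \<i>/2 * cis (freq_dot (axis j (-1)) x))"
    by (intro trig_add trig_monomial)
  also have "(\<lambda>x. (- \<i>/2) * cis (freq_dot (axis j 1) x) + \<i>/2 * cis (freq_dot (axis j (-1)) x))
      = (\<lambda>x. complex_of_real (sin (vec_nth x j)))"
    by (auto simp: fun_eq_iff freq_dot_axis complex_eq_iff)
  finally show ?thesis .
qed

text \<open>The real coordinates of a point on the product of circles are cosines and sines, so a
  real-linear functional is a combination of these; products are covered by
  \<open>trig_mult\<close>.\<close>

lemma trig_polynomial_real_polynomial:
  fixes q :: "complex ^ 'd \<Rightarrow> real"
  assumes "real_polynomial_function q"
  shows "trig_polynomial (\<lambda>x. of_real (q (torus_embed x)))"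
  using assms
proof induction
  case (linear f)
  interpret bounded_linear f by fact
  have "of_real (f (torus_embed x)) = (\<Sum>j\<in>UNIV. of_real (cos (vec_nth x j)) * of_real (f (axis j 1))
      + of_real (sin (vec_nth x j)) * complex_of_real (f (axis j \<i>)))" for x :: "real ^ 'd"
  proof -
    have "torus_embed x = (\<Sum>j\<in>UNIV. cos (vec_nth x j) *\<^sub>R axis j 1 + sin (vec_nth x j) *\<^sub>R axis j \<i>)"
      by (auto simp: torus_embed_def Finite_Cartesian_Product.vec_eq_iff axis_def complex_eq_iff if_distrib sum.distrib cong: if_cong)
    then have "f (torus_embed x) = (\<Sum>j\<in>UNIV. cos (vec_nth x j) * f (axis j 1) + sin (vec_nth x j) * f (axis j \<i>))"
      by (simp add: sum add scaleR)
    then show ?thesis by simp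
  qed
  then show ?case by (simp only:) (intro trig_sum trig_add trig_mult trig_cos trig_sin trig_const finite)
qed (auto intro: trig_const trig_add trig_mult)

lemma trig_polynomial_polynomial:
  fixes g :: "complex ^ 'd \<Rightarrow> complex"
  assumes "polynomial_function g"
  shows "trig_polynomial (\<lambda>x. g (torus_embed x))"
proof -
  have "real_polynomial_function (Re \<circ> g)" "real_polynomial_function (Im \<circ> g)"
    using assms bounded_linear_Re bounded_linear_Im unfolding polynomial_function_def by blast+
  then have "trig_polynomial (\<lambda>x. of_real ((Re \<circ> g) (torus_embed x)) + \<i> * of_real ((Im \<circ> g) (torus_embed x)))"
    by (intro trig_add trig_mult trig_const trig_polynomial_real_polynomial)
  then show ?thesis by (simp add: complex_eq[symmetric])
qed

lemma continuous_periodic_bounded: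
  fixes h :: "real ^ 'd \<Rightarrow> complex"
  assumes "continuous_on UNIV h" "torus_periodic h"
  obtains B where "\<And>x. cmod (h x) \<le> B"
proof -
  have "compact (h ` torus_cube)"
    unfolding torus_cube_eq_cbox by (rule compact_continuous_image[OF continuous_on_subset[OF assms(1)]]) auto
  then obtain B where B: "\<And>y. y \<in> torus_cube \<Longrightarrow> cmod (h y) \<le> B"
    by (meson bounded_iff compact_imp_bounded image_eqI)
  show ?thesis
  proof
    fix x :: "real ^ 'd"
    obtain y where "y \<in> torus_cube" "torus_embed y = torus_embed x" by (rule torus_cube_representative)
    then show "cmod (h x) \<le> B" using B torus_embed_eqD[OF assms(2)] by metis
  qed
qed

lemma integrable_torus_bounded:
  fixes f :: "real ^ 'd \<Rightarrow> complex"
  assumes "f \<in> borel_measurable borel" "\<And>x. cmod (f x) \<le> B"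
  shows "integrable torus_measure f"
proof -
  interpret prob_space "torus_measure :: (real ^ 'd) measure" by (rule prob_space_torus_measure)
  show ?thesis using assms by (intro integrable_const_bound[where B = B]) (auto simp: measurable_cong_sets[OF sets_torus_measure refl])
qed

text \<open>
  Trigonometric polynomials do not separate opposite boundary points of the cube, so
  Stone--Weierstrass is applied on its image in the product of unit circles.
\<close>

lemma trig_polynomial_dense:
  fixes h :: "real ^ 'd \<Rightarrow> complex"
  assumes h: "continuous_on UNIV h" "torus_periodic h" and e: "e > 0"
  obtains p where "trig_polynomial p" "\<And>x. x \<in> torus_cube \<Longrightarrow> cmod (h x - p x) < e"
proof -
  let ?C = "torus_cube :: (real ^ 'd) set"
  let ?S = "torus_embed ` ?C"
  \<comment> \<open>\<open>H\<close> is \<open>h\<close> read on the product of circles; periodicity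
    makes the choice of the preimage irrelevant.\<close>
  define H where "H = (\<lambda>z. h (SOME x. x \<in> ?C \<and> torus_embed x = z))"
  have H: "H (torus_embed x) = h x" if "x \<in> ?C" for x
  proof -
    have "torus_embed (SOME y. y \<in> ?C \<and> torus_embed y = torus_embed x) = torus_embed x"
      using someI[of "\<lambda>y. y \<in> ?C \<and> torus_embed y = torus_embed x" x] that by blast
    then show ?thesis unfolding H_def by (rule torus_embed_eqD[OF h(2)])
  qed
  have C: "compact ?C" by (simp add: torus_cube_eq_cbox)
  have S: "compact ?S" by (rule compact_continuous_image[OF continuous_on_torus_embed C])
  \<comment> \<open>The cube is compact, so closed sets of preimages have compact, hence closed,
    images: \<open>torus_embed\<close> acts as a quotient map on it.\<close>
  have "continuous_on ?S H"
    unfolding continuous_on_closed_invariant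
  proof (intro allI impI)
    fix B :: "complex set" assume B: "closed B"
    let ?A = "torus_embed ` (?C \<inter> h -` B)"
    have "closed (h -` B)" using h(1) B by (simp add: continuous_on_closed_vimage)
    then have "compact (?C \<inter> h -` B)" by (rule compact_Int_closed[OF C])
    then have "closed ?A"
      by (intro compact_imp_closed compact_continuous_image continuous_on_torus_embed)
    moreover have "?A \<inter> ?S = H -` B \<inter> ?S" using H by auto
    ultimately show "\<exists>A. closed A \<and> A \<inter> ?S = H -` B \<inter> ?S" by blast
  qed
  from Stone_Weierstrass_polynomial_function[OF S this e]
  obtain g where g: "polynomial_function g" "\<And>z. z \<in> ?S \<Longrightarrow> cmod (H z - g z) < e" by blast
  show ?thesis
  proof (rule that)
    show "trig_polynomial (\<lambda>x. g (torus_embed x))" by (rule trig_polynomial_polynomial[OF g(1)])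
    show "cmod (h x - g (torus_embed x)) < e" if "x \<in> ?C" for x
      using g(2)[of "torus_embed x"] H[OF that] that by auto
  qed
qed

lemma AE_torus_cube: "AE x in torus_measure. x \<in> (torus_cube :: (real ^ 'd) set)"
  unfolding torus_measure_def by (rule AE_uniform_measureI) auto

text \<open>\<open>h\<close> is orthogonal to all trigonometric polynomials, and these approximate
  \<open>cnj h\<close> uniformly on the cube, so the square of \<open>cmod (h x)\<close> integrates
  to \<open>0\<close>. Continuity and periodicity turn this into vanishing at every point.\<close>

lemma fourier_uniqueness:
  fixes h :: "real ^ 'd \<Rightarrow> complex"
  assumes h: "continuous_on UNIV h" "torus_periodic h"
    and coeff: "\<And>k. (LINT x|torus_measure. h x * cis (- freq_dot k x)) = 0"
  shows "h x = 0"
proof -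
  let ?M = "torus_measure :: (real ^ 'd) measure"
  interpret prob_space ?M by (rule prob_space_torus_measure)
  obtain B where B: "\<And>x. cmod (h x) \<le> B" by (rule continuous_periodic_bounded[OF h]) blast
  have B0: "0 \<le> B" using B[of 0] norm_ge_zero order_trans by blast
  have [measurable]: "h \<in> borel_measurable borel" using h(1) by (rule borel_measurable_continuous_onI)
  have [measurable]: "(\<lambda>x. cnj (h x)) \<in> borel_measurable borel"
    by (rule borel_measurable_continuous_onI) (intro continuous_intros h)
  have orth: "integrable ?M (\<lambda>x. h x * p x) \<and> (LINT x|?M. h x * p x) = 0" if "trig_polynomial p" for p
    using that
  proof induction
    case (trig_monomial c k)
    have "integrable ?M (\<lambda>x. h x * (c * cis (freq_dot k x)))"
      by (rule integrable_torus_bounded[where B = "B * cmod c"]) (auto simp: norm_mult intro!: mult_right_mono B)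
    moreover have "(LINT x|?M. h x * (c * cis (freq_dot k x))) = c * (LINT x|?M. h x * cis (- freq_dot (- k) x))"
      by (subst integral_mult_right_zero[symmetric]) (simp add: freq_dot_minus mult_ac)
    ultimately show ?case using coeff[of "- k"] by simp
  next
    case (trig_add p q)
    then show ?case by (simp add: distrib_left)
  qed
  have cn: "continuous_on UNIV (\<lambda>x. cnj (h x))" "torus_periodic (\<lambda>x. cnj (h x))"
    using h by (auto intro: continuous_intros simp: torus_periodic_def)
  have int2: "integrable ?M (\<lambda>x. h x * cnj (h x))"
    by (rule integrable_torus_bounded[where B = "B * B"]) (auto simp: norm_mult intro!: mult_mono B B0)
  have "cmod (LINT x|?M. h x * cnj (h x)) \<le> B * e" if e: "e > 0" for e
  proof -
    obtain p where p: "trig_polynomial p" "\<And>x. x \<in> torus_cube \<Longrightarrow> cmod (cnj (h x) - p x) < e"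
      by (rule trig_polynomial_dense[OF cn e]) blast
    have int3: "integrable ?M (\<lambda>x. h x * (cnj (h x) - p x))"
      using int2 orth[OF p(1)] by (simp add: right_diff_distrib)
    have "(LINT x|?M. h x * cnj (h x)) = (LINT x|?M. h x * (cnj (h x) - p x))"
      using int2 orth[OF p(1)] by (simp add: right_diff_distrib)
    also have "cmod \<dots> \<le> (LINT x|?M. cmod (h x * (cnj (h x) - p x)))" by (rule integral_norm_bound)
    also have "\<dots> \<le> (LINT x|?M. B * e)"
    proof (rule integral_mono_AE)
      show "integrable ?M (\<lambda>x. cmod (h x * (cnj (h x) - p x)))" using int3 by (rule integrable_norm)
      show "AE x in ?M. cmod (h x * (cnj (h x) - p x)) \<le> B * e"
        using AE_torus_cube
      proof eventually_elim
        case (elim x)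
        have "cmod (h x) * cmod (cnj (h x) - p x) \<le> B * e"
          using p(2)[OF elim] B[of x] B0 by (intro mult_mono) auto
        then show ?case by (simp add: norm_mult)
      qed
    qed simp
    also have "\<dots> = B * e" using prob_space by simp
    finally show ?thesis .
  qed
  then have "cmod (LINT x|?M. h x * cnj (h x)) = 0"
  proof -
    assume *: "\<And>e. e > 0 \<Longrightarrow> cmod (LINT x|?M. h x * cnj (h x)) \<le> B * e"
    have "cmod (LINT x|?M. h x * cnj (h x)) \<le> 0 + e" if "e > 0" for e
    proof -
      have "cmod (LINT x|?M. h x * cnj (h x)) \<le> B * (e / (B + 1))"
        using B0 that by (intro *) simp
      also have "\<dots> \<le> e" using B0 that by (simp add: field_simps)
      finally show ?thesis by simp
    qed
    then have "cmod (LINT x|?M. h x * cnj (h x)) \<le> 0" by (rule field_le_epsilon)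
    then show ?thesis by simp
  qed
  then have "(LINT x|?M. h x * cnj (h x)) = 0" by simp
  then have z: "(LINT x:torus_cube|lborel. h x * cnj (h x)) = 0"
    by (subst (asm) integral_torus_measure) auto
  have cont: "continuous_on UNIV (\<lambda>x. h x * cnj (h x))" using h by (intro continuous_intros)
  have "set_integrable lborel torus_cube (\<lambda>x. h x * cnj (h x))"
    unfolding set_integrable_def torus_cube_eq_cbox
    by (intro borel_integrable_compact continuous_on_subset[OF cont]) auto
  note HK = set_borel_integral_eq_integral[OF this]
  \<comment> \<open>In terms of \<open>has_integral\<close>, a continuous nonnegative function with
    integral \<open>0\<close> over a box vanishes on the whole box, boundary included.\<close>
  have "((\<lambda>x. h x * cnj (h x)) has_integral 0) (cbox 0 (\<chi> j. 2 * pi))"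
    using HK z by (simp add: has_integral_integrable_integral torus_cube_eq_cbox)
  from has_integral_linear[OF this bounded_linear_Re]
  have hi: "((\<lambda>x. (cmod (h x))\<^sup>2) has_integral 0) (cbox 0 (\<chi> j. 2 * pi))"
    by (simp add: comp_def complex_norm_square[symmetric])
  have cube0: "h y = 0" if "y \<in> torus_cube" for y
  proof -
    have "(cmod (h y))\<^sup>2 = 0"
    proof (rule has_integral_0_cbox_imp_0[OF _ _ hi])
      show "continuous_on (cbox 0 (\<chi> j. 2 * pi)) (\<lambda>x. (cmod (h x))\<^sup>2)"
        by (intro continuous_intros continuous_on_subset[OF h(1)]) auto
      show "box 0 (\<chi> j. 2 * pi) \<noteq> ({} :: (real ^ 'd) set)" by (auto simp: interval_ne_empty_cart)
      show "y \<in> cbox 0 (\<chi> j. 2 * pi)" using that by (simp add: torus_cube_eq_cbox)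
    qed auto
    then show ?thesis by simp
  qed
  obtain y where "y \<in> torus_cube" "torus_embed y = torus_embed x" by (rule torus_cube_representative)
  then show ?thesis using cube0 torus_embed_eqD[OF h(2)] by metis
qed

section \<open>Absolutely convergent Fourier series of the unit ball\<close>

lemma fourier_coeff_torus:
  assumes "f \<in> borel_measurable borel"
  shows "fourier_coeff f k = (LINT x|torus_measure. f x * cis (- freq_dot k x))"
  unfolding fourier_coeff_def using assms by (subst integral_torus_measure) auto

lemma trig_series_coefficients:
  fixes k :: "nat \<Rightarrow> int ^ 'd"
  assumes k: "inj k" and c: "summable (\<lambda>l. cmod (c l))"
  shows "(LINT x|torus_measure. (\<Sum>l. c l * cis (freq_dot (k l) x)) * cis (- freq_dot (k m) x)) = c m"
proof -
  let ?M = "torus_measure :: (real ^ 'd) measure"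
  let ?t = "\<lambda>l x. c l * cis (freq_dot (k l - k m) x)"
  interpret prob_space ?M by (rule prob_space_torus_measure)
  have sm: "summable (\<lambda>l. c l * cis (freq_dot (k l) x))" for x
    by (rule summable_norm_cancel) (simp add: norm_mult c)
  have "(LINT x|?M. (\<Sum>l. c l * cis (freq_dot (k l) x)) * cis (- freq_dot (k m) x)) = (LINT x|?M. (\<Sum>l. ?t l x))"
  proof (intro Bochner_Integration.integral_cong refl)
    fix x
    have "(\<Sum>l. c l * cis (freq_dot (k l) x)) * cis (- freq_dot (k m) x) = (\<Sum>l. c l * cis (freq_dot (k l) x) * cis (- freq_dot (k m) x))"
      by (rule suminf_mult2[OF sm])
    then show "(\<Sum>l. c l * cis (freq_dot (k l) x)) * cis (- freq_dot (k m) x) = (\<Sum>l. ?t l x)"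
      by (simp add: freq_dot_diff mult.assoc cis_mult)
  qed
  also have "\<dots> = (\<Sum>l. LINT x|?M. ?t l x)"
  proof (rule integral_suminf)
    show "integrable ?M (?t l)" for l by (intro integrable_mult_right integrable_torus_cis)
    show "AE x in ?M. summable (\<lambda>l. norm (?t l x))" using c by (simp add: norm_mult)
    show "summable (\<lambda>l. LINT x|?M. norm (?t l x))" using c prob_space by (simp add: norm_mult)
  qed
  also have "\<dots> = (\<Sum>l. if l = m then c m else 0)"
    by (intro suminf_cong) (use k in \<open>auto simp: integral_torus_cis inj_def\<close>)
  also have "\<dots> = c m" using suminf_finite[of "{m}" "\<lambda>l. if l = m then c m else 0"] by simp
  finally show ?thesis .
qed

text \<open>Absolute convergence comes from
  \<open>2 * cmod c \<le> (cmod c)\<^sup>2 * w + 1 / w\<close>, both parts of which are summable.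
  The sum is then continuous and periodic with the coefficients of \<open>f\<close>, hence equal to
  \<open>f\<close> at every point. An identity almost everywhere would not do, since least squares
  uses point values.\<close>

lemma
  fixes \<kappa> :: "nat \<Rightarrow> int ^ 'd"
  assumes f: "f \<in> Hmix_unit_ball s" and ord: "weight_ordering s \<kappa>"
    and sm: "summable (\<lambda>l. 1 / mix_weight (2 * s) (\<kappa> l))"
  shows Hmix_coeff_sum_le: "finite A \<Longrightarrow> A \<subseteq> {1..} \<Longrightarrow>
      (\<Sum>l\<in>A. (cmod (fourier_coeff f (\<kappa> l)))\<^sup>2 * mix_weight (2 * s) (\<kappa> l)) \<le> 1"
    and Hmix_coeff_summable: "summable (\<lambda>l. cmod (fourier_coeff f (\<kappa> (Suc l))))"
    and Hmix_fourier_series: "f x = (\<Sum>l. fourier_coeff f (\<kappa> (Suc l)) * cis (freq_dot (\<kappa> (Suc l)) x))"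
proof -
  define c where "c = (\<lambda>l. fourier_coeff f (\<kappa> (Suc l)))"
  have inj: "inj_on \<kappa> {1..}" and surj: "\<kappa> ` {1..} = UNIV"
    using ord by (auto simp: weight_ordering_def bij_betw_def)
  have cf: "continuous_on UNIV f" and pf: "torus_periodic f" and [measurable]: "f \<in> borel_measurable borel"
    and so: "(\<lambda>k. (cmod (fourier_coeff f k))\<^sup>2 * mix_weight (2 * s) k) summable_on UNIV"
    and n1: "Hmix_norm s f \<le> 1"
    using f by (auto simp: Hmix_unit_ball_def Hmix_def torus_L2_def)
  show le1: "(\<Sum>l\<in>A. (cmod (fourier_coeff f (\<kappa> l)))\<^sup>2 * mix_weight (2 * s) (\<kappa> l)) \<le> 1"
    if A: "finite A" "A \<subseteq> {1..}" for A
  proof -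
    have "(\<Sum>l\<in>A. (cmod (fourier_coeff f (\<kappa> l)))\<^sup>2 * mix_weight (2 * s) (\<kappa> l))
        = (\<Sum>k\<in>\<kappa> ` A. (cmod (fourier_coeff f k))\<^sup>2 * mix_weight (2 * s) k)"
      by (subst sum.reindex) (use A inj in \<open>auto intro: inj_on_subset\<close>)
    also have "\<dots> \<le> (\<Sum>\<^sub>\<infinity>k. (cmod (fourier_coeff f k))\<^sup>2 * mix_weight (2 * s) k)"
      using A by (intro finite_sum_le_infsum so) (auto intro!: mult_nonneg_nonneg)
    also have "\<dots> \<le> 1" using n1 by (simp add: Hmix_norm_def)
    finally show ?thesis .
  qed
  show smc: "summable (\<lambda>l. cmod (fourier_coeff f (\<kappa> (Suc l))))"
  proof (rule summable_comparison_test')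
    have "summable (\<lambda>l. (cmod (c l))\<^sup>2 * mix_weight (2 * s) (\<kappa> (Suc l)))"
    proof (rule summableI_nonneg_bounded)
      show "(\<Sum>l<N. (cmod (c l))\<^sup>2 * mix_weight (2 * s) (\<kappa> (Suc l))) \<le> 1" for N
      proof -
        have "(\<Sum>l<N. (cmod (c l))\<^sup>2 * mix_weight (2 * s) (\<kappa> (Suc l)))
            = (\<Sum>l\<in>Suc ` {..<N}. (cmod (fourier_coeff f (\<kappa> l)))\<^sup>2 * mix_weight (2 * s) (\<kappa> l))"
          by (subst sum.reindex) (auto simp: c_def)
        then show ?thesis using le1[of "Suc ` {..<N}"] by auto
      qed
    qed (auto intro!: mult_nonneg_nonneg)
    moreover have "summable (\<lambda>l. 1 / mix_weight (2 * s) (\<kappa> (Suc l)))"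
      using sm by (subst summable_Suc_iff)
    ultimately show "summable (\<lambda>l. (cmod (c l))\<^sup>2 * mix_weight (2 * s) (\<kappa> (Suc l)) + 1 / mix_weight (2 * s) (\<kappa> (Suc l)))"
      by (rule summable_add)
    fix l
    let ?w = "mix_weight (2 * s) (\<kappa> (Suc l))"
    have w: "0 < ?w" by simp
    have "0 \<le> (cmod (c l) * sqrt ?w - 1 / sqrt ?w)\<^sup>2" by simp
    also have "\<dots> = (cmod (c l))\<^sup>2 * ?w + 1 / ?w - 2 * cmod (c l)"
      using w by (simp add: power2_diff power_mult_distrib power_divide)
    finally have "cmod (c l) \<le> (cmod (c l))\<^sup>2 * ?w + 1 / ?w"
      using norm_ge_zero[of "c l"] by linarith
    then show "norm (cmod (fourier_coeff f (\<kappa> (Suc l)))) \<le> (cmod (c l))\<^sup>2 * ?w + 1 / ?w"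
      by (simp add: c_def)
  qed
  define g where "g = (\<lambda>x. \<Sum>l. c l * cis (freq_dot (\<kappa> (Suc l)) x))"
  have smc': "summable (\<lambda>l. cmod (c l))" using smc by (simp add: c_def)
  have contg: "continuous_on UNIV g"
    unfolding g_def
  proof (rule uniform_limit_theorem)
    show "uniform_limit UNIV (\<lambda>n x. \<Sum>l<n. c l * cis (freq_dot (\<kappa> (Suc l)) x))
        (\<lambda>x. \<Sum>l. c l * cis (freq_dot (\<kappa> (Suc l)) x)) sequentially"
      by (rule Weierstrass_m_test[OF _ smc']) (simp add: norm_mult)
    show "\<forall>\<^sub>F n in sequentially. continuous_on UNIV (\<lambda>x. \<Sum>l<n. c l * cis (freq_dot (\<kappa> (Suc l)) x))"
      by (intro always_eventually allI continuous_intros)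
  qed simp
  have pg: "torus_periodic g"
  proof -
    have "cis (freq_dot k (x + axis j (2 * pi))) = cis (freq_dot k x)" for k and x :: "real ^ 'd" and j
    proof -
      have "freq_dot k (x + axis j (2 * pi)) = freq_dot k x + 2 * pi * of_int (vec_nth k j)"
        by (simp add: freq_dot_add_right freq_dot_axis_right)
      then show ?thesis by (simp add: cis_mult[symmetric])
    qed
    then show ?thesis unfolding torus_periodic_def g_def by simp
  qed
  have [measurable]: "g \<in> borel_measurable borel" using contg by (rule borel_measurable_continuous_onI)
  have "f x - g x = 0"
  proof (rule fourier_uniqueness[of "\<lambda>x. f x - g x"])
    show "continuous_on UNIV (\<lambda>x. f x - g x)" by (intro continuous_intros cf contg)
    show "torus_periodic (\<lambda>x. f x - g x)" using pf pg by (simp add: torus_periodic_def)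
    fix k :: "int ^ 'd"
    obtain m' where "m' \<ge> 1" "k = \<kappa> m'" using surj by (metis UNIV_I atLeast_iff imageE)
    then obtain m where m: "k = \<kappa> (Suc m)" by (cases m') auto
    obtain Bf where Bf: "\<And>x. cmod (f x) \<le> Bf" by (rule continuous_periodic_bounded[OF cf pf]) blast
    obtain Bg where Bg: "\<And>x. cmod (g x) \<le> Bg" by (rule continuous_periodic_bounded[OF contg pg]) blast
    have "integrable torus_measure (\<lambda>x. f x * cis (- freq_dot k x))"
      by (rule integrable_torus_bounded[where B = Bf]) (auto simp: norm_mult Bf)
    moreover have "integrable torus_measure (\<lambda>x. g x * cis (- freq_dot k x))"
      by (rule integrable_torus_bounded[where B = Bg]) (auto simp: norm_mult Bg)
    moreover have "(LINT x|torus_measure. f x * cis (- freq_dot k x)) = c m"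
      unfolding c_def m by (subst fourier_coeff_torus) auto
    moreover have "(LINT x|torus_measure. g x * cis (- freq_dot k x)) = c m"
      unfolding g_def m
      by (rule trig_series_coefficients[of "\<lambda>l. \<kappa> (Suc l)", OF _ smc']) (use inj in \<open>auto simp: inj_on_def inj_def\<close>)
    ultimately show "(LINT x|torus_measure. (f x - g x) * cis (- freq_dot k x)) = 0"
      by (simp add: left_diff_distrib)
  qed
  then show "f x = (\<Sum>l. fourier_coeff f (\<kappa> (Suc l)) * cis (freq_dot (\<kappa> (Suc l)) x))"
    by (simp add: g_def c_def)
qed

subsection \<open>Least squares\<close>

lemma mat_adjoint_carrier: "A \<in> carrier_mat n k \<Longrightarrow> mat_adjoint A \<in> carrier_mat k n"
  unfolding mat_adjoint_def using mat_of_rows_carrier(1)[of "dim_row A" "map conjugate (cols A)"]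
  by (simp add: carrier_matD)

lemma mat_adjoint_index:
  fixes A :: "complex mat"
  assumes "A \<in> carrier_mat n k" "i < k" "j < n"
  shows "mat_adjoint A $$ (i, j) = cnj (A $$ (j, i))"
  using assms unfolding mat_adjoint_def by (auto simp: mat_of_rows_def cols_def)

lemma mult_mat_vec_index:
  assumes "A \<in> carrier_mat n k" "v \<in> carrier_vec k" "i < n"
  shows "vec_index (A *\<^sub>v v) i = (\<Sum>l<k. A $$ (i, l) * vec_index v l)"
  using assms by (auto simp: scalar_prod_def atLeast0LessThan intro!: sum.cong)

lemma mult_mat_index:
  assumes "A \<in> carrier_mat n k" "B \<in> carrier_mat k p" "i < n" "j < p"
  shows "(A * B) $$ (i, j) = (\<Sum>l<k. A $$ (i, l) * B $$ (l, j))"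
  using assms by (auto simp: scalar_prod_def atLeast0LessThan intro!: sum.cong)

lemma adjoint_inner:
  fixes A :: "complex mat"
  assumes A: "A \<in> carrier_mat n k" and v: "v \<in> carrier_vec k" and y: "y \<in> carrier_vec n"
  shows "(\<Sum>l<k. cnj (vec_index v l) * vec_index (mat_adjoint A *\<^sub>v y) l)
       = (\<Sum>i<n. cnj (vec_index (A *\<^sub>v v) i) * vec_index y i)"
proof -
  have "(\<Sum>l<k. cnj (vec_index v l) * vec_index (mat_adjoint A *\<^sub>v y) l)
      = (\<Sum>l<k. \<Sum>i<n. cnj (vec_index v l) * cnj (A $$ (i, l)) * vec_index y i)"
    using A y by (intro sum.cong refl)
      (simp add: mult_mat_vec_index[OF mat_adjoint_carrier[OF A]] mat_adjoint_index[OF A] sum_distrib_left mult.assoc)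
  also have "\<dots> = (\<Sum>i<n. \<Sum>l<k. cnj (vec_index v l) * cnj (A $$ (i, l)) * vec_index y i)"
    by (rule sum.swap)
  also have "\<dots> = (\<Sum>i<n. cnj (vec_index (A *\<^sub>v v) i) * vec_index y i)"
    by (intro sum.cong refl) (simp add: mult_mat_vec_index[OF A v] sum_distrib_left mult_ac)
  finally show ?thesis .
qed

lemma adjoint_mult_kernel:
  fixes A :: "complex mat"
  assumes A: "A \<in> carrier_mat n k" and v: "v \<in> carrier_vec k"
    and z: "(mat_adjoint A * A) *\<^sub>v v = 0\<^sub>v k"
  shows "A *\<^sub>v v = 0\<^sub>v n"
proof -
  have Av: "A *\<^sub>v v \<in> carrier_vec n" using A v by auto
  have e: "mat_adjoint A *\<^sub>v (A *\<^sub>v v) = 0\<^sub>v k"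
    using assoc_mult_mat_vec[OF mat_adjoint_carrier[OF A] A v] z by simp
  have "(\<Sum>i<n. cnj (vec_index (A *\<^sub>v v) i) * vec_index (A *\<^sub>v v) i) = 0"
    unfolding adjoint_inner[OF A v Av, symmetric] e by simp
  moreover have "cnj c * c = of_real ((cmod c)\<^sup>2)" for c
    by (simp only: complex_norm_square mult.commute)
  ultimately have "complex_of_real (\<Sum>i<n. (cmod (vec_index (A *\<^sub>v v) i))\<^sup>2) = 0"
    by (simp only: of_real_sum)
  then have "(\<Sum>i<n. (cmod (vec_index (A *\<^sub>v v) i))\<^sup>2) = 0" by (simp only: of_real_eq_0_iff)
  then have "\<forall>i<n. vec_index (A *\<^sub>v v) i = 0" by (simp add: sum_nonneg_eq_0_iff)
  then show ?thesis using Av A by (intro eq_vecI) auto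
qed

text \<open>Linear independence refers to the set of columns, where repetitions are invisible; they
  have to be excluded separately.\<close>

lemma full_rank_distinct_cols:
  fixes A :: "'a::field mat"
  assumes A: "A \<in> carrier_mat n k" and r: "vec_space.rank n A = k"
  shows "distinct (cols A)"
proof (rule ccontr)
  interpret vec_space "TYPE('a)" n .
  assume nd: "\<not> distinct (cols A)"
  obtain S where S: "maximal S (\<lambda>T. T \<subseteq> set (cols A) \<and> lin_indpt T)"
    using maximal_exists[of "(\<lambda>T. T \<subseteq> set (cols A) \<and> lin_indpt T)" "card (set (cols A))" "{}"]
    by (meson List.finite_set card_mono empty_iff empty_subsetI finite_lin_indpt2 rev_finite_subset)
  then have "card S \<le> card (set (cols A))" by (simp add: card_mono maximal_def)
  also have "\<dots> < length (cols A)"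
    using nd card_distinct card_length le_neq_implies_less by blast
  finally show False using rank_card_indpt[OF A S] r A by simp
qed

lemma full_column_rank_iff_kernel:
  fixes A :: "complex mat"
  assumes A: "A \<in> carrier_mat n k"
  shows "full_column_rank A \<longleftrightarrow> (\<forall>v\<in>carrier_vec k. A *\<^sub>v v = 0\<^sub>v n \<longrightarrow> v = 0\<^sub>v k)"
proof -
  interpret vec_space "TYPE(complex)" n .
  have fr: "full_column_rank A \<longleftrightarrow> rank A = k" using A by (simp add: full_column_rank_def)
  show ?thesis
  proof
    assume "full_column_rank A"
    then have r: "rank A = k" by (simp add: fr)
    then have d: "distinct (cols A)" by (rule full_rank_distinct_cols[OF A])
    show "\<forall>v\<in>carrier_vec k. A *\<^sub>v v = 0\<^sub>v n \<longrightarrow> v = 0\<^sub>v k"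
      using lin_depI[OF A _ _ _ d] full_rank_lin_indpt[OF A r d] by blast
  next
    assume ker: "\<forall>v\<in>carrier_vec k. A *\<^sub>v v = 0\<^sub>v n \<longrightarrow> v = 0\<^sub>v k"
    have d: "distinct (cols A)"
    proof (rule ccontr)
      assume "\<not> distinct (cols A)"
      then obtain i j where ij: "i < k" "j < k" "i \<noteq> j" "col A i = col A j"
        using A by (auto simp: distinct_conv_nth)
      define v :: "complex Matrix.vec" where "v = unit_vec k i - unit_vec k j"
      have v: "v \<in> carrier_vec k" by (simp add: v_def)
      have "vec_index (A *\<^sub>v v) r = 0" if r: "r < n" for r
      proof -
        have "vec_index (A *\<^sub>v v) r = (\<Sum>l<k. (if l = i then A $$ (r, i) else 0) - (if l = j then A $$ (r, j) else 0))"
          unfolding mult_mat_vec_index[OF A v r]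
          by (intro sum.cong refl) (use ij in \<open>auto simp: v_def unit_vec_def\<close>)
        also have "\<dots> = vec_index (col A i) r - vec_index (col A j) r"
          using A ij(1,2) r by (simp add: sum_subtractf)
        finally show ?thesis using ij by simp
      qed
      then have "A *\<^sub>v v = 0\<^sub>v n" using A by (intro eq_vecI) auto
      then have "v = 0\<^sub>v k" using ker v by blast
      then have "vec_index v i = 0" using ij by simp
      then show False using ij by (simp add: v_def)
    qed
    have "lin_indpt (set (cols A))"
      using lin_depE[OF A _ d] ker by blast
    then show "full_column_rank A" unfolding fr by (rule lin_indpt_full_rank[OF A d])
  qed
qed

text \<open>Used in two ways: the normal equations can be solved, and full rank becomes an open
  condition on the sample.\<close>

lemma full_column_rank_iff_det:
  fixes A :: "complex mat"
  assumes A: "A \<in> carrier_mat n k"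
  shows "full_column_rank A \<longleftrightarrow> det (mat_adjoint A * A) \<noteq> 0"
proof -
  have G: "mat_adjoint A * A \<in> carrier_mat k k" using mat_adjoint_carrier[OF A] A by auto
  have "A *\<^sub>v v = 0\<^sub>v n \<longleftrightarrow> (mat_adjoint A * A) *\<^sub>v v = 0\<^sub>v k" if "v \<in> carrier_vec k" for v
  proof
    assume "A *\<^sub>v v = 0\<^sub>v n"
    then show "(mat_adjoint A * A) *\<^sub>v v = 0\<^sub>v k"
      using assoc_mult_mat_vec[OF mat_adjoint_carrier[OF A] A that] mat_adjoint_carrier[OF A] by auto
  qed (rule adjoint_mult_kernel[OF A that])
  then show ?thesis
    unfolding full_column_rank_iff_kernel[OF A] det_0_iff_vec_prod_zero[OF G] by blast
qed

text \<open>The adjugate form shows that the inverse depends continuously on the matrix entries, up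
  to division by the determinant.\<close>

lemma mat_inverse_adj_mat:
  fixes G :: "'a::field mat"
  assumes G: "G \<in> carrier_mat k k" and d: "det G \<noteq> 0"
  shows "the (mat_inverse G) = (1 / det G) \<cdot>\<^sub>m adj_mat G"
    and "G * the (mat_inverse G) = 1\<^sub>m k"
proof -
  let ?C = "(1 / det G) \<cdot>\<^sub>m adj_mat G"
  have adj: "adj_mat G \<in> carrier_mat k k" by (rule adj_mat(1)[OF G])
  then have C: "?C \<in> carrier_mat k k" by simp
  have GC: "G * ?C = 1\<^sub>m k"
    using adj_mat(2)[OF G] d mult_smult_distrib[OF G adj] by (auto intro!: eq_matI)
  have CG: "?C * G = 1\<^sub>m k"
    using adj_mat(3)[OF G] d mult_smult_assoc_mat[OF adj G] by (auto intro!: eq_matI)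
  have "G \<in> Units (ring_mat TYPE('a) k ())"
    using G C GC CG unfolding Units_def ring_mat_def by auto
  then obtain B where B: "mat_inverse G = Some B" using mat_inverse(1)[OF G, of "()"] by fastforce
  note B' = mat_inverse(2)[OF G B]
  have "B = (?C * G) * B" unfolding CG by (rule left_mult_one_mat[symmetric]) (use B' in blast)
  also have "\<dots> = ?C * (G * B)" by (rule assoc_mult_mat[OF C G]) (use B' in blast)
  also have "\<dots> = ?C" using B' right_mult_one_mat[OF C] by simp
  finally show "the (mat_inverse G) = ?C" using B by simp
  show "G * the (mat_inverse G) = 1\<^sub>m k" using B B' by simp
qed

lemma lsq_matrix_carrier: "lsq_matrix \<kappa> m n X \<in> carrier_mat n (m - 1)"
  by (simp add: lsq_matrix_def)

lemma lsq_matrix_index: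
  "i < n \<Longrightarrow> l < m - 1 \<Longrightarrow> lsq_matrix \<kappa> m n X $$ (i, l) = cis (freq_dot (\<kappa> (Suc l)) (X (Suc i)))"
  by (simp add: lsq_matrix_def trig_basis_def)

lemma lsq_coeffs_normal_equations:
  fixes \<kappa> :: "nat \<Rightarrow> int ^ 'd" and f :: "real ^ 'd \<Rightarrow> complex"
  assumes fr: "full_column_rank (lsq_matrix \<kappa> m n X)"
  defines "L \<equiv> lsq_matrix \<kappa> m n X" and "y \<equiv> Matrix.vec n (\<lambda>i. f (X (Suc i)))"
  shows "lsq_coeffs \<kappa> m n X f \<in> carrier_vec (m - 1)"
    and "mat_adjoint L *\<^sub>v (L *\<^sub>v lsq_coeffs \<kappa> m n X f) = mat_adjoint L *\<^sub>v y"
proof -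
  have L: "L \<in> carrier_mat n (m - 1)" unfolding L_def by (rule lsq_matrix_carrier)
  note LH = mat_adjoint_carrier[OF L]
  have G: "mat_adjoint L * L \<in> carrier_mat (m - 1) (m - 1)" using L LH by auto
  have d: "det (mat_adjoint L * L) \<noteq> 0" using fr full_column_rank_iff_det[OF L] by (simp add: L_def)
  let ?B = "the (mat_inverse (mat_adjoint L * L))"
  have B: "?B \<in> carrier_mat (m - 1) (m - 1)"
    unfolding mat_inverse_adj_mat(1)[OF G d] using adj_mat(1)[OF G] by simp
  have y: "y \<in> carrier_vec n" by (simp add: y_def)
  have c: "lsq_coeffs \<kappa> m n X f = ?B *\<^sub>v (mat_adjoint L *\<^sub>v y)"
    unfolding lsq_coeffs_def Let_def L_def[symmetric] y_def[symmetric]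
    by (rule assoc_mult_mat_vec[OF B LH y])
  show c': "lsq_coeffs \<kappa> m n X f \<in> carrier_vec (m - 1)" unfolding c using B LH y by auto
  have "mat_adjoint L *\<^sub>v (L *\<^sub>v lsq_coeffs \<kappa> m n X f) = (mat_adjoint L * L) *\<^sub>v lsq_coeffs \<kappa> m n X f"
    by (rule assoc_mult_mat_vec[OF LH L c', symmetric])
  also have "\<dots> = (mat_adjoint L * L * ?B) *\<^sub>v (mat_adjoint L *\<^sub>v y)"
    unfolding c by (rule assoc_mult_mat_vec[OF G B, symmetric]) (use LH y in auto)
  also have "\<dots> = mat_adjoint L *\<^sub>v y"
    unfolding mat_inverse_adj_mat(2)[OF G d] using LH y by auto
  finally show "mat_adjoint L *\<^sub>v (L *\<^sub>v lsq_coeffs \<kappa> m n X f) = mat_adjoint L *\<^sub>v y" .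
qed

text \<open>The fitted values minus those of the coefficients \<open>a\<close> form the orthogonal
  projection of the residual of \<open>a\<close> onto the column space. With \<open>u\<close> the
  projection and \<open>g\<close> the residual, the normal equations give
  \<open><u, u> = <u, g>\<close>, and Cauchy-Schwarz finishes.\<close>

lemma lsq_projection_le:
  fixes \<kappa> :: "nat \<Rightarrow> int ^ 'd" and a :: "nat \<Rightarrow> complex"
  assumes fr: "full_column_rank (lsq_matrix \<kappa> m n X)"
  defines "E \<equiv> \<lambda>i l. cis (freq_dot (\<kappa> (Suc l)) (X (Suc i)))"
  shows "(\<Sum>i<n. (cmod (\<Sum>l<m - 1. E i l * (vec_index (lsq_coeffs \<kappa> m n X f) l - a l)))\<^sup>2)
       \<le> (\<Sum>i<n. (cmod (f (X (Suc i)) - (\<Sum>l<m - 1. E i l * a l)))\<^sup>2)"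
proof -
  let ?L = "lsq_matrix \<kappa> m n X" and ?y = "Matrix.vec n (\<lambda>i. f (X (Suc i)))"
  let ?c = "lsq_coeffs \<kappa> m n X f"
  let ?k = "m - 1"
  define av where "av = Matrix.vec ?k a"
  have L: "?L \<in> carrier_mat n ?k" by (rule lsq_matrix_carrier)
  note c = lsq_coeffs_normal_equations(1)[OF fr, of f] and ne = lsq_coeffs_normal_equations(2)[OF fr, of f]
  have av: "av \<in> carrier_vec ?k" by (simp add: av_def)
  have y: "?y \<in> carrier_vec n" by simp
  have Ei: "vec_index (?L *\<^sub>v v) i = (\<Sum>l<?k. E i l * vec_index v l)" if "v \<in> carrier_vec ?k" "i < n" for v i
    unfolding mult_mat_vec_index[OF L that] using that by (intro sum.cong refl) (simp add: lsq_matrix_index E_def)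
  define u where "u = (\<lambda>i. \<Sum>l<?k. E i l * (vec_index ?c l - a l))"
  define g where "g = (\<lambda>i. f (X (Suc i)) - (\<Sum>l<?k. E i l * a l))"
  have u: "u i = vec_index (?L *\<^sub>v (?c - av)) i" if "i < n" for i
  proof -
    have "vec_index (?L *\<^sub>v (?c - av)) i = (\<Sum>l<?k. E i l * vec_index (?c - av) l)"
      by (rule Ei) (use c av that in auto)
    also have "\<dots> = u i" unfolding u_def using c by (intro sum.cong refl) (auto simp: av_def)
    finally show ?thesis ..
  qed
  have "(\<Sum>i<n. cnj (vec_index (?L *\<^sub>v (?c - av)) i) * vec_index (?L *\<^sub>v ?c) i)
      = (\<Sum>i<n. cnj (vec_index (?L *\<^sub>v (?c - av)) i) * vec_index ?y i)"
    using c av L y by (subst (1 2) adjoint_inner[OF L, symmetric]) (auto simp: ne)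
  then have "(\<Sum>i<n. cnj (u i) * vec_index (?L *\<^sub>v ?c) i) = (\<Sum>i<n. cnj (u i) * vec_index ?y i)"
    by (simp add: u)
  then have "(\<Sum>i<n. cnj (u i) * (vec_index (?L *\<^sub>v ?c) i - (\<Sum>l<?k. E i l * a l)))
      = (\<Sum>i<n. cnj (u i) * (vec_index ?y i - (\<Sum>l<?k. E i l * a l)))"
    by (simp add: right_diff_distrib sum_subtractf)
  moreover have "vec_index (?L *\<^sub>v ?c) i - (\<Sum>l<?k. E i l * a l) = u i" if "i < n" for i
    unfolding Ei[OF c that] u_def by (simp add: right_diff_distrib sum_subtractf)
  ultimately have uu: "(\<Sum>i<n. cnj (u i) * u i) = (\<Sum>i<n. cnj (u i) * g i)"
    by (simp add: g_def)
  define U where "U = (\<Sum>i<n. (cmod (u i))\<^sup>2)"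
  have "cnj z * z = of_real ((cmod z)\<^sup>2)" for z
    by (simp only: complex_norm_square mult.commute)
  then have "(\<Sum>i<n. cnj (u i) * u i) = of_real U" by (simp only: U_def of_real_sum)
  then have "cmod (\<Sum>i<n. cnj (u i) * g i) = U"
    unfolding uu[symmetric] by (simp only: norm_of_real) (simp add: U_def sum_nonneg)
  then have "U\<^sup>2 \<le> U * (\<Sum>i<n. (cmod (g i))\<^sup>2)"
    using Cauchy_Schwarz_complex_sum[of u g "{..<n}"] by (simp add: U_def)
  moreover have "0 \<le> U" "0 \<le> (\<Sum>i<n. (cmod (g i))\<^sup>2)" unfolding U_def by (auto intro: sum_nonneg)
  ultimately have "U \<le> (\<Sum>i<n. (cmod (g i))\<^sup>2)"
    by (cases "U = 0") (auto simp: power2_eq_square)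
  then show ?thesis by (simp add: U_def u_def g_def)
qed

subsection \<open>Measurability\<close>

lemma continuous_on_det:
  fixes A :: "'x::topological_space \<Rightarrow> complex mat"
  assumes A: "\<And>x. A x \<in> carrier_mat k k" and c: "\<And>i j. i < k \<Longrightarrow> j < k \<Longrightarrow> continuous_on S (\<lambda>x. A x $$ (i, j))"
  shows "continuous_on S (\<lambda>x. det (A x))"
proof -
  have "det (A x) = (\<Sum>p\<in>{p. p permutes {0..<k}}. signof p * (\<Prod>i = 0..<k. A x $$ (i, p i)))" for x
    by (rule det_def'[OF A])
  moreover have "continuous_on S (\<lambda>x. \<Sum>p\<in>{p. p permutes {0..<k}}. signof p * (\<Prod>i = 0..<k. A x $$ (i, p i)))"
  proof (intro continuous_intros c)
    fix p i assume "p \<in> {p. p permutes {0..<k}}" "i \<in> {0..<k}"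
    then show "i < k" "p i < k" using permutes_in_image[of p "{0..<k}" i] by auto
  qed
  ultimately show ?thesis by simp
qed

lemma continuous_on_adj_mat:
  fixes A :: "'x::topological_space \<Rightarrow> complex mat"
  assumes A: "\<And>x. A x \<in> carrier_mat k k" and c: "\<And>i j. i < k \<Longrightarrow> j < k \<Longrightarrow> continuous_on S (\<lambda>x. A x $$ (i, j))"
    and ij: "i < k" "j < k"
  shows "continuous_on S (\<lambda>x. adj_mat (A x) $$ (i, j))"
proof -
  have dims: "dim_row (A x) = k" "dim_col (A x) = k" for x using A[of x] by auto
  have "adj_mat (A x) $$ (i, j) = (-1) ^ (j + i) * det (mat_delete (A x) j i)" for x
    using ij by (simp add: adj_mat_def dims cofactor_def)
  moreover have "continuous_on S (\<lambda>x. det (mat_delete (A x) j i))"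
  proof (rule continuous_on_det[where k = "k - 1"])
    show "mat_delete (A x) j i \<in> carrier_mat (k - 1) (k - 1)" for x
      by (rule mat_delete_carrier[OF A])
    fix i' j' assume ij': "i' < k - 1" "j' < k - 1"
    show "continuous_on S (\<lambda>x. mat_delete (A x) j i $$ (i', j'))"
      unfolding mat_delete_def dims using ij' by (auto intro!: c)
  qed
  ultimately show ?thesis by (auto intro!: continuous_intros)
qed

lemma continuous_on_coordinate: "continuous_on S (\<lambda>X :: nat \<Rightarrow> real ^ 'd. X i)"
  by (rule continuous_on_product_then_coordinatewise[OF continuous_on_id])

abbreviation lsq_gram :: "(nat \<Rightarrow> int ^ 'd) \<Rightarrow> nat \<Rightarrow> nat \<Rightarrow> (nat \<Rightarrow> real ^ 'd) \<Rightarrow> complex mat" where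
  "lsq_gram \<kappa> m n X \<equiv> mat_adjoint (lsq_matrix \<kappa> m n X) * lsq_matrix \<kappa> m n X"

lemma lsq_gram_carrier: "lsq_gram \<kappa> m n X \<in> carrier_mat (m - 1) (m - 1)"
  using mat_adjoint_carrier[OF lsq_matrix_carrier] lsq_matrix_carrier by (rule mult_carrier_mat)

lemma continuous_on_lsq_gram:
  assumes "i < m - 1" "j < m - 1"
  shows "continuous_on S (\<lambda>X. lsq_gram \<kappa> m n X $$ (i, j))"
proof -
  have "lsq_gram \<kappa> m n X $$ (i, j)
      = (\<Sum>l<n. cnj (cis (freq_dot (\<kappa> (Suc i)) (X (Suc l)))) * cis (freq_dot (\<kappa> (Suc j)) (X (Suc l))))" for X
    unfolding mult_mat_index[OF mat_adjoint_carrier[OF lsq_matrix_carrier] lsq_matrix_carrier assms]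
    using assms by (intro sum.cong refl) (simp add: mat_adjoint_index[OF lsq_matrix_carrier] lsq_matrix_index)
  then show ?thesis by (auto intro!: continuous_intros continuous_on_coordinate)
qed

text \<open>Cramer's rule: \<open>N\<close> is built from sums and products of characters and values
  of \<open>f\<close> at the sample points, so it is continuous also where the rank drops.\<close>

lemma lsq_operator_numerator:
  fixes \<kappa> :: "nat \<Rightarrow> int ^ 'd" and f :: "real ^ 'd \<Rightarrow> complex"
  assumes f: "continuous_on UNIV f"
  obtains N where "\<And>x. continuous_on UNIV (\<lambda>X. N X x)"
    "\<And>X x. full_column_rank (lsq_matrix \<kappa> m n X) \<Longrightarrow>
      lsq_operator \<kappa> m n X f x = N X x / det (lsq_gram \<kappa> m n X)"
proof -
  let ?k = "m - 1"
  define q where "q = (\<lambda>X l. \<Sum>i<n. cnj (cis (freq_dot (\<kappa> (Suc l)) (X (Suc i)))) * f (X (Suc i)))"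
  define N where "N = (\<lambda>X x. \<Sum>l<?k. (\<Sum>j<?k. adj_mat (lsq_gram \<kappa> m n X) $$ (l, j) * q X j) * cis (freq_dot (\<kappa> (Suc l)) x))"
  show ?thesis
  proof (rule that)
    have fc: "continuous_on UNIV (\<lambda>X :: nat \<Rightarrow> real ^ 'd. f (X i))" for i
      by (rule continuous_on_compose2[OF f continuous_on_coordinate]) auto
    show "continuous_on UNIV (\<lambda>X. N X x)" for x
      unfolding N_def q_def
      by (intro continuous_intros fc continuous_on_coordinate
          continuous_on_adj_mat[where k = ?k] lsq_gram_carrier continuous_on_lsq_gram) auto
  next
    fix X :: "nat \<Rightarrow> real ^ 'd" and x :: "real ^ 'd"
    assume fr: "full_column_rank (lsq_matrix \<kappa> m n X)"
    let ?L = "lsq_matrix \<kappa> m n X" and ?G = "lsq_gram \<kappa> m n X" and ?y = "Matrix.vec n (\<lambda>i. f (X (Suc i)))"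
    note L = lsq_matrix_carrier[of \<kappa> m n X]
    note LH = mat_adjoint_carrier[OF L]
    note G = lsq_gram_carrier[of \<kappa> m n X]
    have d: "det ?G \<noteq> 0" using fr full_column_rank_iff_det[OF L] by simp
    have y: "?y \<in> carrier_vec n" by simp
    have adj: "adj_mat ?G \<in> carrier_mat ?k ?k" by (rule adj_mat(1)[OF G])
    have B: "(1 / det ?G) \<cdot>\<^sub>m adj_mat ?G \<in> carrier_mat ?k ?k" using adj by simp
    have w: "mat_adjoint ?L *\<^sub>v ?y \<in> carrier_vec ?k" using LH y by auto
    have c: "lsq_coeffs \<kappa> m n X f = ((1 / det ?G) \<cdot>\<^sub>m adj_mat ?G) *\<^sub>v (mat_adjoint ?L *\<^sub>v ?y)"
      unfolding lsq_coeffs_def Let_def mat_inverse_adj_mat(1)[OF G d]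
      by (rule assoc_mult_mat_vec[OF B LH y])
    have wl: "vec_index (mat_adjoint ?L *\<^sub>v ?y) l = q X l" if "l < ?k" for l
      unfolding mult_mat_vec_index[OF LH y that] q_def
      using that by (intro sum.cong refl) (simp add: mat_adjoint_index[OF L] lsq_matrix_index)
    have cl: "vec_index (lsq_coeffs \<kappa> m n X f) l = (\<Sum>j<?k. adj_mat ?G $$ (l, j) * q X j) / det ?G" if "l < ?k" for l
      unfolding c mult_mat_vec_index[OF B w that] sum_divide_distrib
      using that adj by (intro sum.cong refl) (simp add: wl)
    have "lsq_operator \<kappa> m n X f x
        = (\<Sum>l<?k. vec_index (lsq_coeffs \<kappa> m n X f) l * cis (freq_dot (\<kappa> (Suc l)) x))"
      unfolding lsq_operator_def trig_basis_def
      by (rule sum.reindex_bij_witness[of _ Suc "\<lambda>l. l - 1"]) auto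
    also have "\<dots> = N X x / det ?G"
      unfolding N_def sum_divide_distrib by (intro sum.cong refl) (simp add: cl)
    finally show "lsq_operator \<kappa> m n X f x = N X x / det ?G" .
  qed
qed

text \<open>Samples are functions on \<open>{1..n}\<close>, \<open>undefined\<close> elsewhere.
  Viewed in the product over all indices they live in a metric space whose product sigma-algebra is
  Borel, so open and closed conditions are measurable.\<close>

lemma measurable_torus_sample_UNIV:
  "(\<lambda>X. X) \<in> measurable (torus_sample n) (\<Pi>\<^sub>M j\<in>UNIV. (borel :: (real ^ 'd) measure))"
proof (rule measurable_PiM_single')
  fix i :: nat
  show "(\<lambda>X. X i) \<in> borel_measurable (torus_sample n :: (nat \<Rightarrow> real ^ 'd) measure)"
  proof (cases "i \<in> {1..n}")
    case True
    then show ?thesis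
      using measurable_component_singleton[of i "{1..n}" "\<lambda>_. torus_measure :: (real ^ 'd) measure"]
      by (simp add: measurable_cong_sets[OF refl sets_torus_measure])
  next
    case False
    then have "X i = undefined" if "X \<in> space (torus_sample n :: (nat \<Rightarrow> real ^ 'd) measure)" for X
      using that by (auto simp: space_PiM PiE_def extensional_def)
    then show ?thesis by (subst measurable_cong[where g = "\<lambda>_. undefined"]) auto
  qed
qed auto

text \<open>In a metric space sequences suffice to test closedness, and then only countably many
  null sets have to be discarded.\<close>

lemma closed_AE_le:
  fixes g h :: "'x::metric_space \<Rightarrow> 'y \<Rightarrow> real"
  assumes "\<And>y. continuous_on UNIV (\<lambda>x. g x y)" "\<And>y. continuous_on UNIV (\<lambda>x. h x y)"
  shows "closed {x. AE y in M. g x y \<le> h x y}"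
  unfolding closed_sequential_limits
proof (intro allI impI)
  fix X l assume X: "(\<forall>n. X n \<in> {x. AE y in M. g x y \<le> h x y}) \<and> X \<longlonglongrightarrow> l"
  then have "AE y in M. \<forall>n. g (X n) y \<le> h (X n) y" by (simp add: AE_all_countable)
  then have "AE y in M. g l y \<le> h l y"
  proof eventually_elim
    case (elim y)
    have "(\<lambda>n. g (X n) y) \<longlonglongrightarrow> g l y" "(\<lambda>n. h (X n) y) \<longlonglongrightarrow> h l y"
      by (rule continuous_on_tendsto_compose[OF assms(1) conjunct2[OF X]], simp_all)
        (rule continuous_on_tendsto_compose[OF assms(2) conjunct2[OF X]], simp_all)
    then show ?case by (rule LIMSEQ_le) (use elim in auto)
  qed
  then show "l \<in> {x. AE y in M. g x y \<le> h x y}" by simp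
qed

lemma torus_Linf_norm_sq_le_iff:
  fixes g :: "real ^ 'd \<Rightarrow> complex"
  assumes g: "g \<in> borel_measurable borel" and c: "0 \<le> c"
  shows "(torus_Linf_norm g)\<^sup>2 \<le> ereal c \<longleftrightarrow> (AE x in torus_measure. cmod (g x) \<le> sqrt c)"
proof -
  let ?M = "torus_measure :: (real ^ 'd) measure"
  interpret prob_space ?M by (rule prob_space_torus_measure)
  have [measurable]: "(\<lambda>x. ereal (cmod (g x))) \<in> borel_measurable ?M"
    using g by (simp add: measurable_cong_sets[OF sets_torus_measure refl])
  \<comment> \<open>Squaring an \<open>ereal\<close> is monotone only on nonnegative values:
    \<open>-\<infinity>\<close> would square to \<open>\<infinity>\<close>. The norm is nonnegative
    because the measure has positive mass.\<close>
  have "esssup ?M (\<lambda>x. 0 :: ereal) \<le> torus_Linf_norm g"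
    unfolding torus_Linf_norm_def by (rule esssup_mono) auto
  then have nn: "0 \<le> torus_Linf_norm g"
    by (subst (asm) esssup_const) (auto simp: emeasure_space_1[unfolded space_torus_measure])
  have sq: "(torus_Linf_norm g)\<^sup>2 \<le> ereal c \<longleftrightarrow> torus_Linf_norm g \<le> ereal (sqrt c)"
  proof (cases "torus_Linf_norm g")
    case (real r)
    then have "sqrt (r\<^sup>2) = r" using nn by simp
    then have "r\<^sup>2 \<le> c \<longleftrightarrow> r \<le> sqrt c" by (metis real_sqrt_le_iff)
    moreover have "(torus_Linf_norm g)\<^sup>2 = ereal (r\<^sup>2)" by (simp add: real power2_eq_square)
    ultimately show ?thesis using real by simp
  next
    case PInf
    then show ?thesis by (simp add: power2_eq_square)
  next
    case MInf
    then show ?thesis using nn by simp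
  qed
  also have "\<dots> \<longleftrightarrow> (AE x in ?M. ereal (cmod (g x)) \<le> ereal (sqrt c))"
  proof
    assume le: "torus_Linf_norm g \<le> ereal (sqrt c)"
    have "AE x in ?M. ereal (cmod (g x)) \<le> torus_Linf_norm g"
      unfolding torus_Linf_norm_def by (rule esssup_AE)
    then show "AE x in ?M. ereal (cmod (g x)) \<le> ereal (sqrt c)"
      by eventually_elim (rule order_trans[OF _ le])
  next
    assume "AE x in ?M. ereal (cmod (g x)) \<le> ereal (sqrt c)"
    then show "torus_Linf_norm g \<le> ereal (sqrt c)"
      unfolding torus_Linf_norm_def by (intro esssup_I) auto
  qed
  finally show ?thesis by simp
qed

lemma continuous_on_lsq_operator: "continuous_on UNIV (lsq_operator \<kappa> m n X f)"
  unfolding lsq_operator_def trig_basis_def by (intro continuous_intros)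

lemma SUP_lsq_error_le_iff:
  fixes \<kappa> :: "nat \<Rightarrow> int ^ 'd"
  assumes "0 \<le> c"
  shows "(SUP f\<in>Hmix_unit_ball s. (torus_Linf_norm (\<lambda>x. f x - lsq_operator \<kappa> m n X f x))\<^sup>2) \<le> ereal c
    \<longleftrightarrow> (\<forall>f\<in>Hmix_unit_ball s. AE x in torus_measure. cmod (f x - lsq_operator \<kappa> m n X f x) \<le> sqrt c)"
proof -
  have "(\<lambda>x. f x - lsq_operator \<kappa> m n X f x) \<in> borel_measurable borel" if "f \<in> Hmix_unit_ball s" for f
    using that continuous_on_lsq_operator[of \<kappa> m n X f]
    by (intro borel_measurable_continuous_onI continuous_intros) (auto simp: Hmix_unit_ball_def)
  then show ?thesis using torus_Linf_norm_sq_le_iff[OF _ assms] by (auto simp: SUP_le_iff)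
qed

text \<open>
  Multiplied by the determinant of the Gram matrix, the error bound for a single \<open>f\<close> is a closed condition on
  the sample, and closed sets are stable under the uncountable intersection over the unit ball.
\<close>

lemma lsq_event_measurable:
  fixes \<kappa> :: "nat \<Rightarrow> int ^ 'd"
  assumes c: "0 \<le> c"
  shows "{X \<in> space (torus_sample n). full_column_rank (lsq_matrix \<kappa> m n X) \<and>
      (SUP f\<in>Hmix_unit_ball s. (torus_Linf_norm (\<lambda>x. f x - lsq_operator \<kappa> m n X f x))\<^sup>2) \<le> ereal c}
    \<in> sets (torus_sample n)" (is "?E \<in> _")
proof -
  let ?D = "\<lambda>X. det (lsq_gram \<kappa> m n X)"
  have fr: "full_column_rank (lsq_matrix \<kappa> m n X) \<longleftrightarrow> ?D X \<noteq> 0" for X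
    by (rule full_column_rank_iff_det[OF lsq_matrix_carrier])
  have "\<exists>N. (\<forall>x. continuous_on UNIV (\<lambda>X. N X x)) \<and> (\<forall>X x. ?D X \<noteq> 0 \<longrightarrow>
      lsq_operator \<kappa> m n X f x = N X x / ?D X)" if "f \<in> Hmix_unit_ball s" for f
  proof -
    have "continuous_on UNIV f" using that by (simp add: Hmix_unit_ball_def)
    from lsq_operator_numerator[OF this, of \<kappa> m n] show ?thesis unfolding fr by metis
  qed
  then obtain N where N: "\<And>f x. f \<in> Hmix_unit_ball s \<Longrightarrow> continuous_on UNIV (\<lambda>X. N f X x)"
    "\<And>f X x. f \<in> Hmix_unit_ball s \<Longrightarrow> ?D X \<noteq> 0 \<Longrightarrow> lsq_operator \<kappa> m n X f x = N f X x / ?D X"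
    by metis
  have contD: "continuous_on UNIV ?D"
    by (rule continuous_on_det[OF lsq_gram_carrier]) (rule continuous_on_lsq_gram)
  define Op where "Op = {X. ?D X \<noteq> 0}"
  define Cl where "Cl = (\<Inter>f\<in>Hmix_unit_ball s. {X. AE x in torus_measure. cmod (?D X * f x - N f X x) \<le> sqrt c * cmod (?D X)})"
  have "open Op" unfolding Op_def by (rule open_Collect_neq[OF contD]) auto
  have "closed Cl" unfolding Cl_def
    by (intro closed_INT ballI closed_AE_le continuous_intros contD N(1))
  have "Op \<inter> Cl \<in> sets (\<Pi>\<^sub>M j\<in>UNIV. (borel :: (real ^ 'd) measure))"
    unfolding sets_PiM_equal_borel using \<open>open Op\<close> \<open>closed Cl\<close> by auto
  then have "(\<lambda>X. X) -` (Op \<inter> Cl) \<inter> space (torus_sample n) \<in> sets (torus_sample n)"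
    by (rule measurable_sets[OF measurable_torus_sample_UNIV])
  moreover have "?E = (\<lambda>X. X) -` (Op \<inter> Cl) \<inter> space (torus_sample n)"
  proof -
    have "cmod (f x - lsq_operator \<kappa> m n X f x) \<le> sqrt c \<longleftrightarrow> cmod (?D X * f x - N f X x) \<le> sqrt c * cmod (?D X)"
      if "f \<in> Hmix_unit_ball s" "?D X \<noteq> 0" for f X x
    proof -
      have "f x - lsq_operator \<kappa> m n X f x = (?D X * f x - N f X x) / ?D X"
        using that by (simp add: N(2) diff_divide_distrib)
      then show ?thesis using that by (simp add: norm_divide pos_divide_le_eq)
    qed
    then show ?thesis unfolding SUP_lsq_error_le_iff[OF c] fr Op_def Cl_def by auto
  qed
  ultimately show ?thesis by simp
qed

subsection \<open>The two sampling events\<close>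

lemma indexed_concentration:
  fixes u :: "int ^ 'd \<Rightarrow> real" and \<kappa> :: "nat \<Rightarrow> int ^ 'd"
  assumes A: "finite A" and inj: "inj_on \<kappa> A" and p: "p > 0" "even p"
    and u: "\<And>l. l \<in> A \<Longrightarrow> 0 \<le> u (\<kappa> l)" "\<And>l. l \<in> A \<Longrightarrow> u (\<kappa> l) \<le> \<tau>"
    and W: "(\<Sum>l\<in>A. u (\<kappa> l)) \<le> W" "0 < W" and \<tau>: "0 < \<tau>" "\<tau> \<le> 2 * W"
    and v: "2 * W * real p \<le> v"
  obtains E where "E \<in> sets (torus_sample n)"
    "measure (torus_sample n) E \<le> 2 * (W / \<tau>) * exp (real n * \<tau> / (5 * W) - real p)"
    "\<forall>X\<in>space (torus_sample n) - E. \<forall>a.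
      \<bar>(\<Sum>i<n. (cmod (\<Sum>l\<in>A. of_real (sqrt (u (\<kappa> l))) * a l * cis (freq_dot (\<kappa> l) (X (Suc i)))))\<^sup>2)
        - real n * (\<Sum>l\<in>A. u (\<kappa> l) * (cmod (a l))\<^sup>2)\<bar> \<le> v * (\<Sum>l\<in>A. (cmod (a l))\<^sup>2)"
proof -
  have fW: "finite (\<kappa> ` A)" "sum u (\<kappa> ` A) \<le> W" using A W inj by (simp_all add: sum.reindex)
  have u': "0 \<le> u k" "u k \<le> \<tau>" if "k \<in> \<kappa> ` A" for k using that u by auto
  obtain E where E: "E \<in> sets (torus_sample n)"
    "measure (torus_sample n) E \<le> 2 * (W / \<tau>) * exp (real n * \<tau> / (5 * W) - real p)"
    "\<forall>X\<in>space (torus_sample n) - E. \<forall>a.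
      \<bar>(\<Sum>j\<in>{1..n}. (cmod (\<Sum>k\<in>\<kappa> ` A. of_real (sqrt (u k)) * a k * cis (freq_dot k (X j))))\<^sup>2)
        - real n * (\<Sum>k\<in>\<kappa> ` A. u k * (cmod (a k))\<^sup>2)\<bar> \<le> v * (\<Sum>k\<in>\<kappa> ` A. (cmod (a k))\<^sup>2)"
    by (rule gram_deviation_concentration[OF fW(1) p u' fW(2) W(2) \<tau> v, of n])
  show ?thesis
  proof (rule that[OF E(1,2)], intro ballI allI)
    fix X and a :: "nat \<Rightarrow> complex" assume X: "X \<in> space (torus_sample n) - E"
    define b where "b = (\<lambda>k. a (the_inv_into A \<kappa> k))"
    have b: "b (\<kappa> l) = a l" if "l \<in> A" for l using that inj by (simp add: b_def the_inv_into_f_f)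
    have re: "(\<Sum>k\<in>\<kappa> ` A. h k) = (\<Sum>l\<in>A. h (\<kappa> l))" for h :: "int ^ 'd \<Rightarrow> 'z::comm_monoid_add"
      using inj by (simp add: sum.reindex)
    have shift: "(\<Sum>j\<in>{1..n}. h j) = (\<Sum>i<n. h (Suc i))" for h :: "nat \<Rightarrow> real"
      by (rule sum.reindex_bij_witness[of _ Suc "\<lambda>l. l - 1"]) auto
    show "\<bar>(\<Sum>i<n. (cmod (\<Sum>l\<in>A. of_real (sqrt (u (\<kappa> l))) * a l * cis (freq_dot (\<kappa> l) (X (Suc i)))))\<^sup>2)
        - real n * (\<Sum>l\<in>A. u (\<kappa> l) * (cmod (a l))\<^sup>2)\<bar> \<le> v * (\<Sum>l\<in>A. (cmod (a l))\<^sup>2)"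
      using E(3)[rule_format, OF X, of b] unfolding re shift by (simp add: b cong: sum.cong)
  qed
qed

text \<open>All weights are \<open>1\<close>, so \<open>\<tau> = 1\<close> and \<open>W = K\<close>.
  The diagonal is \<open>n\<close>, and a deviation of at most \<open>3 / 4 * n\<close> leaves
  \<open>n / 4\<close>.\<close>

lemma lower_frame_event:
  fixes \<kappa> :: "nat \<Rightarrow> int ^ 'd"
  assumes inj: "inj_on \<kappa> {1..}" and K: "K \<ge> 1" and p: "p > 0" "even p"
    and v: "2 * real K * real p \<le> 3 / 4 * real n"
  obtains E where "E \<in> sets (torus_sample n)"
    "measure (torus_sample n) E \<le> 2 * real K * exp (real n / (5 * real K) - real p)"
    "\<forall>X\<in>space (torus_sample n) - E. \<forall>a.
      real n / 4 * (\<Sum>l\<in>{1..K}. (cmod (a l))\<^sup>2)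
      \<le> (\<Sum>i<n. (cmod (\<Sum>l\<in>{1..K}. a l * cis (freq_dot (\<kappa> l) (X (Suc i)))))\<^sup>2)"
proof -
  have i: "inj_on \<kappa> {1..K}" using inj by (rule inj_on_subset) auto
  obtain E where E: "E \<in> sets (torus_sample n)"
    "measure (torus_sample n) E \<le> 2 * (real K / 1) * exp (real n * 1 / (5 * real K) - real p)"
    "\<forall>X\<in>space (torus_sample n) - E. \<forall>a.
      \<bar>(\<Sum>i<n. (cmod (\<Sum>l\<in>{1..K}. of_real (sqrt 1) * a l * cis (freq_dot (\<kappa> l) (X (Suc i)))))\<^sup>2)
        - real n * (\<Sum>l\<in>{1..K}. 1 * (cmod (a l))\<^sup>2)\<bar> \<le> 3 / 4 * real n * (\<Sum>l\<in>{1..K}. (cmod (a l))\<^sup>2)"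
    by (rule indexed_concentration[where u = "\<lambda>_. 1" and \<tau> = 1 and W = "real K" and n = n,
          OF finite_atLeastAtMost i p _ _ _ _ _ _ v]) (use K in simp_all)
  show ?thesis
  proof (rule that[OF E(1)], goal_cases)
    case 1
    show "measure (torus_sample n) E \<le> 2 * real K * exp (real n / (5 * real K) - real p)"
      using E(2) by simp
  next
    case 2
    show ?case
    proof (intro ballI allI)
      fix X and a :: "nat \<Rightarrow> complex" assume "X \<in> space (torus_sample n) - E"
      from E(3)[rule_format, OF this, of a]
      have "\<bar>(\<Sum>i<n. (cmod (\<Sum>l\<in>{1..K}. a l * cis (freq_dot (\<kappa> l) (X (Suc i)))))\<^sup>2)
        - real n * (\<Sum>l\<in>{1..K}. (cmod (a l))\<^sup>2)\<bar> \<le> 3 / 4 * (real n * (\<Sum>l\<in>{1..K}. (cmod (a l))\<^sup>2))"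
      by (simp only: real_sqrt_one of_real_1 mult_1 mult.assoc)
      then show "real n / 4 * (\<Sum>l\<in>{1..K}. (cmod (a l))\<^sup>2)
      \<le> (\<Sum>i<n. (cmod (\<Sum>l\<in>{1..K}. a l * cis (freq_dot (\<kappa> l) (X (Suc i)))))\<^sup>2)"
      unfolding times_divide_eq_left by linarith
    qed
  qed
qed

text \<open>Scaling the coefficients by the root of the weights maps the weighted unit ball onto the
  Euclidean one and puts the factors \<open>\<sigma>\<close> into the Gram matrix, with diagonal at
  most \<open>n * \<tau>\<close>.\<close>

lemma upper_frame_event:
  fixes \<kappa> :: "nat \<Rightarrow> int ^ 'd" and s :: real
  defines "\<sigma> \<equiv> \<lambda>l. 1 / mix_weight (2 * s) (\<kappa> l)"
  assumes inj: "inj_on \<kappa> {1..}" and A: "finite A" "A \<subseteq> {1..}" and p: "p > 0" "even p"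
    and \<sigma>: "\<And>l. l \<in> A \<Longrightarrow> \<sigma> l \<le> \<tau>"
    and W: "sum \<sigma> A \<le> W" "0 < W" and \<tau>: "0 < \<tau>" "\<tau> \<le> 2 * W" and v: "2 * W * real p \<le> v"
  obtains E where "E \<in> sets (torus_sample n)"
    "measure (torus_sample n) E \<le> 2 * (W / \<tau>) * exp (real n * \<tau> / (5 * W) - real p)"
    "\<forall>X\<in>space (torus_sample n) - E. \<forall>c. (\<Sum>l\<in>A. (cmod (c l))\<^sup>2 * mix_weight (2 * s) (\<kappa> l)) \<le> 1 \<longrightarrow>
      (\<Sum>i<n. (cmod (\<Sum>l\<in>A. c l * cis (freq_dot (\<kappa> l) (X (Suc i)))))\<^sup>2) \<le> real n * \<tau> + v"
proof -
  have i: "inj_on \<kappa> A" using inj A(2) by (rule inj_on_subset)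
  let ?u = "\<lambda>k. 1 / mix_weight (2 * s) k"
  obtain E where E: "E \<in> sets (torus_sample n)"
    "measure (torus_sample n) E \<le> 2 * (W / \<tau>) * exp (real n * \<tau> / (5 * W) - real p)"
    "\<forall>X\<in>space (torus_sample n) - E. \<forall>a.
      \<bar>(\<Sum>i<n. (cmod (\<Sum>l\<in>A. of_real (sqrt (?u (\<kappa> l))) * a l * cis (freq_dot (\<kappa> l) (X (Suc i)))))\<^sup>2)
        - real n * (\<Sum>l\<in>A. ?u (\<kappa> l) * (cmod (a l))\<^sup>2)\<bar> \<le> v * (\<Sum>l\<in>A. (cmod (a l))\<^sup>2)"
    by (rule indexed_concentration[OF A(1) i p _ \<sigma>[unfolded \<sigma>_def] W[unfolded \<sigma>_def] \<tau> v, of n]) simp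
  show ?thesis
  proof (rule that[OF E(1,2)], intro ballI allI impI)
    fix X and c :: "nat \<Rightarrow> complex"
    assume X: "X \<in> space (torus_sample n) - E" and c: "(\<Sum>l\<in>A. (cmod (c l))\<^sup>2 * mix_weight (2 * s) (\<kappa> l)) \<le> 1"
    define a where "a = (\<lambda>l. of_real (sqrt (mix_weight (2 * s) (\<kappa> l))) * c l)"
    have a: "of_real (sqrt (?u (\<kappa> l))) * a l = c l" for l
      unfolding a_def mult.assoc[symmetric] of_real_mult[symmetric] by (simp add: real_sqrt_divide)
    have a2: "(cmod (a l))\<^sup>2 = (cmod (c l))\<^sup>2 * mix_weight (2 * s) (\<kappa> l)" for l
      by (simp add: a_def norm_mult power_mult_distrib)
    have S: "(\<Sum>l\<in>A. (cmod (a l))\<^sup>2) \<le> 1" using c by (simp add: a2)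
    have v0: "0 \<le> v" using v W by (smt (verit) mult_nonneg_nonneg of_nat_0_le_iff)
    have "real n * (\<Sum>l\<in>A. ?u (\<kappa> l) * (cmod (a l))\<^sup>2) \<le> real n * (\<Sum>l\<in>A. \<tau> * (cmod (a l))\<^sup>2)"
      using \<sigma> by (intro mult_left_mono sum_mono mult_right_mono) (auto simp: \<sigma>_def)
    also have "\<dots> = real n * \<tau> * (\<Sum>l\<in>A. (cmod (a l))\<^sup>2)" by (simp add: sum_distrib_left mult.assoc)
    also have "\<dots> \<le> real n * \<tau> * 1" using S \<tau> by (intro mult_left_mono) auto
    finally have 1: "real n * (\<Sum>l\<in>A. ?u (\<kappa> l) * (cmod (a l))\<^sup>2) \<le> real n * \<tau>" by simp
    have 2: "v * (\<Sum>l\<in>A. (cmod (a l))\<^sup>2) \<le> v" using mult_left_mono[OF S v0] by simp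
    show "(\<Sum>i<n. (cmod (\<Sum>l\<in>A. c l * cis (freq_dot (\<kappa> l) (X (Suc i)))))\<^sup>2) \<le> real n * \<tau> + v"
      using E(3)[rule_format, OF X, of a] 1 2 unfolding a by linarith
  qed
qed

text \<open>Cauchy-Schwarz against the weights on finite pieces, then a limit. The start
  \<open>a\<close> is left open because the bound serves both at \<open>m\<close> and beyond the cut
  \<open>M\<close>.\<close>

lemma fourier_tail_bound:
  fixes \<kappa> :: "nat \<Rightarrow> int ^ 'd"
  assumes f: "f \<in> Hmix_unit_ball s" and ord: "weight_ordering s \<kappa>"
    and sm: "summable (\<lambda>l. 1 / mix_weight (2 * s) (\<kappa> l))"
    and a: "a \<ge> 1" and T: "\<And>N. (\<Sum>l\<in>{a..N}. 1 / mix_weight (2 * s) (\<kappa> l)) \<le> T"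
  shows "(cmod (f x - (\<Sum>l\<in>{1..<a}. fourier_coeff f (\<kappa> l) * cis (freq_dot (\<kappa> l) x))))\<^sup>2 \<le> T"
proof -
  let ?c = "\<lambda>l. fourier_coeff f (\<kappa> l)" and ?w = "\<lambda>l. mix_weight (2 * s) (\<kappa> l)"
  let ?t = "\<lambda>l. ?c l * cis (freq_dot (\<kappa> l) x)"
  have part: "(cmod (\<Sum>l\<in>{a..N}. ?t l))\<^sup>2 \<le> T" for N
  proof -
    have "cmod (\<Sum>l\<in>{a..N}. ?t l) \<le> (\<Sum>l\<in>{a..N}. (cmod (?c l) * sqrt (?w l)) * (1 / sqrt (?w l)))"
      using norm_sum[of ?t "{a..N}"] by (simp add: norm_mult)
    then have "(cmod (\<Sum>l\<in>{a..N}. ?t l))\<^sup>2 \<le> (\<Sum>l\<in>{a..N}. (cmod (?c l) * sqrt (?w l)) * (1 / sqrt (?w l)))\<^sup>2"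
      by (intro power_mono) auto
    also have "\<dots> \<le> (\<Sum>l\<in>{a..N}. (cmod (?c l) * sqrt (?w l))\<^sup>2) * (\<Sum>l\<in>{a..N}. (1 / sqrt (?w l))\<^sup>2)"
      by (rule Cauchy_Schwarz_ineq_sum)
    also have "\<dots> = (\<Sum>l\<in>{a..N}. (cmod (?c l))\<^sup>2 * ?w l) * (\<Sum>l\<in>{a..N}. 1 / ?w l)"
      by (simp add: power_mult_distrib power_divide)
    also have "\<dots> \<le> 1 * T"
      using a by (intro mult_mono T Hmix_coeff_sum_le[OF f ord sm] sum_nonneg) auto
    finally show ?thesis by simp
  qed
  have "summable (\<lambda>l. ?t (Suc l))"
    by (rule summable_norm_cancel) (simp add: norm_mult Hmix_coeff_summable[OF f ord sm])
  then have "(\<lambda>N. \<Sum>l<N. ?t (Suc l)) \<longlonglongrightarrow> f x"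
    using summable_LIMSEQ Hmix_fourier_series[OF f ord sm, of x] by metis
  then have lim: "(\<lambda>N. (cmod ((\<Sum>l<N. ?t (Suc l)) - (\<Sum>l\<in>{1..<a}. ?t l)))\<^sup>2) \<longlonglongrightarrow> (cmod (f x - (\<Sum>l\<in>{1..<a}. ?t l)))\<^sup>2"
    by (intro tendsto_intros)
  show ?thesis
  proof (rule LIMSEQ_le_const2[OF lim], intro exI allI impI)
    fix N assume N: "N \<ge> a"
    have "(\<Sum>l<N. ?t (Suc l)) = (\<Sum>l\<in>{1..N}. ?t l)"
      by (rule sum.reindex_bij_witness[of _ "\<lambda>l. l - 1" Suc]) auto
    also have "{1..N} = {1..<a} \<union> {a..N}" using N a by auto
    also have "(\<Sum>l\<in>{1..<a} \<union> {a..N}. ?t l) = (\<Sum>l\<in>{1..<a}. ?t l) + (\<Sum>l\<in>{a..N}. ?t l)"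
      by (rule sum.union_disjoint) auto
    finally show "(cmod ((\<Sum>l<N. ?t (Suc l)) - (\<Sum>l\<in>{1..<a}. ?t l)))\<^sup>2 \<le> T"
      using part[of N] by simp
  qed
qed

section \<open>The deterministic error estimate under the two frame bounds\<close>

lemma norm_add_sq_le: "(cmod (x + y))\<^sup>2 \<le> 2 * (cmod x)\<^sup>2 + 2 * (cmod y)\<^sup>2"
proof -
  have "(cmod (x + y))\<^sup>2 \<le> (cmod x + cmod y)\<^sup>2" by (intro power_mono norm_triangle_ineq) auto
  also have "\<dots> \<le> 2 * (cmod x)\<^sup>2 + 2 * (cmod y)\<^sup>2"
    using sum_squares_bound[of "cmod x" "cmod y"] by (simp add: power2_sum)
  finally show ?thesis .
qed

lemma frame_full_column_rank:
  fixes \<kappa> :: "nat \<Rightarrow> int ^ 'd"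
  assumes n: "n > 0" and low: "\<And>a. real n / 4 * (\<Sum>l\<in>{1..m - 1}. (cmod (a l))\<^sup>2)
      \<le> (\<Sum>i<n. (cmod (\<Sum>l\<in>{1..m - 1}. a l * cis (freq_dot (\<kappa> l) (X (Suc i)))))\<^sup>2)"
  shows "full_column_rank (lsq_matrix \<kappa> m n X)"
  unfolding full_column_rank_iff_kernel[OF lsq_matrix_carrier]
proof (intro ballI impI)
  fix v :: "complex Matrix.vec"
  assume v: "v \<in> carrier_vec (m - 1)" and z: "lsq_matrix \<kappa> m n X *\<^sub>v v = 0\<^sub>v n"
  let ?a = "\<lambda>l. vec_index v (l - 1)"
  have "(\<Sum>l\<in>{1..m - 1}. ?a l * cis (freq_dot (\<kappa> l) (X (Suc i)))) = 0" if "i < n" for i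
  proof -
    have "(\<Sum>l\<in>{1..m - 1}. ?a l * cis (freq_dot (\<kappa> l) (X (Suc i))))
        = (\<Sum>l<m - 1. lsq_matrix \<kappa> m n X $$ (i, l) * vec_index v l)"
      by (rule sum.reindex_bij_witness[of _ Suc "\<lambda>l. l - 1"]) (use that in \<open>auto simp: lsq_matrix_index\<close>)
    also have "\<dots> = vec_index (lsq_matrix \<kappa> m n X *\<^sub>v v) i"
      by (rule mult_mat_vec_index[OF lsq_matrix_carrier v that, symmetric])
    finally show ?thesis using z that by simp
  qed
  then have "real n / 4 * (\<Sum>l\<in>{1..m - 1}. (cmod (?a l))\<^sup>2) \<le> 0"
    using low[of ?a] by simp
  then have "(\<Sum>l\<in>{1..m - 1}. (cmod (?a l))\<^sup>2) \<le> 0" using n by (simp add: mult_le_0_iff)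
  then have "(\<Sum>l\<in>{1..m - 1}. (cmod (?a l))\<^sup>2) = 0" by (intro antisym sum_nonneg) auto
  then have "\<forall>l\<in>{1..m - 1}. ?a l = 0" by (subst (asm) sum_nonneg_eq_0_iff) auto
  then have "vec_index v l = 0" if "l < m - 1" for l
    using that by (auto dest!: bspec[where x = "Suc l"])
  then show "v = 0\<^sub>v (m - 1)" using v by (intro eq_vecI) auto
qed

text \<open>At the sample points the remainder splits at \<open>M\<close>: frequencies up to
  \<open>M\<close> are measured by \<open>\<Lambda>\<close>, later ones contribute at most
  \<open>B / n\<close> per point. This bounds the residual by \<open>2 * \<Lambda> + 2 * B\<close>.
  The lower frame bound passes from fitted values to the coefficient error \<open>d\<close>, and a
  sum of \<open>m - 1\<close> characters turns the Euclidean norm of \<open>d\<close> into a uniform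
  bound.\<close>

lemma lsq_error_bound:
  fixes \<kappa> :: "nat \<Rightarrow> int ^ 'd"
  assumes f: "f \<in> Hmix_unit_ball s" and ord: "weight_ordering s \<kappa>"
    and sm: "summable (\<lambda>l. 1 / mix_weight (2 * s) (\<kappa> l))"
    and n: "n > 0" and m: "m \<ge> 2"
    and low: "\<And>a. real n / 4 * (\<Sum>l\<in>{1..m - 1}. (cmod (a l))\<^sup>2)
      \<le> (\<Sum>i<n. (cmod (\<Sum>l\<in>{1..m - 1}. a l * cis (freq_dot (\<kappa> l) (X (Suc i)))))\<^sup>2)"
    and up: "\<And>c. (\<Sum>l\<in>{m..M}. (cmod (c l))\<^sup>2 * mix_weight (2 * s) (\<kappa> l)) \<le> 1 \<Longrightarrow>
      (\<Sum>i<n. (cmod (\<Sum>l\<in>{m..M}. c l * cis (freq_dot (\<kappa> l) (X (Suc i)))))\<^sup>2) \<le> \<Lambda>"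
    and B: "\<And>N. (\<Sum>l\<in>{m..N}. 1 / mix_weight (2 * s) (\<kappa> l)) \<le> B"
    and M: "m \<le> Suc M" "\<And>N. (\<Sum>l\<in>{Suc M..N}. 1 / mix_weight (2 * s) (\<kappa> l)) \<le> B / real n"
  shows "(cmod (f x - lsq_operator \<kappa> m n X f x))\<^sup>2 \<le> 2 * B + 8 * real (m - 1) / real n * (2 * \<Lambda> + 2 * B)"
proof -
  let ?K = "m - 1"
  let ?e = "\<lambda>l y. cis (freq_dot (\<kappa> l) y)"
  define c where "c = (\<lambda>l. fourier_coeff f (\<kappa> l))"
  define P where "P = (\<lambda>y. \<Sum>l\<in>{1..<m}. c l * ?e l y)"
  define d where "d = (\<lambda>l. vec_index (lsq_coeffs \<kappa> m n X f) (l - 1) - c l)"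
  have fr: "full_column_rank (lsq_matrix \<kappa> m n X)" by (rule frame_full_column_rank[OF n low])
  have Km: "{1..<m} = {1..?K}" using m by auto
  have gB: "(cmod (f y - P y))\<^sup>2 \<le> B" for y
    unfolding P_def c_def by (rule fourier_tail_bound[OF f ord sm _ B]) (use m in auto)
  have pt: "(\<Sum>i<n. (cmod (f (X (Suc i)) - P (X (Suc i))))\<^sup>2) \<le> 2 * \<Lambda> + 2 * B"
  proof -
    let ?h = "\<lambda>y. \<Sum>l\<in>{m..M}. c l * ?e l y"
    have "(cmod (f y - P y))\<^sup>2 \<le> 2 * (cmod (?h y))\<^sup>2 + 2 * (B / real n)" for y
    proof -
      have "{1..<Suc M} = {1..<m} \<union> {m..M}" using m M(1) by auto
      then have "(\<Sum>l\<in>{1..<Suc M}. c l * ?e l y) = P y + ?h y"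
        unfolding P_def by (simp only:) (rule sum.union_disjoint, auto)
      then have "f y - P y = ?h y + (f y - (\<Sum>l\<in>{1..<Suc M}. c l * ?e l y))" by simp
      then have "(cmod (f y - P y))\<^sup>2 \<le> 2 * (cmod (?h y))\<^sup>2 + 2 * (cmod (f y - (\<Sum>l\<in>{1..<Suc M}. c l * ?e l y)))\<^sup>2"
        using norm_add_sq_le by metis
      moreover have "(cmod (f y - (\<Sum>l\<in>{1..<Suc M}. c l * ?e l y)))\<^sup>2 \<le> B / real n"
        unfolding c_def by (rule fourier_tail_bound[OF f ord sm _ M(2)]) simp
      ultimately show ?thesis by linarith
    qed
    then have "(\<Sum>i<n. (cmod (f (X (Suc i)) - P (X (Suc i))))\<^sup>2)
        \<le> (\<Sum>i<n. 2 * (cmod (?h (X (Suc i))))\<^sup>2 + 2 * (B / real n))"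
      by (intro sum_mono)
    also have "\<dots> = 2 * (\<Sum>i<n. (cmod (?h (X (Suc i))))\<^sup>2) + 2 * B"
      using n by (simp add: sum.distrib sum_distrib_left)
    also have "(\<Sum>i<n. (cmod (?h (X (Suc i))))\<^sup>2) \<le> \<Lambda>"
      unfolding c_def by (rule up, rule Hmix_coeff_sum_le[OF f ord sm]) (use m in auto)
    finally show ?thesis by simp
  qed
  have reix: "(\<Sum>l<?K. g l) = (\<Sum>l\<in>{1..?K}. g (l - 1))" for g :: "nat \<Rightarrow> complex"
    by (rule sum.reindex_bij_witness[of _ "\<lambda>l. l - 1" Suc]) auto
  have "(\<Sum>i<n. (cmod (\<Sum>l\<in>{1..?K}. d l * ?e l (X (Suc i))))\<^sup>2) \<le> 2 * \<Lambda> + 2 * B"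
  proof -
    have "(\<Sum>l<?K. cis (freq_dot (\<kappa> (Suc l)) (X (Suc i))) * (vec_index (lsq_coeffs \<kappa> m n X f) l - c (Suc l)))
        = (\<Sum>l\<in>{1..?K}. d l * ?e l (X (Suc i)))" for i
      unfolding reix by (intro sum.cong refl) (auto simp: d_def mult.commute)
    moreover have "(\<Sum>l<?K. cis (freq_dot (\<kappa> (Suc l)) (X (Suc i))) * c (Suc l)) = P (X (Suc i))" for i
      unfolding reix P_def Km by (intro sum.cong refl) (auto simp: mult.commute)
    ultimately show ?thesis
      using lsq_projection_le[OF fr, of f "\<lambda>l. c (Suc l)"] pt by simp
  qed
  then have "real n / 4 * (\<Sum>l\<in>{1..?K}. (cmod (d l))\<^sup>2) \<le> 2 * \<Lambda> + 2 * B"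
    using low[of d] by linarith
  then have dn: "(\<Sum>l\<in>{1..?K}. (cmod (d l))\<^sup>2) \<le> 4 / real n * (2 * \<Lambda> + 2 * B)"
    using n by (simp add: field_simps)
  have "(cmod (\<Sum>l\<in>{1..?K}. d l * ?e l x))\<^sup>2 \<le> real ?K * (\<Sum>l\<in>{1..?K}. (cmod (d l))\<^sup>2)"
  proof -
    have "cmod (\<Sum>l\<in>{1..?K}. d l * ?e l x) \<le> (\<Sum>l\<in>{1..?K}. 1 * cmod (d l))"
      using norm_sum[of "\<lambda>l. d l * ?e l x" "{1..?K}"] by (simp add: norm_mult)
    then have "(cmod (\<Sum>l\<in>{1..?K}. d l * ?e l x))\<^sup>2 \<le> (\<Sum>l\<in>{1..?K}. 1 * cmod (d l))\<^sup>2"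
      by (intro power_mono) auto
    also have "\<dots> \<le> (\<Sum>l\<in>{1..?K}. 1\<^sup>2) * (\<Sum>l\<in>{1..?K}. (cmod (d l))\<^sup>2)"
      by (rule Cauchy_Schwarz_ineq_sum)
    finally show ?thesis by simp
  qed
  also have "\<dots> \<le> real ?K * (4 / real n * (2 * \<Lambda> + 2 * B))"
    using dn by (intro mult_left_mono) auto
  finally have Pd: "(cmod (\<Sum>l\<in>{1..?K}. d l * ?e l x))\<^sup>2 \<le> real ?K * (4 / real n * (2 * \<Lambda> + 2 * B))" .
  have "lsq_operator \<kappa> m n X f x - P x = (\<Sum>l\<in>{1..?K}. d l * ?e l x)"
    unfolding lsq_operator_def trig_basis_def P_def Km sum_subtractf[symmetric] d_def
    by (simp add: left_diff_distrib)
  then have "f x - lsq_operator \<kappa> m n X f x = (f x - P x) + - (\<Sum>l\<in>{1..?K}. d l * ?e l x)"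
    by (simp add: algebra_simps)
  then have "(cmod (f x - lsq_operator \<kappa> m n X f x))\<^sup>2
      \<le> 2 * (cmod (f x - P x))\<^sup>2 + 2 * (cmod (\<Sum>l\<in>{1..?K}. d l * ?e l x))\<^sup>2"
    by (simp only:) (rule order_trans[OF norm_add_sq_le], simp only: norm_minus_cancel order_refl)
  also have "\<dots> \<le> 2 * B + 2 * (real ?K * (4 / real n * (2 * \<Lambda> + 2 * B)))"
    using gB[of x] Pd by linarith
  finally show ?thesis by (simp add: algebra_simps add_divide_distrib)
qed

section \<open>Choice of the moment order and numerical constants\<close>

lemma sampling_size_bounds:
  fixes r :: real and n m :: nat
  assumes r: "r > 1" and n: "n \<ge> 3" and m: "m = nat \<lfloor>real n / (10 * r * ln (real n))\<rfloor>" and m3: "m \<ge> 3"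
  shows "10 * (r * ln (real n)) * real m \<le> real n" and "2 \<le> r * ln (real n)"
proof -
  have l1: "1 \<le> ln (real n)" using n e_less_272 by (subst ln_ge_iff) auto
  then have y1: "1 \<le> r * ln (real n)" using r mult_mono[of 1 r 1 "ln (real n)"] by simp
  have "real m \<le> real n / (10 * r * ln (real n))"
    using m m3 by linarith
  then show F: "10 * (r * ln (real n)) * real m \<le> real n" using y1 by (simp add: field_simps)
  have "10 * 1 * 3 \<le> 10 * (r * ln (real n)) * real m"
    using y1 m3 by (intro mult_mono) auto
  \<comment> \<open>\<open>m \<ge> 3\<close> forces \<open>n\<close> to be at least
    \<open>30 > exp 2\<close>; this is where the lower bound \<open>2\<close> for
    \<open>r * ln n\<close> comes from.\<close>
  then have n30: "30 \<le> real n" using F by linarith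
  have "exp (2::real) = exp 1 * exp 1" by (simp flip: exp_add)
  also have "\<dots> \<le> 2.72 * 2.72" using e_less_272 by (intro mult_mono) auto
  finally have "2 \<le> ln (real n)" using n30 by (subst ln_ge_iff) auto
  then show "2 \<le> r * ln (real n)" using r mult_mono[of 1 r 2 "ln (real n)"] by simp
qed

text \<open>\<open>p\<close> is the largest even number below \<open>3 * t / 8\<close>, the most
  that the deviation \<open>3 / 4 * n\<close> permits. The exponent is at most
  \<open>t / 5 - 3 * t / 8 + 2\<close>, hence at most \<open>2 - y\<close> since
  \<open>t \<ge> 10 * y\<close>. The price \<open>exp 2 < 10\<close> of rounding is covered by
  \<open>20 * K \<le> n\<close>.\<close>

lemma lower_moment_order:
  fixes y :: real and n K :: nat
  assumes K: "K \<ge> 1" and F: "10 * y * real K \<le> real n" and y: "2 \<le> y"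
  obtains p where "p > 0" "even p" "2 * real K * real p \<le> 3 / 4 * real n"
    "2 * real K * exp (real n / (5 * real K) - real p) \<le> real n * exp (- y)"
proof
  define t where "t = real n / real K"
  define p where "p = 2 * nat \<lfloor>3 * t / 16\<rfloor>"
  have t: "10 * y \<le> t" using F K by (simp add: t_def field_simps)
  have p_le: "real p \<le> 3 * t / 8" and p_ge: "3 * t / 8 - 2 \<le> real p"
    using t y unfolding p_def by linarith+
  show "p > 0" using p_ge t y by linarith
  show "even p" by (simp add: p_def)
  have "2 * real K * real p \<le> 2 * real K * (3 * t / 8)" by (intro mult_left_mono p_le) auto
  also have "\<dots> = 3 / 4 * real n" using K by (simp add: t_def)
  finally show "2 * real K * real p \<le> 3 / 4 * real n" .
  have "real n / (5 * real K) = t / 5" by (simp add: t_def)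
  then have "real n / (5 * real K) - real p \<le> 2 + - y" using p_ge t y by linarith
  then have "exp (real n / (5 * real K) - real p) \<le> exp 2 * exp (- y)"
    unfolding exp_add[symmetric] by (subst exp_le_cancel_iff)
  then have "2 * real K * exp (real n / (5 * real K) - real p) \<le> 2 * real K * (exp 2 * exp (- y))"
    by (intro mult_left_mono) auto
  also have "\<dots> = (2 * real K * exp 2) * exp (- y)" by simp
  also have "\<dots> \<le> real n * exp (- y)"
  proof (intro mult_right_mono)
    have "exp (2::real) = exp 1 * exp 1" by (simp flip: exp_add)
    also have "\<dots> \<le> 2.72 * 2.72" using e_less_272 by (intro mult_mono) auto
    finally have "2 * real K * exp 2 \<le> 2 * real K * 10" by (intro mult_left_mono) auto
    also have "\<dots> \<le> 10 * y * real K" using y mult_right_mono[of 2 y "10 * real K"] by (simp add: mult_ac)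
    finally show "2 * real K * exp 2 \<le> real n" using F by linarith
  qed simp
  finally show "2 * real K * exp (real n / (5 * real K) - real p) \<le> real n * exp (- y)" .
qed

text \<open>Everything is measured in \<open>Q\<close>: both \<open>(m - 1) * \<sigma>\<close> and
  \<open>(\<beta> - 1) * B\<close> are at most \<open>2 * Q\<close>. The choice of \<open>m\<close>
  gives \<open>y * (m - 1) / n \<le> 1 / 10\<close>, which cancels the logarithm in
  \<open>\<Lambda>\<close>.\<close>

lemma error_constant_le:
  fixes y \<beta> \<sigma> B :: real and n m :: nat
  assumes \<beta>: "\<beta> > 1" and m: "m \<ge> 3" and F: "10 * y * real m \<le> real n" and y: "2 \<le> y"
    and \<sigma>: "\<sigma> \<le> (9 / real m) powr \<beta>" and B: "B = tail_bound \<beta> m"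
    and \<Lambda>: "\<Lambda> = 2 * (real n * \<sigma> + B) + 2 * B * (y + 2)"
  shows "2 * B + 8 * real (m - 1) / real n * (2 * \<Lambda> + 2 * B)
       \<le> 1612 * (16 / 3) powr \<beta> * (\<beta> / (\<beta> - 1)) * (real m / 2 - 1) powr (- \<beta> + 1)"
proof -
  define Q where "Q = (16 / 3) powr \<beta> * (real m / 2 - 1) powr (1 - \<beta>)"
  have Q0: "0 \<le> Q" by (simp add: Q_def)
  have "0 < 10 * y * real m" using y m by (intro mult_pos_pos) auto
  then have n0: "0 < real n" using F by linarith
  have B0: "0 \<le> B" using \<beta> by (simp add: B tail_bound_def)
  \<comment> \<open>Uses \<open>9 \<le> 32 / 3\<close> and
    \<open>m - 1 \<ge> 2 * (m / 2 - 1)\<close>; of the powers of \<open>2\<close> exactly one factor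
    \<open>2\<close> remains.\<close>
  have nine: "9 powr \<beta> * (real m - 1) powr (1 - \<beta>) \<le> 2 * Q"
  proof -
    have "(real m - 1) powr (1 - \<beta>) \<le> (2 * (real m / 2 - 1)) powr (1 - \<beta>)"
      using m \<beta> by (intro powr_mono2') auto
    also have "\<dots> = 2 powr (1 - \<beta>) * (real m / 2 - 1) powr (1 - \<beta>)"
      using m by (subst powr_mult) auto
    finally have "9 powr \<beta> * (real m - 1) powr (1 - \<beta>)
        \<le> (16 / 3 * 2) powr \<beta> * (2 powr (1 - \<beta>) * (real m / 2 - 1) powr (1 - \<beta>))"
      using \<beta> by (intro mult_mono powr_mono2) auto
    also have "\<dots> = (16 / 3) powr \<beta> * (2 powr \<beta> * 2 powr (1 - \<beta>)) * (real m / 2 - 1) powr (1 - \<beta>)"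
      by (subst powr_mult) auto
    also have "2 powr \<beta> * 2 powr (1 - \<beta>) = (2::real)" by (simp flip: powr_add)
    finally show ?thesis by (simp add: Q_def)
  qed
  have K: "real (m - 1) = real m - 1" using m by simp
  have Bn: "B \<le> 2 * Q / (\<beta> - 1)"
    using divide_right_mono[OF nine, of "\<beta> - 1"] \<beta> by (simp add: B tail_bound_def)
  have Ks: "real (m - 1) * \<sigma> \<le> 2 * Q"
  proof -
    have "real (m - 1) * \<sigma> \<le> (real m - 1) * (9 / real m) powr \<beta>"
      unfolding K using \<sigma> m by (intro mult_left_mono) auto
    also have "\<dots> \<le> (real m - 1) * (9 / (real m - 1)) powr \<beta>"
      using m \<beta> by (intro mult_left_mono powr_mono2) (auto simp: field_simps)
    also have "\<dots> = 9 powr \<beta> * ((real m - 1) powr 1 * (real m - 1) powr (- \<beta>))"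
      using m by (simp add: powr_divide powr_minus_divide)
    also have "(real m - 1) powr 1 * (real m - 1) powr (- \<beta>) = (real m - 1) powr (1 - \<beta>)"
      by (simp only: powr_add[symmetric] diff_conv_add_uminus)
    finally show ?thesis using nine by linarith
  qed
  have yK: "y * (real (m - 1) / real n) \<le> 1 / 10"
  proof -
    have "10 * y * real (m - 1) \<le> 10 * y * real m" using y unfolding K by (intro mult_left_mono) auto
    then have "10 * y * real (m - 1) \<le> real n" using F by linarith
    then show ?thesis using n0 by (simp add: field_simps)
  qed
  have Kn: "real (m - 1) / real n \<le> 1 / 20"
  proof -
    have "2 * (real (m - 1) / real n) \<le> y * (real (m - 1) / real n)"
      using y by (intro mult_right_mono) auto
    then show ?thesis using yK by linarith
  qed
  have "2 * B + 8 * real (m - 1) / real n * (2 * \<Lambda> + 2 * B)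
      = 2 * B + 32 * (real (m - 1) * \<sigma>) + B * (112 * (real (m - 1) / real n) + 32 * (y * (real (m - 1) / real n)))"
    using n0 by (simp add: \<Lambda> field_simps)
  also have "\<dots> \<le> 2 * B + 32 * (2 * Q) + B * (112 * (1 / 20) + 32 * (1 / 10))"
    using Ks B0 Kn yK by (intro add_mono mult_left_mono order_refl) auto
  also have "\<dots> \<le> 11 * B + 64 * Q" using B0 by simp
  also have "\<dots> \<le> 11 * (2 * Q / (\<beta> - 1)) + 64 * Q" using Bn by simp
  also have "\<dots> \<le> 22 * (Q * (\<beta> / (\<beta> - 1))) + 64 * (Q * (\<beta> / (\<beta> - 1)))"
  proof (rule add_mono)
    show "11 * (2 * Q / (\<beta> - 1)) \<le> 22 * (Q * (\<beta> / (\<beta> - 1)))"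
      using \<beta> Q0 mult_left_mono[of 1 \<beta> Q] by (simp add: divide_right_mono)
    show "64 * Q \<le> 64 * (Q * (\<beta> / (\<beta> - 1)))"
      using \<beta> Q0 mult_left_mono[of 1 "\<beta> / (\<beta> - 1)" Q] by simp
  qed
  also have "\<dots> \<le> 1612 * (Q * (\<beta> / (\<beta> - 1)))"
  proof -
    have "0 \<le> Q * (\<beta> / (\<beta> - 1))" using \<beta> Q0 by simp
    then show ?thesis by linarith
  qed
  also have "\<dots> = 1612 * (16 / 3) powr \<beta> * (\<beta> / (\<beta> - 1)) * (real m / 2 - 1) powr (- \<beta> + 1)"
    by (simp add: Q_def mult_ac)
  finally show ?thesis .
qed

text \<open>There is at most one column, and its entries have modulus \<open>1\<close>, so the lower
  frame bound holds for every sample.\<close>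

lemma sampling_event_small:
  fixes \<kappa> :: "nat \<Rightarrow> int ^ 'd"
  assumes "m \<le> 2" "n \<ge> 1"
  shows "full_column_rank (lsq_matrix \<kappa> m n X)"
proof (rule frame_full_column_rank)
  fix a :: "nat \<Rightarrow> complex"
  have "{1..m - 1} = {} \<or> {1..m - 1} = {1}" using assms by auto
  then show "real n / 4 * (\<Sum>l\<in>{1..m - 1}. (cmod (a l))\<^sup>2)
      \<le> (\<Sum>i<n. (cmod (\<Sum>l\<in>{1..m - 1}. a l * cis (freq_dot (\<kappa> l) (X (Suc i)))))\<^sup>2)"
    by (elim disjE) (simp_all add: norm_mult mult_right_mono)
qed (use assms in simp)

section \<open>Assembly of the two events\<close>

lemma sampling_event_large:
  fixes s r \<beta> :: real and n m :: nat and \<kappa> :: "nat \<Rightarrow> int ^ 'd"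
  assumes s: "s > 0" and \<beta>: "\<beta> = 2 * s / (1 + log 2 (real CARD('d)))" "\<beta> > 1"
    and r: "r > 1" and n: "n \<ge> 3" and m: "m = nat \<lfloor>real n / (10 * r * ln (real n))\<rfloor>" "m \<ge> 3"
    and ord: "weight_ordering s \<kappa>"
  obtains E where "E \<in> sets (torus_sample n :: (nat \<Rightarrow> real ^ 'd) measure)"
    "measure (torus_sample n) E \<le> 3 * real n powr (1 - r)"
    "\<forall>X\<in>space (torus_sample n) - E. full_column_rank (lsq_matrix \<kappa> m n X) \<and>
      (\<forall>f\<in>Hmix_unit_ball s. \<forall>x. (cmod (f x - lsq_operator \<kappa> m n X f x))\<^sup>2
        \<le> 1612 * (16 / 3) powr \<beta> * (\<beta> / (\<beta> - 1)) * (real m / 2 - 1) powr (- \<beta> + 1))"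
proof -
  let ?M = "torus_sample n :: (nat \<Rightarrow> real ^ 'd) measure"
  interpret prob_space ?M by (rule prob_space_torus_sample)
  define \<sigma> where "\<sigma> = (\<lambda>l. 1 / mix_weight (2 * s) (\<kappa> l))"
  define y where "y = r * ln (real n)"
  define B where "B = tail_bound \<beta> m"
  have F: "10 * y * real m \<le> real n" and y2: "2 \<le> y"
    unfolding y_def using sampling_size_bounds[OF r n m] by auto
  have n0: "0 < real n" using n by simp
  have inj: "inj_on \<kappa> {1..}" using ord by (simp add: weight_ordering_def bij_betw_def)
  have \<sigma>0: "0 < \<sigma> l" for l by (simp add: \<sigma>_def)
  have tail: "sum \<sigma> {m..N} \<le> B" for N
    unfolding \<sigma>_def B_def using m by (intro sum_weights_tail_le[OF ord s _ \<beta>]) auto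
  have B0: "0 < B" using tail[of m] \<sigma>0[of m] by simp
  have sm: "summable \<sigma>" unfolding \<sigma>_def by (rule summable_weights[OF ord s \<beta>])
  \<comment> \<open>The cut depends on the weights only, not on \<open>f\<close> or the sample, so
    one event serves the whole ball.\<close>
  obtain M where M: "m \<le> Suc M" "\<And>N. sum \<sigma> {Suc M..N} \<le> B / real n"
  proof -
    from sm have "\<forall>e>0. \<exists>N. \<forall>k\<ge>N. \<forall>l. norm (sum \<sigma> {k..<l}) < e" by (simp add: summable_Cauchy)
    then obtain N0 where N0: "\<And>k l. k \<ge> N0 \<Longrightarrow> norm (sum \<sigma> {k..<l}) < B / real n"
      using B0 n0 by (metis divide_pos_pos)
    show ?thesis
    proof (rule that[of "m + N0"])
      show "sum \<sigma> {Suc (m + N0)..N} \<le> B / real n" for N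
        using N0[of "Suc (m + N0)" "Suc N"] by (simp add: atLeastLessThanSuc_atLeastAtMost)
    qed simp
  qed
  \<comment> \<open>The summand \<open>B / n\<close> keeps the factor \<open>B / \<tau>\<close> in the failure probability below \<open>n\<close>.\<close>
  define \<tau> where "\<tau> = \<sigma> m + B / real n"
  have \<tau>0: "0 < \<tau>" using \<sigma>0[of m] B0 n0 by (simp add: \<tau>_def add_pos_pos)
  \<comment> \<open>This is the requirement that the ratio \<open>\<rho> = \<tau> / B\<close> be at
    most \<open>2\<close>.\<close>
  have \<tau>2: "\<tau> \<le> 2 * B"
  proof -
    have "B / real n \<le> B" using B0 n by (simp add: field_simps)
    then show ?thesis using tail[of m] by (simp add: \<tau>_def)
  qed
  have \<sigma>\<tau>: "\<sigma> l \<le> \<tau>" if "l \<in> {m..M}" for l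
  proof -
    have "mix_weight s (\<kappa> m) \<le> mix_weight s (\<kappa> l)"
      using ord that m(2) by (auto simp: weight_ordering_def mono_on_def)
    then have "mix_weight s (\<kappa> m) powr 2 \<le> mix_weight s (\<kappa> l) powr 2"
      by (intro powr_mono2) auto
    moreover have "mix_weight s k powr 2 = mix_weight (2 * s) k" for k :: "int ^ 'd"
      using mix_weight_eq_powr[of s k] mix_weight_eq_powr[of "2 * s" k] by (simp add: powr_powr mult.commute)
    ultimately have "\<sigma> l \<le> \<sigma> m" unfolding \<sigma>_def by (intro divide_left_mono) auto
    then show ?thesis using B0 n0 by (simp add: \<tau>_def add_increasing2)
  qed
  have K1: "m - 1 \<ge> 1" using m(2) by simp
  have "10 * y * real (m - 1) \<le> 10 * y * real m" using y2 by (intro mult_left_mono) auto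
  then have FK: "10 * y * real (m - 1) \<le> real n" using F by linarith
  obtain p1 where p1: "p1 > 0" "even p1" "2 * real (m - 1) * real p1 \<le> 3 / 4 * real n"
    "2 * real (m - 1) * exp (real n / (5 * real (m - 1)) - real p1) \<le> real n * exp (- y)"
    by (rule lower_moment_order[OF K1 FK y2])
  obtain E1 where E1: "E1 \<in> sets ?M"
    "measure ?M E1 \<le> 2 * real (m - 1) * exp (real n / (5 * real (m - 1)) - real p1)"
    "\<forall>X\<in>space ?M - E1. \<forall>a. real n / 4 * (\<Sum>l\<in>{1..m - 1}. (cmod (a l))\<^sup>2)
      \<le> (\<Sum>i<n. (cmod (\<Sum>l\<in>{1..m - 1}. a l * cis (freq_dot (\<kappa> l) (X (Suc i)))))\<^sup>2)"
    by (rule lower_frame_event[OF inj K1 p1(1-3)])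
  \<comment> \<open>The first summand cancels the growth term of the moment bound and the second
    leaves \<open>exp (- y)\<close>, which is \<open>n powr (- r)\<close>. Rounding to an even order
    costs at most \<open>2\<close>, hence the \<open>y + 2\<close> below.\<close>
  define q where "q = real n * \<tau> / (5 * B) + y"
  define p2 where "p2 = 2 * nat \<lceil>q / 2\<rceil>"
  have q0: "0 < q" using n0 \<tau>0 B0 y2 by (simp add: q_def add_pos_pos)
  have p2: "p2 > 0" "even p2" and p2q: "q \<le> real p2" "real p2 \<le> q + 2"
    using q0 unfolding p2_def by (simp, simp, linarith, linarith)
  define v where "v = real n * \<tau> + 2 * B * (y + 2)"
  have v: "2 * B * real p2 \<le> v"
  proof -
    have "2 * B * real p2 \<le> 2 * B * (q + 2)" using p2q B0 by (intro mult_left_mono) auto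
    also have "\<dots> = 2 / 5 * (real n * \<tau>) + 2 * B * (y + 2)" using B0 by (simp add: q_def field_simps)
    also have "\<dots> \<le> v" using n0 \<tau>0 by (simp add: v_def)
    finally show ?thesis .
  qed
  have sub: "finite {m..M}" "{m..M} \<subseteq> {1..}" using m(2) by auto
  obtain E2 where E2: "E2 \<in> sets ?M"
    "measure ?M E2 \<le> 2 * (B / \<tau>) * exp (real n * \<tau> / (5 * B) - real p2)"
    "\<forall>X\<in>space ?M - E2. \<forall>c. (\<Sum>l\<in>{m..M}. (cmod (c l))\<^sup>2 * mix_weight (2 * s) (\<kappa> l)) \<le> 1 \<longrightarrow>
      (\<Sum>i<n. (cmod (\<Sum>l\<in>{m..M}. c l * cis (freq_dot (\<kappa> l) (X (Suc i)))))\<^sup>2) \<le> real n * \<tau> + v"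
    by (rule upper_frame_event[OF inj sub p2 \<sigma>\<tau>[unfolded \<sigma>_def] tail[unfolded \<sigma>_def] B0 \<tau>0 \<tau>2 v])
  have ey: "real n * exp (- y) = real n powr (1 - r)"
    using n0 by (simp add: y_def powr_def exp_diff exp_minus field_simps flip: exp_add)
  have m1: "measure ?M E1 \<le> real n powr (1 - r)" using E1(2) p1(4) ey by linarith
  have m2: "measure ?M E2 \<le> 2 * real n powr (1 - r)"
  proof -
    have "B / real n \<le> \<tau>" using \<sigma>0[of m] by (simp add: \<tau>_def)
    then have "B / \<tau> \<le> real n" using n0 \<tau>0 by (simp add: field_simps)
    moreover have "real n * \<tau> / (5 * B) - real p2 \<le> - y" using p2q by (simp add: q_def)
    ultimately have "2 * (B / \<tau>) * exp (real n * \<tau> / (5 * B) - real p2) \<le> 2 * real n * exp (- y)"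
      using B0 \<tau>0 by (intro mult_mono) auto
    then show ?thesis using E2(2) ey by linarith
  qed
  show ?thesis
  proof (rule that[of "E1 \<union> E2"])
    show "E1 \<union> E2 \<in> sets ?M" using E1 E2 by auto
    show "measure ?M (E1 \<union> E2) \<le> 3 * real n powr (1 - r)"
      using measure_Un_le[OF E1(1) E2(1)] m1 m2 by linarith
    show "\<forall>X\<in>space ?M - (E1 \<union> E2). full_column_rank (lsq_matrix \<kappa> m n X) \<and>
      (\<forall>f\<in>Hmix_unit_ball s. \<forall>x. (cmod (f x - lsq_operator \<kappa> m n X f x))\<^sup>2
        \<le> 1612 * (16 / 3) powr \<beta> * (\<beta> / (\<beta> - 1)) * (real m / 2 - 1) powr (- \<beta> + 1))"
    proof (intro ballI conjI allI)
      fix X assume X: "X \<in> space ?M - (E1 \<union> E2)"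
      have low: "real n / 4 * (\<Sum>l\<in>{1..m - 1}. (cmod (a l))\<^sup>2)
        \<le> (\<Sum>i<n. (cmod (\<Sum>l\<in>{1..m - 1}. a l * cis (freq_dot (\<kappa> l) (X (Suc i)))))\<^sup>2)" for a
        using E1(3) X by blast
      have n0': "n > 0" using n by simp
      show "full_column_rank (lsq_matrix \<kappa> m n X)" by (rule frame_full_column_rank[OF n0' low])
      fix f :: "real ^ 'd \<Rightarrow> complex" and x assume f: "f \<in> Hmix_unit_ball s"
      have up: "(\<Sum>i<n. (cmod (\<Sum>l\<in>{m..M}. c l * cis (freq_dot (\<kappa> l) (X (Suc i)))))\<^sup>2) \<le> real n * \<tau> + v"
        if "(\<Sum>l\<in>{m..M}. (cmod (c l))\<^sup>2 * mix_weight (2 * s) (\<kappa> l)) \<le> 1" for c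
        using E2(3) X that by blast
      have "m \<ge> 2" using m(2) by simp
      from lsq_error_bound[OF f ord sm[unfolded \<sigma>_def] n0' this low up tail[unfolded \<sigma>_def] M[unfolded \<sigma>_def]]
      have "(cmod (f x - lsq_operator \<kappa> m n X f x))\<^sup>2
          \<le> 2 * B + 8 * real (m - 1) / real n * (2 * (real n * \<tau> + v) + 2 * B)" .
      also have "\<dots> \<le> 1612 * (16 / 3) powr \<beta> * (\<beta> / (\<beta> - 1)) * (real m / 2 - 1) powr (- \<beta> + 1)"
      proof (rule error_constant_le[OF \<beta>(2) m(2) F y2 _ B_def])
        show "\<sigma> m \<le> (9 / real m) powr \<beta>"
          unfolding \<sigma>_def using m(2) by (intro weight_ordering_decay[OF ord s _ \<beta>(1)]) simp
        show "real n * \<tau> + v = 2 * (real n * \<sigma> m + B) + 2 * B * (y + 2)"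
          using n0 by (simp add: v_def \<tau>_def distrib_left)
      qed
      finally show "(cmod (f x - lsq_operator \<kappa> m n X f x))\<^sup>2
        \<le> 1612 * (16 / 3) powr \<beta> * (\<beta> / (\<beta> - 1)) * (real m / 2 - 1) powr (- \<beta> + 1)" .
    qed
  qed
qed

theorem theorem7p8:
  fixes s r \<beta> :: real and n m :: nat and \<kappa> :: "nat \<Rightarrow> int ^ 'd"
  assumes "s > (1 + log 2 (real CARD('d))) / 2"
    and "\<beta> = 2 * s / (1 + log 2 (real CARD('d)))"
    and "r > 1"
    and "n \<ge> 3"
    and "m = nat \<lfloor>real n / (10 * r * ln (real n))\<rfloor>"
    and "weight_ordering s \<kappa>"
  shows "measure (\<Pi>\<^sub>M j\<in>{1..n}. (torus_measure :: (real ^ 'd) measure))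
           {X \<in> space (\<Pi>\<^sub>M j\<in>{1..n}. (torus_measure :: (real ^ 'd) measure)).
              full_column_rank (lsq_matrix \<kappa> m n X) \<and>
              (SUP f\<in>Hmix_unit_ball s. (torus_Linf_norm (\<lambda>x. f x - lsq_operator \<kappa> m n X f x))\<^sup>2)
                \<le> ereal (1612 * (16 / 3) powr \<beta> * (\<beta> / (\<beta> - 1)))
                   * neg_powr (real m / 2 - 1) (- \<beta> + 1)}
         \<ge> 1 - 3 * real n powr (1 - r)"
  proof -
  let ?M = "torus_sample n :: (nat \<Rightarrow> real ^ 'd) measure"
  let ?Ev = "{X \<in> space ?M. full_column_rank (lsq_matrix \<kappa> m n X) \<and>
              (SUP f\<in>Hmix_unit_ball s. (torus_Linf_norm (\<lambda>x. f x - lsq_operator \<kappa> m n X f x))\<^sup>2)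
                \<le> ereal (1612 * (16 / 3) powr \<beta> * (\<beta> / (\<beta> - 1)))
                   * neg_powr (real m / 2 - 1) (- \<beta> + 1)}"
  interpret prob_space ?M by (rule prob_space_torus_sample)
  have \<alpha>: "0 < 1 + log 2 (real CARD('d))"
  proof -
    have "0 \<le> log 2 (real CARD('d))" by (simp add: Suc_leI)
    then show ?thesis by linarith
  qed
  have s0: "s > 0" using \<alpha> by (intro less_trans[OF _ assms(1)]) simp
  have \<beta>1: "\<beta> > 1" unfolding assms(2) using assms(1) \<alpha> by (simp add: field_simps)
  \<comment> \<open>Strict positivity matters for \<open>m \<le> 2\<close>: an \<open>ereal\<close>
    product of \<open>0\<close> and \<open>\<infinity>\<close> would be \<open>0\<close>.\<close>
  have C0: "0 < 1612 * (16 / 3) powr \<beta> * (\<beta> / (\<beta> - 1))" using \<beta>1 by simp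
  have "1 - 3 * real n powr (1 - r) \<le> measure ?M ?Ev"
  proof (cases "m \<le> 2")
    case True
    then have "neg_powr (real m / 2 - 1) (- \<beta> + 1) = \<infinity>" by (simp add: neg_powr_def)
    moreover have "full_column_rank (lsq_matrix \<kappa> m n X)" for X
      by (rule sampling_event_small[OF True]) (use assms(4) in simp)
    ultimately have "?Ev = space ?M" using C0 by auto
    then show ?thesis by (simp only: prob_space) simp
  next
    case False
    then have m3: "m \<ge> 3" by simp
    define c where "c = 1612 * (16 / 3) powr \<beta> * (\<beta> / (\<beta> - 1)) * (real m / 2 - 1) powr (- \<beta> + 1)"
    have c0: "0 \<le> c" unfolding c_def by (rule mult_nonneg_nonneg[OF less_imp_le[OF C0]]) simp
    have c: "ereal (1612 * (16 / 3) powr \<beta> * (\<beta> / (\<beta> - 1))) * neg_powr (real m / 2 - 1) (- \<beta> + 1) = ereal c"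
      using m3 by (simp add: neg_powr_def c_def)
    obtain E where E: "E \<in> sets ?M" "measure ?M E \<le> 3 * real n powr (1 - r)"
      "\<forall>X\<in>space ?M - E. full_column_rank (lsq_matrix \<kappa> m n X) \<and>
        (\<forall>f\<in>Hmix_unit_ball s. \<forall>x. (cmod (f x - lsq_operator \<kappa> m n X f x))\<^sup>2 \<le> c)"
      unfolding c_def by (rule sampling_event_large[OF s0 assms(2) \<beta>1 assms(3,4,5) m3 assms(6)])
    have "space ?M - E \<subseteq> ?Ev"
    proof
      fix X assume X: "X \<in> space ?M - E"
      have "\<forall>f\<in>Hmix_unit_ball s. AE x in torus_measure. cmod (f x - lsq_operator \<kappa> m n X f x) \<le> sqrt c"
        using E(3) X by (auto intro!: AE_I2 real_le_rsqrt)
      then show "X \<in> ?Ev" unfolding c using E(3) X SUP_lsq_error_le_iff[OF c0, where s = s and \<kappa> = \<kappa> and m = m and n = n and X = X] by blast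
    qed
    \<comment> \<open>A nonmeasurable set has \<open>measure\<close> \<open>0\<close>, so the
      inclusion alone would not give the probability bound.\<close>
    moreover have "?Ev \<in> sets ?M" unfolding c by (rule lsq_event_measurable[OF c0])
    ultimately have "prob (space ?M - E) \<le> prob ?Ev" by (rule finite_measure_mono)
    moreover have "prob (space ?M - E) = 1 - prob E" by (rule prob_compl[OF E(1)])
    ultimately show ?thesis using E(2) by linarith
  qed
  then show ?thesis by simp
qed


end
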